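(* Let $\omega\subset\mathbb{R}^2$ be a bounded Lipschitz domain, and let $\overline{Q}_2^\star$, $Q_2^*$, $F_0$ be as defined in the context. Let $$\mathcal{I}_{\rm lKi}(v)=\begin{cases}\frac12\int_\omega\overline{Q}_2^\star(-\nabla^2v)\,dx & \text{if } v\in W^{2,2}_{\rm sh}(\omega),\\ \infty&\text{otherwise.}\end{cases}$$ Up to the addition of an affine transformation, the minimisers of $\mathcal{I}_{\rm lKi}$ are of the form $$v(x)=\tfrac12x^\top Fx,\qquad F\in\mathcal{N}:=\operatorname{argmin}\{Q_2^*(F-F_0):F\in\mathbb{R}^{2\times2}_{\rm sym},\ \det F=0\}.$$
   Context: $W^{2,2}_{\rm sh}(\omega)=\{v\in W^{2,2}(\omega;\mathbb{R}):\det\nabla^2v=0\text{ a.e. in }\omega\}$. Data: for a.e. $t\in(-1/2,1/2)$, $Q_2(t,\cdot)$ is a quadratic form on $\mathbb{R}^{2\times2}$ vanishing on antisymmetric matrices, and there are constants $c,C>0$ such that for a.e. $t$: $Q_2(t,G)\le C|G|^2$ for all $G\in\mathbb{R}^{2\times 2}$ and $Q_2(t,G)\ge c|G|^2$ for all $G\in\mathbb{R}^{2\times2}_{\rm sym}$. Moreover $\check B\in L^\infty((-1/2,1/2);\mathbb{R}^{2\times2}_{\rm sym})$. Set $$\overline{Q}_2^\star(F)=\min_{E\in\mathbb{R}^{2\times2}_{\rm sym}}\int_{-1/2}^{1/2}Q_2(t,E+tF+\check B(t))\,dt .$$ Identify $A\in\mathbb{R}^{2\times2}_{\rm sym}$ with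 $a=(A_{11},A_{22},A_{12})\in\mathbb{R}^3$ (and likewise $\check B(t)$ with $b(t)$). Let $M(t)\in\mathbb{R}^{3\times3}$ be the symmetric positive definite matrix with $Q_2(t,A)=a^\top M(t)a$ for all $A\in\mathbb{R}^{2\times2}_{\rm sym}$. Put $M_i=\int_{-1/2}^{1/2}t^iM(t)\,dt$ for $i=0,1,2$ and $M^*=M_2-M_1M_0^{-1}M_1$; $M_0$ and $M^*$ are positive definite. Let $\mathcal{L}_i$ and $\mathcal{L}_*$ be the linear maps on $\mathbb{R}^{2\times2}_{\rm sym}$ corresponding, under the identification, to $M_i$ and $M^*$, and let $Q_2^*(A)=a^\top M^*a$. Let $B_1,B_2\in\mathbb{R}^{2\times2}_{\rm sym}$ be the matrices corresponding to $b_1=\int_{-1/2}^{1/2}M(t)b(t)\,dt$ and $b_2=\int_{-1/2}^{1/2}tM(t)b(t)\,dt$. Finally, $F_0=\mathcal{L}_*^{-1}(\mathcal{L}_1\mathcal{L}_0^{-1}B_1-B_2)$.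
   Formalization: The sign is corrected: minimisers are v(x) = −½xᵀFx plus affine, F in N, since the functional evaluates the form at −∇²v; the printed +½xᵀFx fails e.g. for Q₂(t,G)=|sym G|² and B̌(t)=t·diag(1,0). *)

theory Defs
  imports "HOL-Analysis.Analysis"
begin

section \<open>Sobolev functions on an open subset of Euclidean space\<close>

definition partial :: "'n::finite \<Rightarrow> (real^'n \<Rightarrow> real) \<Rightarrow> real^'n \<Rightarrow> real" where
  "partial i f x = frechet_derivative f (at x) (axis i 1)"

text \<open>Iterated classical partial derivatives; a multi-index is given by the list of its directions.\<close>

primrec partials :: "'n::finite list \<Rightarrow> (real^'n \<Rightarrow> real) \<Rightarrow> real^'n \<Rightarrow> real" where
  "partials [] f = f"
| "partials (i # is) f = partial i (partials is f)"

primrec Ck :: "nat \<Rightarrow> (real^'n::finite \<Rightarrow> real) \<Rightarrow> bool" where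
  "Ck 0 f \<longleftrightarrow> continuous_on UNIV f"
| "Ck (Suc k) f \<longleftrightarrow> f differentiable_on UNIV \<and> (\<forall>i. Ck k (partial i f))"

definition test_function :: "(real^'n::finite) set \<Rightarrow> (real^'n \<Rightarrow> real) \<Rightarrow> bool" where
  "test_function \<omega> \<phi> \<longleftrightarrow>
     (\<forall>k. Ck k \<phi>) \<and> compact (closure {x. \<phi> x \<noteq> 0}) \<and> closure {x. \<phi> x \<noteq> 0} \<subseteq> \<omega>"

definition locally_integrable :: "(real^'n::finite) set \<Rightarrow> (real^'n \<Rightarrow> real) \<Rightarrow> bool" where
  "locally_integrable \<omega> f \<longleftrightarrow> (\<forall>K. compact K \<and> K \<subseteq> \<omega> \<longrightarrow> integrable (lebesgue_on K) f)"

definition has_weak_derivative ::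
    "(real^'n::finite) set \<Rightarrow> 'n list \<Rightarrow> (real^'n \<Rightarrow> real) \<Rightarrow> (real^'n \<Rightarrow> real) \<Rightarrow> bool" where
  "has_weak_derivative \<omega> is v g \<longleftrightarrow>
     locally_integrable \<omega> v \<and> locally_integrable \<omega> g \<and>
     (\<forall>\<phi>. test_function \<omega> \<phi> \<longrightarrow>
        (LINT x|lebesgue_on \<omega>. v x * partials is \<phi> x) =
        (-1) ^ length is * (LINT x|lebesgue_on \<omega>. g x * \<phi> x))"

text \<open>Elements of Lebesgue and Sobolev spaces are represented by functions on the whole space;
  only their values almost everywhere in \<open>\<omega>\<close> matter.\<close>

definition L2_on :: "(real^'n::finite) set \<Rightarrow> (real^'n \<Rightarrow> real) \<Rightarrow> bool" where
  "L2_on \<omega> f \<longleftrightarrow>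
     f \<in> borel_measurable (lebesgue_on \<omega>) \<and> integrable (lebesgue_on \<omega>) (\<lambda>x. (f x)\<^sup>2)"

definition W22 :: "(real^'n::finite) set \<Rightarrow> (real^'n \<Rightarrow> real) set" where
  "W22 \<omega> = {v. \<forall>is. length is \<le> 2 \<longrightarrow> (\<exists>g. L2_on \<omega> g \<and> has_weak_derivative \<omega> is v g)}"

text \<open>The weak Hessian is unique up to null sets; some representative is chosen.\<close>

definition weak_hessian ::
    "(real^'n::finite) set \<Rightarrow> (real^'n \<Rightarrow> real) \<Rightarrow> real^'n \<Rightarrow> real^'n^'n" where
  "weak_hessian \<omega> v x = (\<chi> i j. (SOME g. has_weak_derivative \<omega> [i, j] v g) x)"

definition W22sh :: "(real^2) set \<Rightarrow> (real^2 \<Rightarrow> real) set" where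
  "W22sh \<omega> = {v \<in> W22 \<omega>. AE x in lebesgue_on \<omega>. det (weak_hessian \<omega> v x) = 0}"

text \<open>Near each boundary point \<open>p\<close>, in coordinates \<open>(e, n)\<close> centred at \<open>p\<close>, the set lies on one
  side of the graph of a Lipschitz function.\<close>

definition lipschitz_boundary :: "(real^2) set \<Rightarrow> bool" where
  "lipschitz_boundary \<omega> \<longleftrightarrow>
     (\<forall>p\<in>frontier \<omega>. \<exists>e n. norm e = 1 \<and> norm n = 1 \<and> e \<bullet> n = 0 \<and>
        (\<exists>r>0. \<exists>L. \<exists>\<gamma> :: real \<Rightarrow> real. L-lipschitz_on UNIV \<gamma> \<and>
           \<omega> \<inter> ball p r = {x \<in> ball p r. n \<bullet> (x - p) > \<gamma> (e \<bullet> (x - p))}))"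

definition bounded_lipschitz_domain :: "(real^2) set \<Rightarrow> bool" where
  "bounded_lipschitz_domain \<omega> \<longleftrightarrow>
     \<omega> \<noteq> {} \<and> open \<omega> \<and> connected \<omega> \<and> bounded \<omega> \<and> lipschitz_boundary \<omega>"

section \<open>Quadratic forms and the data\<close>

definition quadratic_form :: "('a::real_vector \<Rightarrow> real) \<Rightarrow> bool" where
  "quadratic_form q \<longleftrightarrow> (\<exists>b. bilinear b \<and> (\<forall>x y. b x y = b y x) \<and> (\<forall>x. q x = b x x))"

definition sym_matrices :: "(real^'n::finite^'n) set" where
  "sym_matrices = {A. transpose A = A}"

abbreviation thickness :: "real measure" where
  "thickness \<equiv> lebesgue_on {-1/2<..<1/2}"

text \<open>The norm of \<^typ>\<open>real^2^2\<close> is the Frobenius norm. Measurability of \<open>Q\<close> in \<open>t\<close> is the implicit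
  assumption which makes the integrals over \<open>t\<close> meaningful.\<close>

definition admissible_form :: "real \<Rightarrow> real \<Rightarrow> (real \<Rightarrow> real^2^2 \<Rightarrow> real) \<Rightarrow> bool" where
  "admissible_form c C Q \<longleftrightarrow>
     (\<forall>G. (\<lambda>t. Q t G) \<in> borel_measurable thickness) \<and>
     (AE t in thickness.
        quadratic_form (Q t) \<and>
        (\<forall>G. transpose G = - G \<longrightarrow> Q t G = 0) \<and>
        (\<forall>G. Q t G \<le> C * (norm G)\<^sup>2) \<and>
        (\<forall>G\<in>sym_matrices. Q t G \<ge> c * (norm G)\<^sup>2))"

definition Linf_sym :: "(real \<Rightarrow> real^2^2) \<Rightarrow> bool" where
  "Linf_sym B \<longleftrightarrow>
     B \<in> borel_measurable thickness \<and> (AE t in thickness. B t \<in> sym_matrices) \<and>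
     (\<exists>K. AE t in thickness. norm (B t) \<le> K)"

text \<open>Under \<^const>\<open>admissible_form\<close> and \<^const>\<open>Linf_sym\<close> the infimum is attained, by coercivity.\<close>

definition Qbar :: "(real \<Rightarrow> real^2^2 \<Rightarrow> real) \<Rightarrow> (real \<Rightarrow> real^2^2) \<Rightarrow> real^2^2 \<Rightarrow> real" where
  "Qbar Q B F = (INF E\<in>sym_matrices. LINT t|thickness. Q t (E + t *\<^sub>R F + B t))"

section \<open>The reduced form in coordinates\<close>

definition coords :: "real^2^2 \<Rightarrow> real^3" where
  "coords A = vector [A$1$1, A$2$2, A$1$2]"

definition of_coords :: "real^3 \<Rightarrow> real^2^2" where
  "of_coords a = vector [vector [a$1, a$3], vector [a$3, a$2]]"

definition form_matrix :: "(real^2^2 \<Rightarrow> real) \<Rightarrow> real^3^3" where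
  "form_matrix q = (THE M. transpose M = M \<and> (\<forall>a. a \<noteq> 0 \<longrightarrow> a \<bullet> (M *v a) > 0) \<and>
     (\<forall>A\<in>sym_matrices. q A = coords A \<bullet> (M *v coords A)))"

definition moment :: "(real \<Rightarrow> real^2^2 \<Rightarrow> real) \<Rightarrow> nat \<Rightarrow> real^3^3" where
  "moment Q i = (LINT t|thickness. t ^ i *\<^sub>R form_matrix (Q t))"

definition moment_star :: "(real \<Rightarrow> real^2^2 \<Rightarrow> real) \<Rightarrow> real^3^3" where
  "moment_star Q = moment Q 2 - moment Q 1 ** matrix_inv (moment Q 0) ** moment Q 1"

definition coord_map :: "real^3^3 \<Rightarrow> real^2^2 \<Rightarrow> real^2^2" where
  "coord_map M A = of_coords (M *v coords A)"

definition coord_map_inv :: "real^3^3 \<Rightarrow> real^2^2 \<Rightarrow> real^2^2" where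
  "coord_map_inv M = inv_into sym_matrices (coord_map M)"

definition Qstar :: "(real \<Rightarrow> real^2^2 \<Rightarrow> real) \<Rightarrow> real^2^2 \<Rightarrow> real" where
  "Qstar Q A = coords A \<bullet> (moment_star Q *v coords A)"

definition B1 :: "(real \<Rightarrow> real^2^2 \<Rightarrow> real) \<Rightarrow> (real \<Rightarrow> real^2^2) \<Rightarrow> real^2^2" where
  "B1 Q B = of_coords (LINT t|thickness. form_matrix (Q t) *v coords (B t))"

definition B2 :: "(real \<Rightarrow> real^2^2 \<Rightarrow> real) \<Rightarrow> (real \<Rightarrow> real^2^2) \<Rightarrow> real^2^2" where
  "B2 Q B = of_coords (LINT t|thickness. t *\<^sub>R (form_matrix (Q t) *v coords (B t)))"

definition F0 :: "(real \<Rightarrow> real^2^2 \<Rightarrow> real) \<Rightarrow> (real \<Rightarrow> real^2^2) \<Rightarrow> real^2^2" where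
  "F0 Q B = coord_map_inv (moment_star Q)
     (coord_map (moment Q 1) (coord_map_inv (moment Q 0) (B1 Q B)) - B2 Q B)"

section \<open>The functional and the optimal curvatures\<close>

definition I_lKi ::
    "(real \<Rightarrow> real^2^2 \<Rightarrow> real) \<Rightarrow> (real \<Rightarrow> real^2^2) \<Rightarrow> (real^2) set \<Rightarrow> (real^2 \<Rightarrow> real) \<Rightarrow> ereal" where
  "I_lKi Q B \<omega> v =
     (if v \<in> W22sh \<omega>
      then ereal (1/2 * (LINT x|lebesgue_on \<omega>. Qbar Q B (- weak_hessian \<omega> v x)))
      else \<infinity>)"

text \<open>The optimal values of the argument of \<^const>\<open>Qbar\<close>, hence of \<^emph>\<open>minus\<close> the Hessian of a
  minimiser: up to an additive constant, \<open>Qbar Q B F = Qstar Q (F - F0 Q B)\<close> for symmetric \<open>F\<close>.\<close>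

definition opt_curvatures :: "(real \<Rightarrow> real^2^2 \<Rightarrow> real) \<Rightarrow> (real \<Rightarrow> real^2^2) \<Rightarrow> (real^2^2) set" where
  "opt_curvatures Q B =
     {F. is_arg_min (\<lambda>F. Qstar Q (F - F0 Q B)) (\<lambda>F. F \<in> sym_matrices \<and> det F = 0) F}"

end

theory Submission
  imports Defs "HOL-Complex_Analysis.Great_Picard"
begin

text \<open>
  Completing the square in the relaxation variable gives \<open>Qbar Q B F = Qstar Q (F - F0 Q B) + const\<close>
  for symmetric \<open>F\<close>, so \<open>v\<close> is a minimiser iff minus its weak Hessian lies almost everywhere in the
  set \<open>N\<close> of optimal curvatures. It remains to see that such a Hessian is constant, even when \<open>N\<close> is
  infinite.

  A nonzero element of \<open>N\<close> is the nearest point to \<open>F0\<close> on a line spanned by some \<open>n \<otimes> n\<close>; the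
  directions \<open>n\<close> which occur are the zeros of a nonnegative binary quartic. Hence either \<open>N\<close> has at most
  two elements, whose difference is then invertible, or the quartic vanishes identically. In the
  first case the Hessian is \<open>F1 + \<eta> (F2 - F1)\<close> for a function \<open>\<eta>\<close>, and since its rows are curl-free, the
  weak gradient of \<open>\<eta>\<close> vanishes. In the second case all elements of \<open>N\<close> satisfy one linear equation with
  definite coefficients, so the Hessian satisfies a second order elliptic equation with constant
  coefficients. Together with \<open>det = 0\<close> this says that a complex combination \<open>f\<close> of the second
  derivatives is weakly holomorphic in suitable linear coordinates and has constant modulus. Mollifying \<open>f\<close> gives
  uniformly bounded holomorphic functions; by Montel's theorem they subconverge, and the limit is
  a holomorphic representative of \<open>f\<close>, which is constant by the maximum principle.
\<close>

section \<open>Smooth functions\<close>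

text \<open>The constraint det = 0 is not convex, so strict convexity of \<open>Qstar\<close> does
  not make the optimal curvature unique. A weak Hessian is only square integrable and could a priori
  oscillate inside N; rigidity has to come from its rows being gradients. Two values cannot be mixed
  because their difference has rank two, so they are not rank-one connected. For a continuum of
  values, write B for the scalar product of \<open>Qstar\<close> and q for the common value B(a, a)
  of the nearest points. The degenerate quartic then says B(n \<otimes> n, F0)^2 = q B(n \<otimes>
  n, n \<otimes> n) > 0, so the quadratic form sending n to B(n \<otimes> n, F0) has no real zero:
  this is the ellipticity of the equation. If \<mu> = \<alpha> + i \<tau> is a complex root of this
  form, the normalised operator factors as (d2 - \<mu> d1)(d2 - cnj \<mu> d1), and the combination
  of second derivatives is f = (d2 - cnj \<mu> d1)^2 v. On a Hessian s n \<otimes> n one gets |f| =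
  |s| |n2 - cnj \<mu> n1|^2, the modulus of the elliptic operator applied to v, hence a
  constant.\<close>

lemma partial_eq:
  assumes "(f has_derivative f') (at x)"
  shows "partial i f x = f' (axis i 1)"
  using frechet_derivative_at[OF assms] by (simp add: partial_def)

lemma has_derivative_frechet:
  "f differentiable_on UNIV \<Longrightarrow> (f has_derivative frechet_derivative f (at x)) (at x)"
  by (simp add: differentiable_on_def frechet_derivative_works)

lemma frechet_derivative_partial:
  fixes f :: "real^'n::finite \<Rightarrow> real"
  assumes "f differentiable (at x)"
  shows "frechet_derivative f (at x) h = (\<Sum>i\<in>UNIV. h $ i * partial i f x)"
proof -
  have lin: "linear (frechet_derivative f (at x))"
    using assms by (simp add: linear_frechet_derivative)
  have "h = (\<Sum>i\<in>UNIV. h $ i *\<^sub>R axis i 1)"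
    by (metis (no_types, lifting) basis_expansion scalar_mult_eq_scaleR sum.cong)
  then have "frechet_derivative f (at x) h = frechet_derivative f (at x) (\<Sum>i\<in>UNIV. h $ i *\<^sub>R axis i 1)"
    by simp
  also have "\<dots> = (\<Sum>i\<in>UNIV. h $ i * partial i f x)"
    by (simp add: linear_sum[OF lin] linear_cmul[OF lin] partial_def)
  finally show ?thesis .
qed

lemma has_derivative_partial:
  fixes f :: "real^'n::finite \<Rightarrow> real"
  assumes "f differentiable (at x)"
  shows "(f has_derivative (\<lambda>h. \<Sum>i\<in>UNIV. h $ i * partial i f x)) (at x)"
proof -
  have "frechet_derivative f (at x) = (\<lambda>h. \<Sum>i\<in>UNIV. h $ i * partial i f x)"
    using frechet_derivative_partial[OF assms] by auto
  then show ?thesis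
    using assms by (metis frechet_derivative_works)
qed

section \<open>Closure properties of the classes \<open>Ck\<close>\<close>

lemma Ck_Suc_imp_Ck: "Ck (Suc k) f \<Longrightarrow> Ck k f"
  by (induction k arbitrary: f) (auto intro: differentiable_imp_continuous_on)

lemma Ck_const: "Ck k (\<lambda>x. c)"
proof (induction k arbitrary: c)
  case (Suc k)
  have "partial i (\<lambda>x. c) = (\<lambda>x. 0)" for i :: 'a
    by (rule ext) (use partial_eq[OF has_derivative_const] in auto)
  then show ?case using Suc by (simp add: differentiable_on_def)
qed simp

lemma partial_add:
  assumes "f differentiable_on UNIV" "g differentiable_on UNIV"
  shows "partial i (\<lambda>x. f x + g x) = (\<lambda>x. partial i f x + partial i g x)"
  by (rule ext, subst partial_eq[OF has_derivative_add[OF has_derivative_frechet[OF assms(1)]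
        has_derivative_frechet[OF assms(2)]]]) (simp add: partial_def)

lemma partial_mult:
  assumes "f differentiable_on UNIV" "g differentiable_on UNIV"
  shows "partial i (\<lambda>x. f x * g x) = (\<lambda>x. f x * partial i g x + partial i f x * g x)"
  by (rule ext, subst partial_eq[OF has_derivative_mult[OF has_derivative_frechet[OF assms(1)]
        has_derivative_frechet[OF assms(2)]]]) (simp add: partial_def)

lemma Ck_add: "Ck k f \<Longrightarrow> Ck k g \<Longrightarrow> Ck k (\<lambda>x. f x + g x)"
proof (induction k arbitrary: f g)
  case (Suc k)
  then show ?case by (auto simp: partial_add intro: derivative_intros)
qed (auto intro: continuous_intros)

lemma Ck_mult: "Ck k f \<Longrightarrow> Ck k g \<Longrightarrow> Ck k (\<lambda>x. f x * g x)"
proof (induction k arbitrary: f g)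
  case (Suc k)
  have "Ck k f" "Ck k g" using Suc.prems Ck_Suc_imp_Ck by blast+
  with Suc show ?case by (auto simp: partial_mult intro!: derivative_intros Ck_add)
qed (auto intro: continuous_intros)

lemma Ck_uminus: "Ck k f \<Longrightarrow> Ck k (\<lambda>x. - f x)"
  using Ck_mult[OF Ck_const[of k "-1"], of f] by simp

lemma Ck_diff: "Ck k f \<Longrightarrow> Ck k g \<Longrightarrow> Ck k (\<lambda>x. f x - g x)"
  using Ck_add[OF _ Ck_uminus[of k g], of f] by simp

lemma Ck_power: "Ck k f \<Longrightarrow> Ck k (\<lambda>x. f x ^ n)"
  by (induction n) (auto intro: Ck_mult Ck_const)

lemma Ck_sum: "(\<And>i. i \<in> I \<Longrightarrow> Ck k (f i)) \<Longrightarrow> Ck k (\<lambda>x. \<Sum>i\<in>I. f i x)"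
  by (induction I rule: infinite_finite_induct) (auto intro: Ck_add Ck_const)

lemma Ck_prod: "(\<And>i. i \<in> I \<Longrightarrow> Ck k (f i)) \<Longrightarrow> Ck k (\<lambda>x. \<Prod>i\<in>I. f i x)"
  by (induction I rule: infinite_finite_induct) (auto intro: Ck_mult Ck_const)

lemma has_derivative_component: "((\<lambda>x::real^'n::finite. x $ j) has_derivative (\<lambda>h. h $ j)) (at x)"
  by (rule bounded_linear_imp_has_derivative, rule bounded_linear_vec_nth)

lemma partial_component: "partial i (\<lambda>x. x $ j) x = (if i = j then 1 else 0)"
  by (subst partial_eq[OF has_derivative_component]) (simp add: axis_def)

lemma Ck_component: "Ck k (\<lambda>x::real^'n::finite. x $ j)"
proof (cases k)
  case (Suc m)
  have "partial i (\<lambda>x::real^'n. x $ j) = (\<lambda>x. if i = j then 1 else 0)" for i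
    by (rule ext) (rule partial_component)
  then show ?thesis
    using has_derivative_component Suc
    by (auto simp: Ck_const differentiable_on_def intro!: differentiableI)
qed (auto intro: continuous_intros)

lemma has_derivative_translate:
  assumes "f differentiable_on UNIV"
  shows "((\<lambda>x. f (x - y)) has_derivative frechet_derivative f (at (x - y))) (at x)"
proof -
  have "((\<lambda>x. x - y) has_derivative (\<lambda>h. h)) (at x)"
    by (auto intro!: derivative_eq_intros)
  from has_derivative_compose[OF this has_derivative_frechet[OF assms]] show ?thesis .
qed

lemma partial_translate:
  "f differentiable_on UNIV \<Longrightarrow> partial i (\<lambda>x. f (x - y)) = (\<lambda>x. partial i f (x - y))"
  by (rule ext, subst partial_eq[OF has_derivative_translate]) (simp_all add: partial_def)

lemma differentiable_on_translate:
  "f differentiable_on UNIV \<Longrightarrow> (\<lambda>x. f (x - y)) differentiable_on UNIV"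
  using has_derivative_translate unfolding differentiable_on_def differentiable_def by blast

lemma Ck_translate: "Ck k f \<Longrightarrow> Ck k (\<lambda>x. f (x - y))"
proof (induction k arbitrary: f)
  case 0
  then show ?case
    by simp (rule continuous_on_compose2[of UNIV f], auto intro: continuous_intros)
next
  case (Suc k)
  then show ?case by (auto simp: partial_translate intro: differentiable_on_translate)
qed

text \<open>These functions are stable under differentiation, and every derivative vanishes to infinite
  order at 0.\<close>

definition flat_exp :: "real poly \<Rightarrow> real \<Rightarrow> real" where
  "flat_exp P t = (if t > 0 then poly P (1 / t) * exp (- 1 / t) else 0)"

lemma poly_times_exp_tendsto_0: "((\<lambda>s. poly P s * exp (- s)) \<longlongrightarrow> (0::real)) at_top"
proof -
  have "((\<lambda>s. \<Sum>i\<le>degree P. coeff P i * (s ^ i / exp s)) \<longlongrightarrow> (\<Sum>i\<le>degree P. coeff P i * 0)) at_top"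
    by (intro tendsto_sum tendsto_mult tendsto_const tendsto_power_div_exp_0)
  moreover have "(\<lambda>s. \<Sum>i\<le>degree P. coeff P i * (s ^ i / exp s)) = (\<lambda>s. poly P s * exp (- s))"
    by (rule ext) (simp add: poly_altdef sum_distrib_right exp_minus divide_inverse mult.assoc)
  ultimately show ?thesis by simp
qed

lemma flat_exp_tendsto_0: "(flat_exp P \<longlongrightarrow> 0) (at 0)"
proof -
  have "((\<lambda>t. poly P (inverse t) * exp (- inverse t)) \<longlongrightarrow> 0) (at_right (0::real))"
    by (rule filterlim_compose[OF poly_times_exp_tendsto_0 filterlim_inverse_at_top_right])
  then have "(flat_exp P \<longlongrightarrow> 0) (at_right 0)"
    by (rule Lim_transform_eventually)
      (auto simp: flat_exp_def eventually_at_filter inverse_eq_divide)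
  moreover have "(flat_exp P \<longlongrightarrow> 0) (at_left 0)"
    by (rule Lim_transform_eventually[OF tendsto_const])
      (auto simp: flat_exp_def eventually_at_filter)
  ultimately show ?thesis
    using filterlim_at_split by blast
qed

text \<open>For t > 0 both factors of P(1/t) exp(-1/t) contribute a factor 1/t^2, so differentiation
  acts on the polynomial as P -> X^2 (P - P'). At 0 the difference quotient is again a function of
  this family, with polynomial X P, and tends to 0.\<close>

lemma flat_exp_has_derivative:
  "(flat_exp P has_real_derivative flat_exp ([:0, 0, 1:] * (P - pderiv P)) t) (at t)"
proof -
  consider "t > 0" | "t < 0" | "t = 0" by linarith
  then show ?thesis
  proof cases
    case 1
    have "((\<lambda>t. poly P (1 / t) * exp (- 1 / t)) has_real_derivative
        flat_exp ([:0, 0, 1:] * (P - pderiv P)) t) (at t)"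
      using 1 by (auto intro!: derivative_eq_intros DERIV_chain2[OF poly_DERIV]
          simp: flat_exp_def field_simps power2_eq_square)
    then show ?thesis
      by (rule has_field_derivative_transform_within_open[where S="{0<..}"])
        (use 1 in \<open>auto simp: flat_exp_def\<close>)
  next
    case 2
    have "((\<lambda>t. 0) has_real_derivative flat_exp ([:0, 0, 1:] * (P - pderiv P)) t) (at t)"
      using 2 by (simp add: flat_exp_def)
    then show ?thesis
      by (rule has_field_derivative_transform_within_open[where S="{..<0}"])
        (use 2 in \<open>auto simp: flat_exp_def\<close>)
  next
    case 3
    have "(\<lambda>h. (flat_exp P h - flat_exp P 0) / (h - 0)) = flat_exp (pCons 0 P)"
      by (rule ext) (simp add: flat_exp_def)
    then show ?thesis
      using flat_exp_tendsto_0[of "pCons 0 P"] 3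
      by (simp add: has_field_derivative_iff) (simp add: flat_exp_def)
  qed
qed

text \<open>The derivative replaces P by another polynomial, so the induction on k has to run over
  all P at once.\<close>

lemma Ck_flat_exp_compose:
  assumes "\<And>k. Ck k q"
  shows "Ck k (\<lambda>x. flat_exp P (q x))"
proof -
  have q: "q differentiable_on UNIV" using assms[of 1] by simp
  have der: "((\<lambda>x. flat_exp P (q x)) has_derivative
      (\<lambda>h. frechet_derivative q (at x) h * flat_exp ([:0, 0, 1:] * (P - pderiv P)) (q x))) (at x)" for P x
  proof -
    have "(flat_exp P has_derivative
        (\<lambda>h. h * flat_exp ([:0, 0, 1:] * (P - pderiv P)) (q x))) (at (q x))"
      using flat_exp_has_derivative[of P "q x"]
      by (simp add: has_field_derivative_def mult.commute[of _ "flat_exp _ _"])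
    from has_derivative_compose[OF has_derivative_frechet[OF q] this] show ?thesis .
  qed
  have d: "(\<lambda>x. flat_exp P (q x)) differentiable_on UNIV" for P
    using der by (auto simp: differentiable_on_def intro: differentiableI)
  show ?thesis
  proof (induction k arbitrary: P)
    case 0
    then show ?case using differentiable_imp_continuous_on[OF d] by simp
  next
    case (Suc k)
    have "partial i (\<lambda>x. flat_exp P (q x)) =
        (\<lambda>x. partial i q x * flat_exp ([:0, 0, 1:] * (P - pderiv P)) (q x))" for i
      by (rule ext) (subst partial_eq[OF der], simp add: partial_def)
    moreover have "Ck k (partial i q)" for i using assms[of "Suc k"] by simp
    ultimately show ?case
      using d Suc by (auto intro!: Ck_mult)
  qed
qed

lemma flat_exp_1_pos_iff: "flat_exp 1 t > 0 \<longleftrightarrow> t > 0"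
  and flat_exp_1_nonneg: "flat_exp 1 t \<ge> 0"
  and flat_exp_1_lt: "flat_exp 1 t < 1"
  by (auto simp: flat_exp_def)

lemma Ck_norm_sq: "Ck k (\<lambda>x::real^'n::finite. x \<bullet> x)"
  by (auto simp: inner_vec_def intro!: Ck_sum Ck_mult Ck_component)

section \<open>Symmetry of second partial derivatives\<close>

lemma has_real_derivative_along_axis:
  assumes "f differentiable_on UNIV"
  shows "((\<lambda>s. f (x + s *\<^sub>R axis i 1)) has_real_derivative partial i f (x + s *\<^sub>R axis i 1)) (at s)"
proof -
  have "((\<lambda>s. x + s *\<^sub>R axis i 1) has_derivative (\<lambda>h. h *\<^sub>R axis i 1)) (at s)"
    by (auto intro!: derivative_eq_intros)
  from has_derivative_compose[OF this has_derivative_frechet[OF assms]]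
  have "((\<lambda>s. f (x + s *\<^sub>R axis i 1)) has_derivative
      (\<lambda>h. frechet_derivative f (at (x + s *\<^sub>R axis i 1)) (h *\<^sub>R axis i 1))) (at s)" .
  moreover have "(\<lambda>h. frechet_derivative f (at (x + s *\<^sub>R axis i 1)) (h *\<^sub>R axis i 1)) =
      (*) (partial i f (x + s *\<^sub>R axis i 1))"
    using assms by (auto simp: partial_def differentiable_on_def linear_cmul linear_frechet_derivative)
  ultimately show ?thesis by (simp add: has_field_derivative_def)
qed

text \<open>Two applications of the mean value theorem: along direction i to the increment of f in
  direction j, and then along direction j to \<open>partial i f\<close>.\<close>

lemma second_difference_mean_value:
  assumes "Ck 2 f" "h > 0"
  obtains s t where "0 < s" "s < h" "0 < t" "t < h"
    "f (x + h *\<^sub>R axis i 1 + h *\<^sub>R axis j 1) - f (x + h *\<^sub>R axis i 1) - f (x + h *\<^sub>R axis j 1) + f x =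
     h\<^sup>2 * partial j (partial i f) (x + s *\<^sub>R axis i 1 + t *\<^sub>R axis j 1)"
proof -
  have f: "f differentiable_on UNIV" "partial i f differentiable_on UNIV"
    using assms(1) by (auto simp: numeral_2_eq_2)
  define g where "g s = f (x + h *\<^sub>R axis j 1 + s *\<^sub>R axis i 1) - f (x + s *\<^sub>R axis i 1)" for s
  have "(g has_real_derivative partial i f (x + h *\<^sub>R axis j 1 + s *\<^sub>R axis i 1)
      - partial i f (x + s *\<^sub>R axis i 1)) (at s)" for s
    unfolding g_def by (intro derivative_intros has_real_derivative_along_axis f)
  from MVT2[OF \<open>h > 0\<close> this] obtain s where s: "0 < s" "s < h"
    "g h - g 0 = h * (partial i f (x + h *\<^sub>R axis j 1 + s *\<^sub>R axis i 1) - partial i f (x + s *\<^sub>R axis i 1))"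
    by auto
  from MVT2[OF \<open>h > 0\<close> has_real_derivative_along_axis[OF f(2), of "x + s *\<^sub>R axis i 1" j]]
  obtain t where t: "0 < t" "t < h"
    "partial i f (x + s *\<^sub>R axis i 1 + h *\<^sub>R axis j 1) - partial i f (x + s *\<^sub>R axis i 1) =
     h * partial j (partial i f) (x + s *\<^sub>R axis i 1 + t *\<^sub>R axis j 1)"
    by auto
  show ?thesis
    using that[OF s(1,2) t(1,2)] s(3) t(3) by (simp add: g_def algebra_simps power2_eq_square)
qed

text \<open>The second difference is symmetric in i and j. Expressing it in both orders equates the
  two mixed derivatives at points close to x, and continuity carries this to x.\<close>

lemma partial_commute:
  assumes "Ck 2 f"
  shows "partial i (partial j f) = partial j (partial i f)"
proof (rule ext, rule ccontr)
  fix x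
  assume ne: "partial i (partial j f) x \<noteq> partial j (partial i f) x"
  define e where "e = \<bar>partial i (partial j f) x - partial j (partial i f) x\<bar> / 2"
  have "e > 0" using ne by (simp add: e_def)
  have cont: "continuous_on UNIV (partial k (partial l f))" for k l
    using assms by (simp add: numeral_2_eq_2)
  have "\<exists>d>0. \<forall>y. dist y x < d \<longrightarrow> \<bar>partial k (partial l f) y - partial k (partial l f) x\<bar> < e" for k l
    using cont[of k l] \<open>e > 0\<close> by (auto simp: continuous_on_iff dist_real_def)
  then obtain d1 d2 where d: "d1 > 0" "d2 > 0"
    "\<And>y. dist y x < d1 \<Longrightarrow> \<bar>partial i (partial j f) y - partial i (partial j f) x\<bar> < e"
    "\<And>y. dist y x < d2 \<Longrightarrow> \<bar>partial j (partial i f) y - partial j (partial i f) x\<bar> < e"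
    by metis
  \<comment> \<open>The intermediate points are displaced by less than h in each of two directions,
    hence by less than 2 h in all.\<close>
  define h where "h = min d1 d2 / 2"
  have h: "h > 0" "2 * h \<le> d1" "2 * h \<le> d2" using d by (auto simp: h_def)
  have close: "dist (x + s *\<^sub>R axis k 1 + t *\<^sub>R axis l 1) x < 2 * h"
    if "0 < s" "s < h" "0 < t" "t < h" for s t k l
    using that norm_triangle_ineq[of "s *\<^sub>R axis k 1" "t *\<^sub>R axis l (1::real)"]
    by (simp add: dist_norm norm_axis_1)
  obtain s t where 1: "0 < s" "s < h" "0 < t" "t < h"
    "f (x + h *\<^sub>R axis i 1 + h *\<^sub>R axis j 1) - f (x + h *\<^sub>R axis i 1) - f (x + h *\<^sub>R axis j 1) + f x =
     h\<^sup>2 * partial j (partial i f) (x + s *\<^sub>R axis i 1 + t *\<^sub>R axis j 1)"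
    using second_difference_mean_value[OF assms h(1)] by metis
  obtain s' t' where 2: "0 < s'" "s' < h" "0 < t'" "t' < h"
    "f (x + h *\<^sub>R axis j 1 + h *\<^sub>R axis i 1) - f (x + h *\<^sub>R axis j 1) - f (x + h *\<^sub>R axis i 1) + f x =
     h\<^sup>2 * partial i (partial j f) (x + s' *\<^sub>R axis j 1 + t' *\<^sub>R axis i 1)"
    using second_difference_mean_value[OF assms h(1)] by metis
  have "partial j (partial i f) (x + s *\<^sub>R axis i 1 + t *\<^sub>R axis j 1) =
      partial i (partial j f) (x + s' *\<^sub>R axis j 1 + t' *\<^sub>R axis i 1)"
  proof -
    have "x + h *\<^sub>R axis j 1 + h *\<^sub>R axis i 1 = x + h *\<^sub>R axis i 1 + h *\<^sub>R axis j 1"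
      by (simp only: add.assoc add.commute[of "h *\<^sub>R axis j 1"])
    from 1(5) 2(5)[unfolded this] have "h\<^sup>2 * partial j (partial i f) (x + s *\<^sub>R axis i 1 + t *\<^sub>R axis j 1) =
        h\<^sup>2 * partial i (partial j f) (x + s' *\<^sub>R axis j 1 + t' *\<^sub>R axis i 1)"
      by linarith
    then show ?thesis using h(1) by simp
  qed
  moreover have "\<bar>partial j (partial i f) (x + s *\<^sub>R axis i 1 + t *\<^sub>R axis j 1) - partial j (partial i f) x\<bar> < e"
    by (rule d(4)[OF less_le_trans[OF close[OF 1(1-4)] h(3)]])
  moreover have "\<bar>partial i (partial j f) (x + s' *\<^sub>R axis j 1 + t' *\<^sub>R axis i 1) - partial i (partial j f) x\<bar> < e"
    by (rule d(3)[OF less_le_trans[OF close[OF 2(1-4)] h(2)]])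
  moreover have "\<bar>q - p\<bar> < 2 * e" if "a = b" "\<bar>a - p\<bar> < e" "\<bar>b - q\<bar> < e" for a b p q :: real
    using that by linarith
  ultimately have "\<bar>partial i (partial j f) x - partial j (partial i f) x\<bar> < 2 * e"
    by blast
  then show False by (simp add: e_def)
qed

section \<open>Test functions\<close>

lemma test_functionI:
  assumes "\<And>k. Ck k \<phi>" "compact K" "K \<subseteq> \<omega>" "\<And>x. x \<notin> K \<Longrightarrow> \<phi> x = 0"
  shows "test_function \<omega> \<phi>"
proof -
  have "closure {x. \<phi> x \<noteq> 0} \<subseteq> K"
    using assms by (intro closure_minimal) (auto simp: compact_imp_closed)
  moreover from this have "compact (closure {x. \<phi> x \<noteq> 0})"
    using bounded_subset[OF compact_imp_bounded[OF assms(2)]] by (simp add: compact_eq_bounded_closed)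
  ultimately show ?thesis using assms unfolding test_function_def by blast
qed

lemma test_functionE:
  assumes "test_function \<omega> \<phi>"
  obtains K where "compact K" "K \<subseteq> \<omega>" "\<And>x. x \<notin> K \<Longrightarrow> \<phi> x = 0"
    "\<And>x i. x \<notin> K \<Longrightarrow> partial i \<phi> x = 0"
proof -
  define K where "K = closure {x. \<phi> x \<noteq> 0}"
  have K: "compact K" "K \<subseteq> \<omega>"
    using assms unfolding test_function_def K_def by blast+
  have z: "\<phi> x = 0" if "x \<notin> K" for x
    using that subsetD[OF closure_subset, of x "{x. \<phi> x \<noteq> 0}"]
    by (cases "\<phi> x = 0") (simp_all add: K_def)
  have o: "open (- K)" by (rule open_Compl[OF compact_imp_closed[OF K(1)]])
  have "partial i \<phi> x = 0" if "x \<notin> K" for x i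
  proof -
    have "(\<phi> has_derivative (\<lambda>_. 0)) (at x)"
      by (rule has_derivative_transform_within_open[OF has_derivative_const o])
        (simp_all add: that z)
    from partial_eq[OF this] show ?thesis .
  qed
  from that[OF K z this] show ?thesis .
qed

lemma test_function_Ck: "test_function \<omega> \<phi> \<Longrightarrow> Ck k \<phi>"
  unfolding test_function_def by blast

lemma test_function_differentiable: "test_function \<omega> \<phi> \<Longrightarrow> \<phi> differentiable_on UNIV"
  using test_function_Ck[of _ _ "Suc 0"] by auto

lemma test_function_continuous: "test_function \<omega> \<phi> \<Longrightarrow> continuous_on UNIV \<phi>"
  by (simp add: differentiable_imp_continuous_on test_function_differentiable)

lemma test_function_mono: "test_function \<omega> \<phi> \<Longrightarrow> \<omega> \<subseteq> \<omega>' \<Longrightarrow> test_function \<omega>' \<phi>"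
  unfolding test_function_def by blast

lemma test_function_partial:
  assumes "test_function \<omega> \<phi>"
  shows "test_function \<omega> (partial i \<phi>)"
proof (rule test_functionE[OF assms])
  fix K assume K: "compact K" "K \<subseteq> \<omega>" "\<And>x i. x \<notin> K \<Longrightarrow> partial i \<phi> x = 0"
  have "Ck k (partial i \<phi>)" for k
    using test_function_Ck[OF assms, of "Suc k"] by simp
  then show ?thesis by (rule test_functionI[OF _ K(1,2)]) (rule K(3))
qed

lemma test_function_mult:
  assumes "test_function \<omega> \<phi>" "\<And>k. Ck k f"
  shows "test_function \<omega> (\<lambda>x. f x * \<phi> x)"
proof (rule test_functionE[OF assms(1)])
  fix K assume K: "compact K" "K \<subseteq> \<omega>" "\<And>x. x \<notin> K \<Longrightarrow> \<phi> x = 0"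
  show ?thesis
    by (rule test_functionI[OF Ck_mult[OF assms(2) test_function_Ck[OF assms(1)]] K(1,2)])
      (simp add: K(3))
qed

lemma test_function_translate:
  assumes "test_function A \<phi>" "\<And>x. x \<in> A \<Longrightarrow> x + y \<in> \<omega>"
  shows "test_function \<omega> (\<lambda>x. \<phi> (x - y))"
proof (rule test_functionE[OF assms(1)])
  fix K assume K: "compact K" "K \<subseteq> A" "\<And>x. x \<notin> K \<Longrightarrow> \<phi> x = 0"
  show ?thesis
  proof (rule test_functionI[of _ "(+) y ` K"])
    show "Ck k (\<lambda>x. \<phi> (x - y))" for k
      by (intro Ck_translate test_function_Ck[OF assms(1)])
    show "compact ((+) y ` K)" using K by (intro compact_translation)
    show "(+) y ` K \<subseteq> \<omega>" using assms(2) K(2) by (auto simp: add.commute)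
    show "\<phi> (x - y) = 0" if "x \<notin> (+) y ` K" for x
    proof (rule K(3))
      show "x - y \<notin> K" using that image_eqI[of x "(+) y" "x - y" K] by auto
    qed
  qed
qed

lemma test_function_bounded:
  assumes "test_function \<omega> \<phi>"
  obtains M where "M > 0" "\<And>x. \<bar>\<phi> x\<bar> \<le> M"
proof (rule test_functionE[OF assms])
  fix K assume K: "compact K" "K \<subseteq> \<omega>" "\<And>x. x \<notin> K \<Longrightarrow> \<phi> x = 0"
  have "bounded (\<phi> ` K)"
    using K test_function_continuous[OF assms]
    by (intro compact_imp_bounded compact_continuous_image) (auto intro: continuous_on_subset)
  then obtain M where "M > 0" "\<And>x. x \<in> K \<Longrightarrow> \<bar>\<phi> x\<bar> \<le> M"
    by (auto simp: bounded_pos)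
  then show ?thesis using that[of M] K(3) by (metis abs_zero less_eq_real_def)
qed

text \<open>A compact neighbourhood of the support suffices: points at distance below 1, one of
  which is in the ball around the support, both lie in the ball enlarged by 1, and otherwise both
  values vanish.\<close>

lemma test_function_uniformly_continuous:
  assumes "test_function \<omega> \<phi>" "e > 0"
  obtains d where "d > 0" "\<And>x y. dist x y < d \<Longrightarrow> \<bar>\<phi> x - \<phi> y\<bar> < e"
proof (rule test_functionE[OF assms(1)])
  fix K assume K: "compact K" "K \<subseteq> \<omega>" "\<And>x. x \<notin> K \<Longrightarrow> \<phi> x = 0"
  obtain r where r: "K \<subseteq> cball 0 r"
    using bounded_subset_ballD[OF compact_imp_bounded[OF K(1)], of 0] ball_subset_cball[of 0] by (meson order_trans)
  have "uniformly_continuous_on (cball 0 (r + 1)) \<phi>"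
    by (intro compact_uniformly_continuous continuous_on_subset[OF test_function_continuous[OF assms(1)]]) auto
  then obtain d where d: "d > 0"
    "\<And>x y. x \<in> cball 0 (r + 1) \<Longrightarrow> y \<in> cball 0 (r + 1) \<Longrightarrow> dist x y < d \<Longrightarrow> \<bar>\<phi> x - \<phi> y\<bar> < e"
    using \<open>e > 0\<close> unfolding uniformly_continuous_on_def dist_real_def by metis
  have *: "\<bar>\<phi> x - \<phi> y\<bar> < e" if "dist x y < min d 1" "x \<in> cball 0 r" for x y
    using that d(2)[of x y] norm_triangle_ineq2[of y x] by (auto simp: dist_norm norm_minus_commute)
  have "\<bar>\<phi> x - \<phi> y\<bar> < e" if "dist x y < min d 1" for x y
  proof (cases "x \<in> cball 0 r \<or> y \<in> cball 0 r")
    case True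
    then show ?thesis using that *[of x y] *[of y x] by (auto simp: dist_commute)
  next
    case False
    then have "x \<notin> K" "y \<notin> K" using r by blast+
    then show ?thesis using K(3) assms(2) by simp
  qed
  then show ?thesis using that[of "min d 1"] d(1) by auto
qed

section \<open>Bump functions on balls and boxes\<close>

definition ball_bump :: "real \<Rightarrow> real^'n::finite \<Rightarrow> real" where
  "ball_bump r x = flat_exp 1 (r\<^sup>2 - x \<bullet> x)"

lemma ball_bump_nonneg: "ball_bump r x \<ge> 0"
  by (simp add: ball_bump_def flat_exp_1_nonneg)

lemma ball_bump_pos_iff: "r > 0 \<Longrightarrow> ball_bump r x > 0 \<longleftrightarrow> norm x < r"
  using power_less_imp_less_base[of "norm x" 2 r] power_strict_mono[of "norm x" r 2]
  by (auto simp: ball_bump_def flat_exp_1_pos_iff dot_square_norm)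

lemma test_function_ball_bump:
  assumes "r > 0" "cball 0 r \<subseteq> U"
  shows "test_function U (ball_bump r)"
proof (rule test_functionI[of _ "cball 0 r"])
  show "Ck k (ball_bump r)" for k
    unfolding ball_bump_def by (intro Ck_flat_exp_compose Ck_diff Ck_const Ck_norm_sq)
  show "ball_bump r x = 0" if "x \<notin> cball 0 r" for x
    using that ball_bump_pos_iff[OF assms(1), of x] ball_bump_nonneg[of r x] by auto
qed (use assms in auto)

definition box_bump :: "real^'n::finite \<Rightarrow> real^'n \<Rightarrow> real^'n \<Rightarrow> real" where
  "box_bump a b x = (\<Prod>i\<in>UNIV. flat_exp 1 ((x $ i - a $ i) * (b $ i - x $ i)))"

text \<open>The argument of \<open>flat_exp 1\<close> would also be positive if both of its factors
  were negative; this is excluded by a_i < b_i, which the nonempty box provides.\<close>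

lemma box_bump:
  assumes "box a b \<noteq> {}"
  shows "x \<in> box a b \<Longrightarrow> 0 < box_bump a b x \<and> box_bump a b x \<le> 1"
    and "x \<notin> box a b \<Longrightarrow> box_bump a b x = 0"
proof -
  have ab: "a $ i < b $ i" for i
  proof -
    obtain x where "x \<in> box a b" using assms by blast
    then have "a $ i < x $ i" "x $ i < b $ i" by (auto simp: mem_box_cart)
    then show ?thesis by (rule less_trans)
  qed
  have iff: "flat_exp 1 ((x $ i - a $ i) * (b $ i - x $ i)) > 0 \<longleftrightarrow> a $ i < x $ i \<and> x $ i < b $ i" for i
    using ab[of i] by (auto simp: flat_exp_1_pos_iff zero_less_mult_iff)
  show "0 < box_bump a b x \<and> box_bump a b x \<le> 1" if "x \<in> box a b"
    using that iff flat_exp_1_lt by (auto simp: box_bump_def mem_box_cart less_imp_le intro!: prod_pos prod_le_1)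
  show "box_bump a b x = 0" if x: "x \<notin> box a b"
  proof -
    obtain i where "\<not> (a $ i < x $ i \<and> x $ i < b $ i)"
      using x unfolding mem_box_cart by blast
    then have "flat_exp 1 ((x $ i - a $ i) * (b $ i - x $ i)) = 0"
      using iff[of i] flat_exp_1_nonneg[of "(x $ i - a $ i) * (b $ i - x $ i)"] by linarith
    then show ?thesis unfolding box_bump_def by (intro prod_zero) auto
  qed
qed

text \<open>The functions \<open>1 - (1 - p) ^ n\<close> increase to the indicator of the set where \<open>p > 0\<close>.\<close>

lemma test_function_box_bump_power:
  assumes "box a b \<noteq> {}" "cbox a b \<subseteq> U"
  shows "test_function U (\<lambda>x. 1 - (1 - box_bump a b x) ^ n)"
proof (rule test_functionI[of _ "cbox a b"])
  show "Ck k (\<lambda>x. 1 - (1 - box_bump a b x) ^ n)" for k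
    unfolding box_bump_def
    by (intro Ck_diff Ck_power Ck_prod Ck_flat_exp_compose Ck_const Ck_mult Ck_component)
  show "1 - (1 - box_bump a b x) ^ n = 0" if "x \<notin> cbox a b" for x
  proof -
    have "box_bump a b x = 0"
      using that box_subset_cbox[of a b] by (intro box_bump(2)[OF assms(1)]) blast
    then show ?thesis by simp
  qed
qed (use assms in auto)

lemma box_bump_power_tendsto:
  assumes "box a b \<noteq> {}"
  shows "(\<lambda>n. 1 - (1 - box_bump a b x) ^ n) \<longlonglongrightarrow> indicator (box a b) x"
proof (cases "x \<in> box a b")
  case True
  then have "(\<lambda>n. (1 - box_bump a b x) ^ n) \<longlonglongrightarrow> 0"
    using box_bump(1)[OF assms True] by (intro LIMSEQ_realpow_zero) auto
  from tendsto_diff[OF tendsto_const this, of 1] show ?thesis using True by simp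
qed (use box_bump(2)[OF assms] in simp)

lemma box_bump_power_bound:
  assumes "box a b \<noteq> {}"
  shows "\<bar>1 - (1 - box_bump a b x) ^ n\<bar> \<le> 1"
proof -
  have "0 \<le> box_bump a b x" "box_bump a b x \<le> 1"
    using box_bump[OF assms, of x] by (cases "x \<in> box a b"; simp)+
  then have "0 \<le> (1 - box_bump a b x) ^ n" "(1 - box_bump a b x) ^ n \<le> 1"
    by (auto intro: power_le_one)
  then show ?thesis by auto
qed

section \<open>Locally integrable functions and weak derivatives\<close>

lemma integrable_mult_bounded:
  fixes f g :: "'a \<Rightarrow> real"
  assumes "integrable M f" "g \<in> borel_measurable M" "\<And>x. \<bar>g x\<bar> \<le> c"
  shows "integrable M (\<lambda>x. f x * g x)"
proof (rule Bochner_Integration.integrable_bound[of M "\<lambda>x. c * f x"])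
  show "AE x in M. norm (f x * g x) \<le> norm (c * f x)"
  proof (rule AE_I2)
    fix x
    have "\<bar>f x\<bar> * \<bar>g x\<bar> \<le> \<bar>f x\<bar> * \<bar>c\<bar>"
      using assms(3)[of x] by (intro mult_left_mono) linarith+
    then show "norm (f x * g x) \<le> norm (c * f x)" by (simp add: abs_mult mult.commute)
  qed
qed (use assms in auto)

lemma test_function_zero: "test_function \<omega> \<phi> \<Longrightarrow> x \<notin> \<omega> \<Longrightarrow> \<phi> x = 0"
  by (erule test_functionE) blast

text \<open>Translations, Fubini and mollification are carried out for Borel functions integrable
  over the whole space. This is the passage from a locally integrable function on \<omega>,
  measurable only for the completed measure, to such a function; it agrees with f on K and in all
  pairings with test functions supported in K.\<close>

lemma locally_integrable_ae_borel:
  fixes f :: "real^'n::finite \<Rightarrow> real"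
  assumes f: "locally_integrable \<omega> f" and K: "compact K" "K \<subseteq> \<omega>" and \<omega>: "open \<omega>"
  obtains g where "g \<in> borel_measurable borel" "integrable lborel g" "\<And>x. x \<notin> K \<Longrightarrow> g x = 0"
    "AE x in lebesgue. x \<in> K \<longrightarrow> f x = g x"
    "\<And>\<phi>. test_function K \<phi> \<Longrightarrow>
       integrable (lebesgue_on \<omega>) (\<lambda>x. f x * \<phi> x) \<and>
       (LINT x|lebesgue_on \<omega>. f x * \<phi> x) = (LINT x|lborel. g x * \<phi> x)"
proof -
  define h where "h x = (if x \<in> K then f x else 0)" for x
  have Kl: "K \<in> sets lebesgue" "K \<in> sets borel" using K(1) by (auto simp: borel_compact lmeasurable_compact)
  have h: "integrable lebesgue h"
    using f K unfolding h_def Lebesgue_Measure.integrable_restrict_UNIV[OF Kl(1)] locally_integrable_def by blast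
  from completion_ex_borel_measurable_real[OF borel_measurable_integrable[OF h]]
  obtain g' where g': "g' \<in> borel_measurable lborel" "AE x in lborel. h x = g' x" by blast
  define g where "g x = (if x \<in> K then g' x else 0)" for x
  have gm: "g \<in> borel_measurable borel"
    unfolding g_def using g'(1) Kl(2) by (intro measurable_If_set) auto
  have ae0: "AE x in lborel. h x = g x"
    using g'(2) by eventually_elim (auto simp: g_def h_def)
  then have ae: "AE x in lebesgue. h x = g x" by (rule AE_completion)
  have gml: "g \<in> borel_measurable lebesgue" using gm by (simp add: measurable_completion)
  have gl: "integrable lebesgue g"
    using integrable_cong_AE[OF borel_measurable_integrable[OF h] gml ae] h by simp
  have gi: "integrable lborel g" using gl gm by (simp add: integrable_completion)
  have ae2: "AE x in lebesgue. x \<in> K \<longrightarrow> f x = g x"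
    using ae by eventually_elim (auto simp: h_def)
  have main: "integrable (lebesgue_on \<omega>) (\<lambda>x. f x * \<phi> x) \<and>
       (LINT x|lebesgue_on \<omega>. f x * \<phi> x) = (LINT x|lborel. g x * \<phi> x)"
    if \<phi>: "test_function K \<phi>" for \<phi>
  proof -
    obtain M where M: "\<And>x. \<bar>\<phi> x\<bar> \<le> M" using test_function_bounded[OF \<phi>] by blast
    have z: "\<phi> x = 0" if "x \<notin> K" for x
      using test_function_zero[OF \<phi> that] .
    have \<phi>b: "\<phi> \<in> borel_measurable borel"
      using test_function_continuous[OF \<phi>] by (rule borel_measurable_continuous_onI)
    then have \<phi>l: "\<phi> \<in> borel_measurable lebesgue" by (simp add: measurable_completion)
    have eq: "(\<lambda>x. indicat_real \<omega> x *\<^sub>R (f x * \<phi> x)) = (\<lambda>x. h x * \<phi> x)"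
      using z K(2) by (auto simp: h_def fun_eq_iff indicator_def)
    have \<omega>s: "\<omega> \<inter> space lebesgue \<in> sets lebesgue" using \<omega> by simp
    have ih: "integrable lebesgue (\<lambda>x. h x * \<phi> x)"
      by (rule integrable_mult_bounded[OF h \<phi>l M])
    then have 1: "integrable (lebesgue_on \<omega>) (\<lambda>x. f x * \<phi> x)"
      unfolding integrable_restrict_space[OF \<omega>s] eq .
    have "(LINT x|lebesgue_on \<omega>. f x * \<phi> x) = (LINT x|lebesgue. h x * \<phi> x)"
      unfolding integral_restrict_space[OF \<omega>s] eq ..
    also have "\<dots> = (LINT x|lebesgue. g x * \<phi> x)"
      by (rule integral_cong_AE) (use ih gml \<phi>l ae in auto)
    also have "\<dots> = (LINT x|lborel. g x * \<phi> x)"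
      using gm \<phi>b by (intro integral_completion) auto
    finally show ?thesis using 1 by simp
  qed
  show ?thesis
    by (rule that[OF gm gi _ ae2 main]) (simp_all add: g_def)
qed

lemma test_function_compact:
  assumes "test_function \<omega> \<phi>"
  obtains K where "compact K" "K \<subseteq> \<omega>" "test_function K \<phi>"
proof -
  have "test_function (closure {x. \<phi> x \<noteq> 0}) \<phi>" "compact (closure {x. \<phi> x \<noteq> 0})" "closure {x. \<phi> x \<noteq> 0} \<subseteq> \<omega>"
    using assms unfolding test_function_def by blast+
  then show ?thesis by (intro that)
qed

lemma integrable_locally_integrable_mult_test:
  assumes "locally_integrable \<omega> f" "open \<omega>" "test_function \<omega> \<phi>"
  shows "integrable (lebesgue_on \<omega>) (\<lambda>x. f x * \<phi> x)"
  by (rule test_function_compact[OF assms(3)], rule locally_integrable_ae_borel[OF assms(1) _ _ assms(2)])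
    (assumption | blast)+

text \<open>The sets over which g integrates to 0 form a Dynkin system containing the boxes, which
  are closed under intersection and generate the Borel sets. Vanishing of the total integral is what
  makes the system closed under complements.\<close>

lemma AE_eq_0_of_box_integrals:
  fixes g :: "'a::euclidean_space \<Rightarrow> real"
  assumes g: "integrable lborel g"
    and 0: "\<And>a b. (LINT x|lborel. indicator (box a b) x * g x) = 0"
    and whole: "(LINT x|lborel. g x) = 0"
  shows "AE x in lborel. g x = 0"
proof (rule sigma_finite_measure.density_zero[OF sigma_finite_lborel g])
  fix A :: "'a set" assume "A \<in> sets lborel"
  then have "A \<in> sigma_sets UNIV (range (\<lambda>(a, b). box a b))"
    by (simp add: borel_eq_box)
  moreover have si: "set_integrable lborel A g" if "A \<in> sets borel" for A
    unfolding set_integrable_def using that g by (intro integrable_mult_indicator) auto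
  have Int: "Int_stable (range (\<lambda>(a, b). box a b :: 'a set))"
    by (auto simp: Int_stable_def box_Int_box)
  have sub: "range (\<lambda>(a, b). box a b :: 'a set) \<subseteq> Pow UNIV" by simp
  ultimately show "set_lebesgue_integral lborel A g = 0"
  proof (induction rule: sigma_sets_induct_disjoint[OF Int sub, consumes 1, case_names basic empty compl union])
    case (basic A)
    then show ?case using 0 by (auto simp: set_lebesgue_integral_def)
  next
    case empty
    then show ?case by (simp add: set_lebesgue_integral_def)
  next
    case (compl A)
    then have A: "A \<in> sets borel" using compl by (simp add: borel_eq_box)
    have "(LINT x:A \<union> (UNIV - A)|lborel. g x) = (LINT x:A|lborel. g x) + (LINT x:UNIV - A|lborel. g x)"
      by (rule set_integral_Un) (use A in \<open>auto intro: si\<close>)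
    then show ?case using compl whole by (simp add: set_lebesgue_integral_def Un_absorb1)
  next
    case (union A)
    have "A i \<in> sets lborel" for i using union by (auto simp: borel_eq_box)
    then have "(LINT x:(\<Union>i. A i)|lborel. g x) = (\<Sum>i. (LINT x:(A i)|lborel. g x))"
      using union by (intro lebesgue_integral_countable_add si) (auto simp: disjoint_family_on_def)
    then show ?case using union by simp
  qed
qed

text \<open>Dominated convergence along the powers \<open>1 - (1 - box_bump c d x) ^ n\<close> turns
  the pairings with test functions into integrals over boxes whose closure lies in U.\<close>

lemma AE_eq_0_of_test_functions_box:
  fixes g :: "real^'n::finite \<Rightarrow> real"
  assumes g: "integrable lborel g"
    and 0: "\<And>\<phi>. test_function U \<phi> \<Longrightarrow> (LINT x|lborel. g x * \<phi> x) = 0"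
    and ab: "cbox a b \<subseteq> U"
  shows "AE x in lborel. x \<in> box a b \<longrightarrow> g x = 0"
proof -
  have gm: "g \<in> borel_measurable lborel" using g by simp
  have box0: "(LINT x|lborel. indicator (box c d) x * g x) = 0" if cd: "cbox c d \<subseteq> U" for c d
  proof (cases "box c d = {}")
    case False
    have "(\<lambda>n. LINT x|lborel. g x * (1 - (1 - box_bump c d x) ^ n)) \<longlonglongrightarrow>
        (LINT x|lborel. g x * indicator (box c d) x)"
    proof (rule integral_dominated_convergence[where w="\<lambda>x. \<bar>g x\<bar>"])
      show "(\<lambda>x. g x * (1 - (1 - box_bump c d x) ^ n)) \<in> borel_measurable lborel" for n
        using borel_measurable_continuous_onI[OF test_function_continuous[OF test_function_box_bump_power[OF False cd, of n]]] gm
        by (intro borel_measurable_times) auto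
      show "AE x in lborel. (\<lambda>n. g x * (1 - (1 - box_bump c d x) ^ n)) \<longlonglongrightarrow> g x * indicator (box c d) x"
        by (intro AE_I2 tendsto_mult tendsto_const box_bump_power_tendsto[OF False])
      show "AE x in lborel. norm (g x * (1 - (1 - box_bump c d x) ^ n)) \<le> \<bar>g x\<bar>" for n
        using mult_left_mono[OF box_bump_power_bound[OF False, of _ n] abs_ge_zero]
        by (auto simp: abs_mult)
    qed (use g in auto)
    moreover have "(LINT x|lborel. g x * (1 - (1 - box_bump c d x) ^ n)) = 0" for n
      by (rule 0[OF test_function_box_bump_power[OF False cd]])
    ultimately show ?thesis by (simp add: LIMSEQ_const_iff mult.commute)
  qed simp
  \<comment> \<open>Cutting off to \<open>box a b\<close> makes all boxes available: the integral of
    g1 over a box is that of g over its intersection with \<open>box a b\<close>, again a box with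
    closure in U.\<close>
  define g1 where "g1 x = indicator (box a b) x * g x" for x
  have g1: "integrable lborel g1"
    unfolding g1_def using integrable_mult_indicator[OF _ g, of "box a b"] by simp
  have "(LINT x|lborel. indicator (box c d) x * g1 x) = 0" for c d
  proof -
    obtain e f where ef: "box c d \<inter> box a b = box e f" using box_Int_box[of c d a b] by blast
    have "box e f \<subseteq> box a b" using ef by blast
    have "(LINT x|lborel. indicator (box e f) x * g x) = 0"
    proof (cases "box e f = {}")
      case False
      have "closure (box e f) \<subseteq> cbox a b"
        using \<open>box e f \<subseteq> box a b\<close> box_subset_cbox[of a b] by (intro closure_minimal) auto
      then show ?thesis using closure_box[OF False] ab box0[of e f] by auto
    qed simp
    moreover have "indicator (box c d) x * g1 x = indicator (box e f) x * g x" for x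
      unfolding g1_def ef[symmetric] by (simp add: indicator_inter_arith)
    ultimately show ?thesis by simp
  qed
  moreover have "(LINT x|lborel. g1 x) = 0" using box0[OF ab] by (simp add: g1_def)
  ultimately have "AE x in lborel. g1 x = 0" by (rule AE_eq_0_of_box_integrals[OF g1])
  then show ?thesis by eventually_elim (auto simp: g1_def)
qed

text \<open>The neighbourhoods form an uncountable cover in general; by the Lindelof property
  countably many of them have the same union, so the exceptional null sets can be united.\<close>

lemma AE_lebesgue_of_locally:
  fixes \<omega> :: "'a::euclidean_space set"
  assumes "\<And>x. x \<in> \<omega> \<Longrightarrow> \<exists>U. open U \<and> x \<in> U \<and> (AE y in lebesgue. y \<in> U \<longrightarrow> P y)"
  shows "AE y in lebesgue. y \<in> \<omega> \<longrightarrow> P y"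
proof -
  define \<F> where "\<F> = {U. open U \<and> (AE y in lebesgue. y \<in> U \<longrightarrow> P y)}"
  obtain \<F>' where F: "\<F>' \<subseteq> \<F>" "countable \<F>'" "\<Union>\<F>' = \<Union>\<F>"
    using Lindelof[of \<F>] unfolding \<F>_def by blast
  have "AE y in lebesgue. \<forall>U\<in>\<F>'. y \<in> U \<longrightarrow> P y"
    unfolding AE_ball_countable[OF F(2)] using F(1) by (auto simp: \<F>_def)
  then show ?thesis
  proof eventually_elim
    case (elim y)
    show ?case
    proof
      assume "y \<in> \<omega>"
      then have "y \<in> \<Union>\<F>" using assms by (auto simp: \<F>_def)
      then show "P y" using F(3) elim by blast
    qed
  qed
qed

lemma AE_lebesgue_on_open_iff:
  "open \<omega> \<Longrightarrow> (AE x in lebesgue_on \<omega>. P x) \<longleftrightarrow> (AE x in lebesgue. x \<in> \<omega> \<longrightarrow> P x)"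
  by (simp add: AE_restrict_space_iff)

lemma fundamental_lemma_calculus_of_variations:
  fixes f :: "real^'n::finite \<Rightarrow> real"
  assumes "open \<omega>" "locally_integrable \<omega> f"
    and 0: "\<And>\<phi>. test_function \<omega> \<phi> \<Longrightarrow> (LINT x|lebesgue_on \<omega>. f x * \<phi> x) = 0"
  shows "AE x in lebesgue_on \<omega>. f x = 0"
  unfolding AE_lebesgue_on_open_iff[OF assms(1)]
proof (rule AE_lebesgue_of_locally)
  fix x assume "x \<in> \<omega>"
  obtain a b where ab: "cbox a b \<subseteq> \<omega>" "x \<in> box a b"
    by (rule open_contains_cbox[OF \<open>open \<omega>\<close> \<open>x \<in> \<omega>\<close>])
  obtain g where g: "integrable lborel g" "AE x in lebesgue. x \<in> cbox a b \<longrightarrow> f x = g x"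
    "\<And>\<phi>. test_function (cbox a b) \<phi> \<Longrightarrow>
       integrable (lebesgue_on \<omega>) (\<lambda>x. f x * \<phi> x) \<and>
       (LINT x|lebesgue_on \<omega>. f x * \<phi> x) = (LINT x|lborel. g x * \<phi> x)"
    by (rule locally_integrable_ae_borel[OF assms(2) compact_cbox ab(1) assms(1)]) blast
  have "AE x in lborel. x \<in> box a b \<longrightarrow> g x = 0"
  proof (rule AE_eq_0_of_test_functions_box[OF g(1)])
    show "(LINT x|lborel. g x * \<phi> x) = 0" if "test_function (cbox a b) \<phi>" for \<phi>
      using g(3)[OF that] 0[OF test_function_mono[OF that ab(1)]] by simp
  qed simp
  then have "AE x in lebesgue. x \<in> box a b \<longrightarrow> g x = 0" by (rule AE_completion)
  with g(2) have "AE x in lebesgue. x \<in> box a b \<longrightarrow> f x = 0"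
    by eventually_elim (auto dest: subsetD[OF box_subset_cbox])
  then show "\<exists>U. open U \<and> x \<in> U \<and> (AE y in lebesgue. y \<in> U \<longrightarrow> f y = 0)"
    using ab(2) by blast
qed

lemma locally_integrable_diff:
  "locally_integrable \<omega> f \<Longrightarrow> locally_integrable \<omega> g \<Longrightarrow> locally_integrable \<omega> (\<lambda>x. f x - g x)"
  by (auto simp: locally_integrable_def)

lemma AE_eq_of_test_functions:
  fixes f g :: "real^'n::finite \<Rightarrow> real"
  assumes "open \<omega>" "locally_integrable \<omega> f" "locally_integrable \<omega> g"
    and eq: "\<And>\<phi>. test_function \<omega> \<phi> \<Longrightarrow>
      (LINT x|lebesgue_on \<omega>. f x * \<phi> x) = (LINT x|lebesgue_on \<omega>. g x * \<phi> x)"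
  shows "AE x in lebesgue_on \<omega>. f x = g x"
proof -
  have "AE x in lebesgue_on \<omega>. f x - g x = 0"
  proof (rule fundamental_lemma_calculus_of_variations[OF assms(1) locally_integrable_diff[OF assms(2,3)]])
    show "(LINT x|lebesgue_on \<omega>. (f x - g x) * \<phi> x) = 0" if "test_function \<omega> \<phi>" for \<phi>
      using eq[OF that] integrable_locally_integrable_mult_test[OF assms(2,1) that]
        integrable_locally_integrable_mult_test[OF assms(3,1) that]
      by (simp add: left_diff_distrib)
  qed
  then show ?thesis by eventually_elim simp
qed

lemma has_weak_derivative_unique:
  assumes "open \<omega>" "has_weak_derivative \<omega> is v g" "has_weak_derivative \<omega> is v h"
  shows "AE x in lebesgue_on \<omega>. g x = h x"
  using assms by (intro AE_eq_of_test_functions) (auto simp: has_weak_derivative_def)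

section \<open>Mollification\<close>

text \<open>Uniformity in z comes from the uniform continuity of the partial derivatives along the
  segment from z to z - h, and it allows the expansion to be integrated against an integrable
  function. The increment is -h because a mollifier is translated as \<phi>(x - y) with y
  moving.\<close>

lemma test_function_first_order_expansion:
  fixes \<phi> :: "real^'n::finite \<Rightarrow> real"
  assumes \<phi>: "test_function U \<phi>" and "e > 0"
  obtains d where "d > 0"
    "\<And>z h. norm h < d \<Longrightarrow> \<bar>\<phi> (z - h) - \<phi> z + (\<Sum>i\<in>UNIV. h $ i * partial i \<phi> z)\<bar> \<le> e * norm h"
proof -
  \<comment> \<open>The error is a sum over the coordinates, each bounded by
    \<open>e' * norm h\<close>.\<close>
  define e' where "e' = e / CARD('n)"
  have e': "e' > 0" "e' * CARD('n) = e" using \<open>e > 0\<close> by (auto simp: e'_def)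
  have "\<exists>d>0. \<forall>x y. dist x y < d \<longrightarrow> \<bar>partial i \<phi> x - partial i \<phi> y\<bar> < e'" for i
    by (rule test_function_uniformly_continuous[OF test_function_partial[OF \<phi>, of i] e'(1)]) blast
  then obtain D where D: "\<And>i. D i > 0" "\<And>i x y. dist x y < D i \<Longrightarrow> \<bar>partial i \<phi> x - partial i \<phi> y\<bar> < e'"
    by metis
  define d where "d = Min (range D)"
  have d: "d > 0" "\<And>i. d \<le> D i" using D(1) by (auto simp: d_def)
  have "\<bar>\<phi> (z - h) - \<phi> z + (\<Sum>i\<in>UNIV. h $ i * partial i \<phi> z)\<bar> \<le> e * norm h" if h: "norm h < d" for z h
  proof -
    have "((\<lambda>s. \<phi> (z - s *\<^sub>R h)) has_real_derivative - (\<Sum>i\<in>UNIV. h $ i * partial i \<phi> (z - s *\<^sub>R h))) (at s)" for s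
    proof -
      have "((\<lambda>s. z - s *\<^sub>R h) has_derivative (\<lambda>t. - (t *\<^sub>R h))) (at s)"
        by (auto intro!: derivative_eq_intros)
      moreover have "(\<phi> has_derivative (\<lambda>k. \<Sum>i\<in>UNIV. k $ i * partial i \<phi> (z - s *\<^sub>R h))) (at (z - s *\<^sub>R h))"
        using test_function_differentiable[OF \<phi>] by (intro has_derivative_partial) (simp add: differentiable_on_def)
      ultimately have "((\<lambda>s. \<phi> (z - s *\<^sub>R h)) has_derivative
          (\<lambda>t. \<Sum>i\<in>UNIV. (- (t *\<^sub>R h)) $ i * partial i \<phi> (z - s *\<^sub>R h))) (at s)"
        by (rule has_derivative_compose)
      moreover have "(\<lambda>t. \<Sum>i\<in>UNIV. (- (t *\<^sub>R h)) $ i * partial i \<phi> (z - s *\<^sub>R h)) =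
          (*) (- (\<Sum>i\<in>UNIV. h $ i * partial i \<phi> (z - s *\<^sub>R h)))"
        by (rule ext) (simp add: sum_distrib_left sum_negf mult_ac)
      ultimately show ?thesis by (simp add: has_field_derivative_def)
    qed
    from MVT2[OF zero_less_one this] obtain s where s: "0 < s" "s < 1"
      "\<phi> (z - h) - \<phi> z = - (\<Sum>i\<in>UNIV. h $ i * partial i \<phi> (z - s *\<^sub>R h))"
      by auto
    have "dist z (z - s *\<^sub>R h) \<le> norm h"
      using s by (simp add: dist_norm mult_left_le_one_le)
    then have "dist z (z - s *\<^sub>R h) < D i" for i
      using h d(2)[of i] by linarith
    then have b: "\<bar>partial i \<phi> z - partial i \<phi> (z - s *\<^sub>R h)\<bar> \<le> e'" for i
      using D(2) less_imp_le by blast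
    have "\<phi> (z - h) - \<phi> z + (\<Sum>i\<in>UNIV. h $ i * partial i \<phi> z) =
        (\<Sum>i\<in>UNIV. h $ i * (partial i \<phi> z - partial i \<phi> (z - s *\<^sub>R h)))"
      unfolding s(3) by (simp add: right_diff_distrib sum_subtractf)
    also have "\<bar>\<dots>\<bar> \<le> (\<Sum>i\<in>UNIV. \<bar>h $ i * (partial i \<phi> z - partial i \<phi> (z - s *\<^sub>R h))\<bar>)"
      by (rule sum_abs)
    also have "\<dots> \<le> (\<Sum>i\<in>(UNIV::'n set). norm h * e')"
      unfolding abs_mult by (intro sum_mono mult_mono b component_le_norm_cart) auto
    also have "\<dots> = norm h * (e' * CARD('n))" by simp
    also have "\<dots> = e * norm h" unfolding e'(2) by simp
    finally show ?thesis .
  qed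
  with d(1) that show ?thesis by blast
qed

text \<open>The kernel is the translate \<phi>(x - y), not the reflected \<phi>(y - x): the value at
  y is then literally a pairing of f with a translated test function. The price is a minus sign in
  the derivative with respect to y; for the mollifiers, which are even, both conventions
  agree.\<close>

definition mollify :: "('a::euclidean_space \<Rightarrow> real) \<Rightarrow> ('a \<Rightarrow> real) \<Rightarrow> 'a \<Rightarrow> real" where
  "mollify f \<phi> y = (LINT x|lborel. f x * \<phi> (x - y))"

lemma test_function_borel: "test_function U \<phi> \<Longrightarrow> \<phi> \<in> borel_measurable borel"
  by (intro borel_measurable_continuous_onI test_function_continuous)

lemma integrable_mollify:
  assumes "integrable lborel f" "test_function U \<phi>"
  shows "integrable lborel (\<lambda>x. f x * \<phi> (x - y))"
proof -
  obtain M where M: "\<And>x. \<bar>\<phi> x\<bar> \<le> M" by (rule test_function_bounded[OF assms(2)]) blast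
  show ?thesis
    using test_function_borel[OF assms(2)]
    by (intro integrable_mult_bounded[OF assms(1) _ M]) simp
qed

lemma mollify_has_derivative:
  fixes \<phi> :: "real^'n::finite \<Rightarrow> real"
  assumes f: "integrable lborel f" and \<phi>: "test_function U \<phi>"
  shows "(mollify f \<phi> has_derivative (\<lambda>h. - (\<Sum>i\<in>UNIV. h $ i * mollify f (partial i \<phi>) y))) (at y)"
  unfolding has_derivative_at_alt
proof (intro conjI allI impI)
  show "bounded_linear (\<lambda>h. - (\<Sum>i\<in>UNIV. h $ i * mollify f (partial i \<phi>) y))"
    by (rule bounded_linear_minus, rule bounded_linear_sum, rule bounded_linear_mult_const,
        rule bounded_linear_vec_nth)
  fix e :: real assume "e > 0"
  \<comment> \<open>The summand 1 keeps A positive when f vanishes almost everywhere.\<close>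
  define A where "A = (LINT x|lborel. \<bar>f x\<bar>) + 1"
  have "(LINT x|lborel. \<bar>f x\<bar>) \<ge> 0" by simp
  then have A: "A > 0" unfolding A_def by linarith
  define e' where "e' = e / A"
  have e': "e' > 0" "e' * A = e" using \<open>e > 0\<close> A by (auto simp: e'_def)
  obtain d where d: "d > 0"
    "\<And>z h. norm h < d \<Longrightarrow> \<bar>\<phi> (z - h) - \<phi> z + (\<Sum>i\<in>UNIV. h $ i * partial i \<phi> z)\<bar> \<le> e' * norm h"
    by (rule test_function_first_order_expansion[OF \<phi> e'(1)]) blast
  show "\<exists>d>0. \<forall>y'. norm (y' - y) < d \<longrightarrow>
     norm (mollify f \<phi> y' - mollify f \<phi> y - - (\<Sum>i\<in>UNIV. (y' - y) $ i * mollify f (partial i \<phi>) y))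
       \<le> e * norm (y' - y)"
  proof (intro exI[of _ d] conjI allI impI d(1))
    fix y' assume y': "norm (y' - y) < d"
    define h where "h = y' - y"
    define R where "R x = \<phi> (x - y') - \<phi> (x - y) + (\<Sum>i\<in>UNIV. h $ i * partial i \<phi> (x - y))" for x
    have R: "\<bar>R x\<bar> \<le> e' * norm h" for x
      using d(2)[of h "x - y"] y' by (simp add: R_def h_def algebra_simps)
    have i: "integrable lborel (\<lambda>x. f x * \<phi> (x - y))" for y
      by (rule integrable_mollify[OF f \<phi>])
    have ip: "integrable lborel (\<lambda>x. f x * partial i \<phi> (x - y))" for i
      by (rule integrable_mollify[OF f test_function_partial[OF \<phi>]])
    have eqR: "f x * R x = f x * \<phi> (x - y') - f x * \<phi> (x - y) + (\<Sum>i\<in>UNIV. h $ i * (f x * partial i \<phi> (x - y)))" for x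
      by (simp add: R_def algebra_simps sum_distrib_left)
    have ips: "integrable lborel (\<lambda>x. \<Sum>i\<in>UNIV. h $ i * (f x * partial i \<phi> (x - y)))"
      by (intro Bochner_Integration.integrable_sum integrable_mult_right ip)
    have iR: "integrable lborel (\<lambda>x. f x * R x)"
      unfolding eqR by (intro Bochner_Integration.integrable_add Bochner_Integration.integrable_diff i ips)
    have "mollify f \<phi> y' - mollify f \<phi> y - - (\<Sum>i\<in>UNIV. h $ i * mollify f (partial i \<phi>) y) = (LINT x|lborel. f x * R x)"
      unfolding eqR mollify_def using i ip ips
      by (simp add: Bochner_Integration.integral_sum)
    also have "norm \<dots> \<le> (LINT x|lborel. norm (f x * R x))" by (rule integral_norm_bound)
    also have "\<dots> \<le> (LINT x|lborel. \<bar>f x\<bar> * (e' * norm h))"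
    proof (rule integral_mono)
      show "norm (f x * R x) \<le> \<bar>f x\<bar> * (e' * norm h)" for x
        using mult_left_mono[OF R[of x] abs_ge_zero] by (simp add: abs_mult)
    qed (use iR f in auto)
    also have "\<dots> = (A - 1) * (e' * norm h)" using f by (simp add: A_def)
    also have "\<dots> \<le> A * (e' * norm h)" using e' by (intro mult_right_mono) auto
    also have "\<dots> = e * norm h" using e'(2) by (metis mult.assoc mult.commute)
    finally show "norm (mollify f \<phi> y' - mollify f \<phi> y - - (\<Sum>i\<in>UNIV. (y' - y) $ i * mollify f (partial i \<phi>) y))
       \<le> e * norm (y' - y)" by (simp add: h_def)
  qed
qed

lemma integral_translate:
  fixes f :: "'a::euclidean_space \<Rightarrow> real"
  assumes "f \<in> borel_measurable borel"
  shows "(LINT x|lborel. f (x - y)) = (LINT x|lborel. f x)"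
proof -
  have "(LINT x|lborel. f x) = (LINT x|distr lborel borel ((+) (- y)). f x)"
    by (simp only: lborel_distr_plus)
  also have "\<dots> = (LINT x|lborel. f (- y + x))"
    by (rule integral_distr) (use assms in auto)
  finally show ?thesis by simp
qed

text \<open>The integral of a translate does not depend on the translation; differentiate it.\<close>

lemma integral_partial_test:
  fixes \<phi> :: "real^'n::finite \<Rightarrow> real"
  assumes \<phi>: "test_function U \<phi>"
  shows "(LINT x|lborel. partial i \<phi> x) = 0"
proof -
  obtain K where K: "compact K" "\<And>x. x \<notin> K \<Longrightarrow> \<phi> x = 0" "\<And>x i. x \<notin> K \<Longrightarrow> partial i \<phi> x = 0"
    by (rule test_functionE[OF \<phi>]) blast
  obtain r where r: "K \<subseteq> ball 0 r"
    using bounded_subset_ballD[OF compact_imp_bounded[OF K(1)], of 0] by auto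
  \<comment> \<open>The ball contains every translate of the support by a vector of length below 1,
    so near the origin \<open>mollify f \<phi>\<close> is the full integral of a translate of
    \<phi>.\<close>
  define f where "f = indicat_real (cball (0::real^'n) (r + 1))"
  have f: "integrable lborel f"
    unfolding f_def using emeasure_lborel_cball_finite[of "0::real^'n" "r + 1"]
    by (intro integrable_real_indicator) auto
  have const: "mollify f \<phi> y = (LINT x|lborel. \<phi> x)" if "y \<in> ball 0 1" for y
  proof -
    have eq: "f x * \<phi> (x - y) = \<phi> (x - y)" for x
    proof (cases "x - y \<in> K")
      case True
      then have "norm (x - y) < r" using r by auto
      moreover have "norm y < 1" using that by simp
      ultimately have "norm x \<le> r + 1" using norm_triangle_ineq[of "x - y" y] by simp
      then show ?thesis by (simp add: f_def)
    qed (simp add: K)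
    show ?thesis
      unfolding mollify_def eq by (rule integral_translate[OF test_function_borel[OF \<phi>]])
  qed
  have "(mollify f \<phi> has_derivative (\<lambda>h. 0)) (at 0)"
    by (rule has_derivative_transform_within_open[OF has_derivative_const open_ball[of 0 1]])
      (auto simp: const)
  from has_derivative_unique[OF mollify_has_derivative[OF f \<phi>] this]
  have "- (\<Sum>j\<in>UNIV. axis i 1 $ j * mollify f (partial j \<phi>) 0) = 0"
    by (rule fun_cong)
  then have zero: "mollify f (partial i \<phi>) 0 = 0"
    by (simp add: axis_def if_distrib[of "\<lambda>x. x * _"] cong: if_cong)
  have eq: "f x * partial i \<phi> (x - 0) = partial i \<phi> x" for x
  proof (cases "x \<in> K")
    case True
    then have "norm x < r" using r by auto
    then show ?thesis by (simp add: f_def)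
  qed (simp add: K)
  have "mollify f (partial i \<phi>) 0 = (LINT x|lborel. partial i \<phi> x)"
    unfolding mollify_def by (rule Bochner_Integration.integral_cong[OF refl eq])
  with zero show ?thesis by (rule trans[OF sym, rotated])
qed

section \<open>Normalised mollifiers and their approximation property\<close>

definition mollifier :: "real \<Rightarrow> real^'n::finite \<Rightarrow> real" where
  "mollifier r x = ball_bump r x / (LINT x|lborel. ball_bump r (x :: real^'n))"

lemma integrable_test_function:
  assumes "test_function U \<phi>"
  shows "integrable lborel \<phi>"
proof -
  obtain K where "compact K" "K \<subseteq> U" "test_function K \<phi>"
    by (rule test_function_compact[OF assms])
  then have K: "compact K" "\<And>x. x \<notin> K \<Longrightarrow> \<phi> x = 0"
    by (simp_all add: test_function_zero)
  have "integrable lborel (\<lambda>x. indicator K x *\<^sub>R \<phi> x)"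
    by (rule borel_integrable_compact[OF K(1)
          continuous_on_subset[OF test_function_continuous[OF assms] subset_UNIV]])
  moreover have "(\<lambda>x. indicator K x *\<^sub>R \<phi> x) = \<phi>"
    using K(2) by (auto simp: fun_eq_iff indicator_def)
  ultimately show ?thesis by simp
qed

lemma integral_ball_bump_pos:
  assumes "r > 0"
  shows "(LINT x|lborel. ball_bump r (x :: real^'n::finite)) > 0"
proof -
  let ?b = "ball_bump r :: real^'n \<Rightarrow> real"
  have i: "integrable lborel ?b" by (rule integrable_test_function[OF test_function_ball_bump[OF assms subset_UNIV]])
  have "(LINT x|lborel. ?b x) \<noteq> 0"
  proof
    assume "(LINT x|lborel. ?b x) = 0"
    then have "AE x in lborel. ?b x = 0"
      using integral_nonneg_eq_0_iff_AE[OF i] ball_bump_nonneg by auto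
    then have "AE x in lborel. x \<notin> ball (0::real^'n) r"
    proof eventually_elim
      case (elim x)
      then show ?case using ball_bump_pos_iff[OF assms, of x] by simp
    qed
    then have "emeasure lborel (ball (0::real^'n) r) = 0"
      by (subst (asm) AE_iff_measurable[of "ball 0 r"]) auto
    moreover have "emeasure lborel (ball (0::real^'n) r) \<noteq> 0"
      using content_ball_pos[OF assms, of "0::real^'n"] by (auto simp: measure_def)
    ultimately show False by simp
  qed
  moreover have "(LINT x|lborel. ?b x) \<ge> 0" by (simp add: ball_bump_nonneg)
  ultimately show ?thesis by linarith
qed

lemma mollifier_nonneg:
  fixes x :: "real^'n::finite"
  shows "r > 0 \<Longrightarrow> mollifier r x \<ge> 0"
  using integral_ball_bump_pos[of r, where 'n='n] by (simp add: mollifier_def ball_bump_nonneg)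

lemma mollifier_eq_0:
  fixes x :: "real^'n::finite"
  shows "r > 0 \<Longrightarrow> norm x \<ge> r \<Longrightarrow> mollifier r x = 0"
  using ball_bump_pos_iff[of r x] ball_bump_nonneg[of r x] by (simp add: mollifier_def)

lemma integral_mollifier:
  "r > 0 \<Longrightarrow> (LINT x|lborel. mollifier r (x :: real^'n::finite)) = 1"
  using integral_ball_bump_pos[of r, where 'n='n] by (simp add: mollifier_def[abs_def])

lemma test_function_mollifier:
  fixes U :: "(real^'n::finite) set"
  assumes "r > 0" "cball 0 r \<subseteq> U"
  shows "test_function U (mollifier r)"
proof -
  have eq: "mollifier r = (\<lambda>x::real^'n. (1 / (LINT x|lborel. ball_bump r (x :: real^'n))) * ball_bump r x)"
    by (auto simp: mollifier_def)
  show ?thesis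
    unfolding eq by (rule test_function_mult[OF test_function_ball_bump[OF assms] Ck_const])
qed

lemma mollifier_minus: "mollifier r (- x) = mollifier r x"
  by (simp add: mollifier_def ball_bump_def)

text \<open>Fubini moves the mollifier from \<open>f\<close> to the test function \<open>\<psi>\<close>, where it converges uniformly.\<close>

lemma integral_mollify_tendsto:
  fixes f :: "real^'n::finite \<Rightarrow> real"
  assumes f: "integrable lborel f" and \<psi>: "test_function U \<psi>"
    and r: "\<And>n. r n > 0" "r \<longlonglongrightarrow> 0"
  shows "(\<lambda>n. LINT y|lborel. mollify f (mollifier (r n)) y * \<psi> y) \<longlonglongrightarrow> (LINT x|lborel. f x * \<psi> x)"
proof -
  note [measurable] = borel_measurable_integrable[OF f] test_function_borel[OF \<psi>]
  have m [measurable]: "mollifier (r n) \<in> borel_measurable (borel :: (real^'n) measure)" for n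
    by (rule test_function_borel[OF test_function_mollifier[OF r(1) subset_UNIV]])
  have im: "integrable lborel (mollifier (r n) :: real^'n \<Rightarrow> real)" for n
    by (rule integrable_test_function[OF test_function_mollifier[OF r(1) subset_UNIV]])
  have i\<psi>: "integrable lborel \<psi>" by (rule integrable_test_function[OF \<psi>])
  define S where "S n x = (LINT y|lborel. mollifier (r n) (x - y) * \<psi> y)" for n x
  have bd: "\<exists>M. \<forall>x. \<bar>mollifier (r n) (x::real^'n)\<bar> \<le> M" for n
    by (rule test_function_bounded[OF test_function_mollifier[OF r(1) subset_UNIV]]) blast
  have int1: "(LINT y|lborel. mollifier (r n) (x - y)) = 1" for n and x :: "real^'n"
  proof -
    have "(LINT y|lborel. mollifier (r n) (x - y)) = (LINT y|lborel. mollifier (r n) (y - x))"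
      using mollifier_minus[of "r n" "_ - x"] by simp
    then show ?thesis using integral_translate[OF m] integral_mollifier[OF r(1)] by simp
  qed
  \<comment> \<open>The integral of a function that is not integrable is 0 by convention, so the
    value 1 already certifies integrability.\<close>
  have im2: "integrable lborel (\<lambda>y. mollifier (r n) (x - y))" for n and x :: "real^'n"
    using int1[of n x] not_integrable_integral_eq by fastforce
  have im3: "integrable lborel (\<lambda>y. mollifier (r n) (x - y) * \<psi> y)" for n x
  proof -
    obtain M where "\<And>y. \<bar>\<psi> y\<bar> \<le> M" by (rule test_function_bounded[OF \<psi>]) blast
    then show ?thesis by (intro integrable_mult_bounded[OF im2]) auto
  qed
  have fub: "(LINT y|lborel. mollify f (mollifier (r n)) y * \<psi> y) = (LINT x|lborel. f x * S n x)" for n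
  proof -
    define h where "h x y = f x * (mollifier (r n) (x - y) * \<psi> y)" for x y
    obtain M where M: "\<And>x. \<bar>mollifier (r n) (x::real^'n)\<bar> \<le> M" using bd by blast
    have hm: "case_prod h \<in> borel_measurable (lborel \<Otimes>\<^sub>M lborel)"
      unfolding h_def by measurable
    \<comment> \<open>Bounding the mollifier by M leaves a product of a function of x and a function
      of y, which dominates h and justifies Fubini.\<close>
    have "integrable (lborel \<Otimes>\<^sub>M lborel) (\<lambda>(x, y). f x * (M * \<psi> y))"
    proof (rule lborel_pair.Fubini_integrable)
      show "(\<lambda>(x, y). f x * (M * \<psi> y)) \<in> borel_measurable (lborel \<Otimes>\<^sub>M lborel)" by measurable
      show "integrable lborel (\<lambda>x. LINT y|lborel. norm (case (x, y) of (x, y) \<Rightarrow> f x * (M * \<psi> y)))"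
        using f by (simp add: abs_mult)
      show "AE x in lborel. integrable lborel (\<lambda>y. case (x, y) of (x, y) \<Rightarrow> f x * (M * \<psi> y))"
        using i\<psi> by simp
    qed
    then have hi: "integrable (lborel \<Otimes>\<^sub>M lborel) (case_prod h)"
    proof (rule Bochner_Integration.integrable_bound[OF _ hm])
      have "\<bar>h x y\<bar> \<le> \<bar>f x * (M * \<psi> y)\<bar>" for x y
        using M[of "x - y"] unfolding h_def abs_mult by (intro mult_left_mono mult_right_mono) auto
      then show "AE p in lborel \<Otimes>\<^sub>M lborel. norm (case_prod h p) \<le> norm (case p of (x, y) \<Rightarrow> f x * (M * \<psi> y))"
        by (auto intro!: AE_I2)
    qed
    have "(LINT y|lborel. mollify f (mollifier (r n)) y * \<psi> y) = (LINT y|lborel. LINT x|lborel. h x y)"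
      unfolding mollify_def h_def by (simp flip: integral_mult_left_zero add: mult.assoc)
    also have "\<dots> = (LINT x|lborel. LINT y|lborel. h x y)"
      by (rule lborel_pair.Fubini_integral[OF hi])
    also have "\<dots> = (LINT x|lborel. f x * S n x)"
      unfolding h_def S_def by simp
    finally show ?thesis .
  qed
  \<comment> \<open>\<open>S n x\<close> is an average of \<psi> with nonnegative weights of total
    mass 1, all carried by points at distance less than \<open>r n\<close> from x.\<close>
  have close: "\<bar>S n x - \<psi> x\<bar> \<le> e" if e: "\<And>x y. dist x y < d \<Longrightarrow> \<bar>\<psi> x - \<psi> y\<bar> < e" and n: "r n < d" for n x d e
  proof -
    have "S n x - \<psi> x = S n x - (LINT y|lborel. mollifier (r n) (x - y) * \<psi> x)"
      by (simp add: int1)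
    also have "\<dots> = (LINT y|lborel. mollifier (r n) (x - y) * (\<psi> y - \<psi> x))"
      unfolding S_def right_diff_distrib
      by (rule Bochner_Integration.integral_diff[symmetric]) (use im3 im2 in auto)
    also have "norm \<dots> \<le> (LINT y|lborel. norm (mollifier (r n) (x - y) * (\<psi> y - \<psi> x)))"
      by (rule integral_norm_bound)
    also have "\<dots> \<le> (LINT y|lborel. mollifier (r n) (x - y) * e)"
    proof (rule integral_mono)
      show "integrable lborel (\<lambda>y. norm (mollifier (r n) (x - y) * (\<psi> y - \<psi> x)))"
        unfolding right_diff_distrib using im3 im2 by auto
      show "integrable lborel (\<lambda>y. mollifier (r n) (x - y) * e)" using im2 by auto
      fix y
      show "norm (mollifier (r n) (x - y) * (\<psi> y - \<psi> x)) \<le> mollifier (r n) (x - y) * e"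
      proof (cases "norm (x - y) < r n")
        case True
        then have "\<bar>\<psi> y - \<psi> x\<bar> \<le> e" using e[of y x] n by (simp add: dist_norm norm_minus_commute)
        from mult_left_mono[OF this mollifier_nonneg[OF r(1), of n "x - y"]]
        show ?thesis by (simp add: abs_mult mollifier_nonneg r(1))
      next
        case False
        then show ?thesis by (simp add: not_less mollifier_eq_0[OF r(1)])
      qed
    qed
    also have "\<dots> = e" by (simp add: int1)
    finally show ?thesis by simp
  qed
  have Slim: "(\<lambda>n. S n x) \<longlonglongrightarrow> \<psi> x" for x
  proof (rule LIMSEQ_I)
    fix e :: real assume "e > 0"
    then obtain d where d: "d > 0" "\<And>x y. dist x y < d \<Longrightarrow> \<bar>\<psi> x - \<psi> y\<bar> < e / 2"
      using test_function_uniformly_continuous[OF \<psi>, of "e / 2"] by auto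
    obtain N where "\<And>n. n \<ge> N \<Longrightarrow> norm (r n - 0) < d" using LIMSEQ_D[OF r(2) d(1)] by blast
    then have "\<bar>S n x - \<psi> x\<bar> \<le> e / 2" if "n \<ge> N" for n
      using that by (intro close[OF d(2)]) fastforce+
    then show "\<exists>N. \<forall>n\<ge>N. norm (S n x - \<psi> x) < e" using \<open>e > 0\<close> by (intro exI[of _ N]) fastforce
  qed
  obtain M where M: "M > 0" "\<And>x. \<bar>\<psi> x\<bar> \<le> M" by (rule test_function_bounded[OF \<psi>]) blast
  have Sb: "\<bar>S n x\<bar> \<le> M" for n x
  proof -
    have "norm (S n x) \<le> (LINT y|lborel. norm (mollifier (r n) (x - y) * \<psi> y))"
      unfolding S_def by (rule integral_norm_bound)
    also have "\<dots> \<le> (LINT y|lborel. mollifier (r n) (x - y) * M)"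
    proof (rule integral_mono)
      show "norm (mollifier (r n) (x - y) * \<psi> y) \<le> mollifier (r n) (x - y) * M" for y
        using mult_left_mono[OF M(2)[of y] mollifier_nonneg[OF r(1), of n "x - y"]]
        by (simp add: abs_mult mollifier_nonneg r(1))
    qed (use im2 im3 in auto)
    also have "\<dots> = M" by (simp add: int1)
    finally show ?thesis by simp
  qed
  have "(\<lambda>n. LINT x|lborel. f x * S n x) \<longlonglongrightarrow> (LINT x|lborel. f x * \<psi> x)"
  proof (rule integral_dominated_convergence[where w="\<lambda>x. \<bar>f x\<bar> * M"])
    show "(\<lambda>x. f x * S n x) \<in> borel_measurable lborel" for n
      unfolding S_def by measurable
    show "AE x in lborel. (\<lambda>n. f x * S n x) \<longlonglongrightarrow> f x * \<psi> x"
      by (intro AE_I2 tendsto_mult tendsto_const Slim)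
    show "AE x in lborel. norm (f x * S n x) \<le> \<bar>f x\<bar> * M" for n
      using Sb by (intro AE_I2) (auto simp: abs_mult intro!: mult_left_mono)
  qed (use f in auto)
  then show ?thesis unfolding fub .
qed

section \<open>Calculus of weak derivatives\<close>

lemma integral_lebesgue_on_borel:
  fixes \<eta> :: "'a::euclidean_space \<Rightarrow> real"
  assumes "\<omega> \<in> sets lebesgue" "\<eta> \<in> borel_measurable borel" "\<And>x. x \<notin> \<omega> \<Longrightarrow> \<eta> x = 0"
  shows "(LINT x|lebesgue_on \<omega>. \<eta> x) = (LINT x|lborel. \<eta> x)"
proof -
  have "(\<lambda>x. indicat_real \<omega> x *\<^sub>R \<eta> x) = \<eta>"
    using assms(3) by (auto simp: fun_eq_iff indicator_def)
  then have "(LINT x|lebesgue_on \<omega>. \<eta> x) = (LINT x|lebesgue. \<eta> x)"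
    using integral_restrict_space[of \<omega> lebesgue \<eta>] assms(1) by simp
  also have "\<dots> = (LINT x|lborel. \<eta> x)"
    using assms(2) by (intro integral_completion) simp
  finally show ?thesis .
qed

lemma integral_partial_test_function:
  assumes "open \<omega>" "test_function \<omega> \<eta>"
  shows "(LINT x|lebesgue_on \<omega>. partial i \<eta> x) = 0"
proof -
  note t = test_function_partial[OF assms(2), of i]
  have "(LINT x|lebesgue_on \<omega>. partial i \<eta> x) = (LINT x|lborel. partial i \<eta> x)"
    by (rule integral_lebesgue_on_borel[OF _ test_function_borel[OF t] test_function_zero[OF t]])
      (use assms(1) in auto)
  then show ?thesis using integral_partial_test[OF assms(2)] by (rule trans)
qed

lemma locally_integrable_continuous:
  fixes f :: "real^'n::finite \<Rightarrow> real"
  assumes "continuous_on \<omega> f"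
  shows "locally_integrable \<omega> f"
  unfolding locally_integrable_def
proof (intro allI impI)
  fix K assume K: "compact K \<and> K \<subseteq> \<omega>"
  have "set_integrable lborel K f"
    unfolding set_integrable_def
    using K by (intro borel_integrable_compact) (auto intro: continuous_on_subset[OF assms])
  then have "integrable lebesgue (\<lambda>x. indicator K x *\<^sub>R f x)"
    unfolding set_integrable_def using integrable_completion[of "\<lambda>x. indicator K x *\<^sub>R f x" lborel]
    by (simp add: borel_measurable_integrable)
  moreover have "K \<inter> space lebesgue \<in> sets lebesgue" using K by (auto simp: lmeasurable_compact fmeasurableD)
  ultimately show "integrable (lebesgue_on K) f"
    by (simp add: integrable_restrict_space)
qed

lemma locally_integrable_integrable:
  assumes "integrable lborel f"
  shows "locally_integrable U f"
  unfolding locally_integrable_def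
proof (intro allI impI)
  fix K assume K: "compact K \<and> K \<subseteq> U"
  have Ks: "K \<in> sets lebesgue" using K by (auto simp: lmeasurable_compact fmeasurableD)
  have "integrable lebesgue f"
    using assms integrable_completion[of f lborel] by (simp add: borel_measurable_integrable)
  from integrable_mult_indicator[OF Ks this] show "integrable (lebesgue_on K) f"
    using Ks by (simp add: integrable_restrict_space)
qed

lemma partials_Ck: "(\<And>k. Ck k p) \<Longrightarrow> Ck k (partials is p)"
proof (induction "is" arbitrary: k)
  case (Cons i "is")
  have "Ck (Suc k) (partials is p)" by (rule Cons.IH[OF Cons.prems])
  then show ?case by simp
qed simp

lemma partials_append: "partials (is @ js) p = partials is (partials js p)"
  by (induction "is") auto

lemma test_function_partials: "test_function \<omega> \<phi> \<Longrightarrow> test_function \<omega> (partials is \<phi>)"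
  by (induction "is") (auto intro: test_function_partial)

lemma Ck_continuous: "(\<And>k. Ck k p) \<Longrightarrow> continuous_on A p"
  using continuous_on_subset[of UNIV p A] Ck.simps(1)[of p] by blast

lemma integral_by_parts_test_function:
  fixes p :: "real^'n::finite \<Rightarrow> real"
  assumes \<omega>: "open \<omega>" and \<phi>: "test_function \<omega> \<phi>" and p: "\<And>k. Ck k p"
  shows "(LINT x|lebesgue_on \<omega>. p x * partial i \<phi> x) = - (LINT x|lebesgue_on \<omega>. partial i p x * \<phi> x)"
proof -
  have p': "\<And>k. Ck k (partial i p)" using p[of "Suc _"] by simp
  have d: "p differentiable_on UNIV" using p[of "Suc 0"] by simp
  have i1: "integrable (lebesgue_on \<omega>) (\<lambda>x. p x * partial i \<phi> x)"
    by (rule integrable_locally_integrable_mult_test[OF locally_integrable_continuous[OF Ck_continuous[OF p]] \<omega>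
          test_function_partial[OF \<phi>]])
  have i2: "integrable (lebesgue_on \<omega>) (\<lambda>x. partial i p x * \<phi> x)"
    by (rule integrable_locally_integrable_mult_test[OF locally_integrable_continuous[OF Ck_continuous[OF p']] \<omega> \<phi>])
  have "0 = (LINT x|lebesgue_on \<omega>. partial i (\<lambda>x. p x * \<phi> x) x)"
    using integral_partial_test_function[OF \<omega> test_function_mult[OF \<phi> p]] by simp
  also have "\<dots> = (LINT x|lebesgue_on \<omega>. p x * partial i \<phi> x + partial i p x * \<phi> x)"
    by (simp add: partial_mult[OF d test_function_differentiable[OF \<phi>]])
  also have "\<dots> = (LINT x|lebesgue_on \<omega>. p x * partial i \<phi> x) + (LINT x|lebesgue_on \<omega>. partial i p x * \<phi> x)"
    by (rule Bochner_Integration.integral_add[OF i1 i2])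
  finally show ?thesis by linarith
qed

text \<open>Each integration by parts takes the outermost derivative off the test function and
  applies it first to p. The directions therefore accumulate on p in reverse order, whence
  \<open>rev is\<close>.\<close>

lemma has_weak_derivative_Ck:
  fixes p :: "real^'n::finite \<Rightarrow> real"
  assumes "open \<omega>" "\<And>k. Ck k p"
  shows "has_weak_derivative \<omega> is p (partials (rev is) p)"
proof -
  have "(LINT x|lebesgue_on \<omega>. p x * partials is \<phi> x) =
      (-1) ^ length is * (LINT x|lebesgue_on \<omega>. partials (rev is) p x * \<phi> x)"
    if \<phi>: "test_function \<omega> \<phi>" for \<phi>
    using assms(2)
  proof (induction "is" arbitrary: p)
    case (Cons i "is")
    have p': "\<And>k. Ck k (partial i p)" using Cons.prems[of "Suc _"] by simp
    show ?case
      using integral_by_parts_test_function[OF assms(1) test_function_partials[OF \<phi>, of "is"] Cons.prems, of i]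
        Cons.IH[OF p'] by (simp add: partials_append)
  qed simp
  then show ?thesis
    unfolding has_weak_derivative_def
    using assms(2) by (intro conjI allI impI locally_integrable_continuous Ck_continuous partials_Ck) auto
qed

text \<open>Completeness of Lebesgue measure is the reason: preimages under f and g differ by a null
  set only. Both functions are extended by 0 so that the preimages are compared in the whole
  space.\<close>

lemma lebesgue_on_measurable_cong_AE:
  fixes f g :: "'a::euclidean_space \<Rightarrow> 'b::euclidean_space"
  assumes f: "f \<in> borel_measurable (lebesgue_on S)" and S: "S \<in> sets lebesgue"
    and ae: "AE x in lebesgue_on S. f x = g x"
  shows "g \<in> borel_measurable (lebesgue_on S)"
proof -
  have ae': "AE x in lebesgue. x \<in> S \<longrightarrow> f x = g x"
    using ae S by (simp add: AE_restrict_space_iff)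
  have fm: "(\<lambda>x. if x \<in> S then f x else 0) \<in> borel_measurable lebesgue"
    by (rule borel_measurable_if_I[OF f S])
  have "(\<lambda>x. if x \<in> S then g x else 0) \<in> borel_measurable lebesgue"
  proof (rule measurableI)
    fix A :: "'b set" assume A: "A \<in> sets borel"
    have m: "(\<lambda>x. if x \<in> S then f x else 0) -` A \<inter> space lebesgue \<in> sets lebesgue"
      by (rule measurable_sets[OF fm A])
    have "AE x in lebesgue. x \<in> (\<lambda>x. if x \<in> S then f x else 0) -` A \<inter> space lebesgue \<longleftrightarrow>
        x \<in> (\<lambda>x. if x \<in> S then g x else 0) -` A \<inter> space lebesgue"
      using ae' by eventually_elim auto
    then show "(\<lambda>x. if x \<in> S then g x else 0) -` A \<inter> space lebesgue \<in> sets lebesgue"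
      by (rule completion.in_sets_AE[OF _ m]) simp
  qed simp
  then show ?thesis by (rule borel_measurable_if_D)
qed

lemma integrable_lebesgue_on_cong_AE:
  fixes f g :: "'a::euclidean_space \<Rightarrow> 'b::euclidean_space"
  assumes f: "integrable (lebesgue_on S) f" and S: "S \<in> sets lebesgue"
    and ae: "AE x in lebesgue_on S. f x = g x"
  shows "integrable (lebesgue_on S) g" "integral\<^sup>L (lebesgue_on S) g = integral\<^sup>L (lebesgue_on S) f"
proof -
  have g: "g \<in> borel_measurable (lebesgue_on S)"
    by (rule lebesgue_on_measurable_cong_AE[OF _ S ae]) (use f in simp)
  show "integrable (lebesgue_on S) g"
    using integrable_cong_AE[OF borel_measurable_integrable[OF f] g ae] f by simp
  show "integral\<^sup>L (lebesgue_on S) g = integral\<^sup>L (lebesgue_on S) f"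
    using integral_cong_AE[OF borel_measurable_integrable[OF f] g ae] by simp
qed

lemma locally_integrable_cong_AE:
  fixes f g :: "real^'n::finite \<Rightarrow> real"
  assumes f: "locally_integrable \<omega> f" and \<omega>: "open \<omega>" and ae: "AE x in lebesgue_on \<omega>. f x = g x"
  shows "locally_integrable \<omega> g"
  unfolding locally_integrable_def
proof (intro allI impI)
  fix K assume K: "compact K \<and> K \<subseteq> \<omega>"
  have Ks: "K \<in> sets lebesgue" using K by (auto simp: lmeasurable_compact fmeasurableD)
  have "AE x in lebesgue_on K. f x = g x"
  proof -
    have "AE x in lebesgue. x \<in> \<omega> \<longrightarrow> f x = g x"
      using ae by (simp add: AE_lebesgue_on_open_iff[OF \<omega>])
    then have "AE x in lebesgue. x \<in> K \<longrightarrow> f x = g x"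
      by eventually_elim (use K in auto)
    then show ?thesis using Ks by (simp add: AE_restrict_space_iff)
  qed
  from integrable_lebesgue_on_cong_AE(1)[OF _ Ks this] f K
  show "integrable (lebesgue_on K) g" by (simp add: locally_integrable_def)
qed

lemma has_weak_derivative_cong_AE:
  fixes v w :: "real^'n::finite \<Rightarrow> real"
  assumes v: "has_weak_derivative \<omega> is v g" and \<omega>: "open \<omega>"
    and ae: "AE x in lebesgue_on \<omega>. v x = w x" and ae': "AE x in lebesgue_on \<omega>. g x = h x"
  shows "has_weak_derivative \<omega> is w h"
proof -
  have \<omega>s: "\<omega> \<in> sets lebesgue" using \<omega> by simp
  have li: "locally_integrable \<omega> v" "locally_integrable \<omega> g" using v unfolding has_weak_derivative_def by blast+
  have eq: "(LINT x|lebesgue_on \<omega>. w x * \<phi> x) = (LINT x|lebesgue_on \<omega>. v x * \<phi> x)"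
    if "test_function \<omega> \<phi>" "locally_integrable \<omega> v" "AE x in lebesgue_on \<omega>. v x = w x" for \<phi> v w
    by (rule integrable_lebesgue_on_cong_AE(2)[OF integrable_locally_integrable_mult_test[OF that(2) \<omega> that(1)] \<omega>s])
      (use that(3) in eventually_elim, simp)
  show ?thesis
    unfolding has_weak_derivative_def
  proof (intro conjI allI impI)
    show "locally_integrable \<omega> w" by (rule locally_integrable_cong_AE[OF li(1) \<omega> ae])
    show "locally_integrable \<omega> h" by (rule locally_integrable_cong_AE[OF li(2) \<omega> ae'])
    fix \<phi> assume \<phi>: "test_function \<omega> \<phi>"
    have "(LINT x|lebesgue_on \<omega>. v x * partials is \<phi> x) = (-1) ^ length is * (LINT x|lebesgue_on \<omega>. g x * \<phi> x)"
      using v \<phi> unfolding has_weak_derivative_def by blast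
    then show "(LINT x|lebesgue_on \<omega>. w x * partials is \<phi> x) = (-1) ^ length is * (LINT x|lebesgue_on \<omega>. h x * \<phi> x)"
      unfolding eq[OF test_function_partials[OF \<phi>] li(1) ae] eq[OF \<phi> li(2) ae'] .
  qed
qed

lemma has_weak_derivative_diff:
  fixes v w :: "real^'n::finite \<Rightarrow> real"
  assumes "open \<omega>" "has_weak_derivative \<omega> is v g" "has_weak_derivative \<omega> is w h"
  shows "has_weak_derivative \<omega> is (\<lambda>x. v x - w x) (\<lambda>x. g x - h x)"
proof -
  have li: "locally_integrable \<omega> v" "locally_integrable \<omega> g" "locally_integrable \<omega> w" "locally_integrable \<omega> h"
    using assms unfolding has_weak_derivative_def by blast+
  note i = integrable_locally_integrable_mult_test[OF _ assms(1)]
  show ?thesis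
    unfolding has_weak_derivative_def
  proof (intro conjI allI impI locally_integrable_diff li)
    fix \<phi> assume \<phi>: "test_function \<omega> \<phi>"
    have eqs: "(LINT x|lebesgue_on \<omega>. v x * partials is \<phi> x) = (-1) ^ length is * (LINT x|lebesgue_on \<omega>. g x * \<phi> x)"
      "(LINT x|lebesgue_on \<omega>. w x * partials is \<phi> x) = (-1) ^ length is * (LINT x|lebesgue_on \<omega>. h x * \<phi> x)"
      using assms(2,3) \<phi> unfolding has_weak_derivative_def by blast+
    have "(LINT x|lebesgue_on \<omega>. (v x - w x) * partials is \<phi> x) =
        (LINT x|lebesgue_on \<omega>. v x * partials is \<phi> x) - (LINT x|lebesgue_on \<omega>. w x * partials is \<phi> x)"
      unfolding left_diff_distrib
      by (rule Bochner_Integration.integral_diff) (intro i li test_function_partials \<phi>)+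
    also have "\<dots> = (-1) ^ length is * ((LINT x|lebesgue_on \<omega>. g x * \<phi> x) - (LINT x|lebesgue_on \<omega>. h x * \<phi> x))"
      unfolding eqs by (simp only: right_diff_distrib)
    also have "(LINT x|lebesgue_on \<omega>. g x * \<phi> x) - (LINT x|lebesgue_on \<omega>. h x * \<phi> x) =
        (LINT x|lebesgue_on \<omega>. (g x - h x) * \<phi> x)"
      unfolding left_diff_distrib
      by (rule Bochner_Integration.integral_diff[symmetric]) (intro i li \<phi>)+
    finally show "(LINT x|lebesgue_on \<omega>. (v x - w x) * partials is \<phi> x) =
        (-1) ^ length is * (LINT x|lebesgue_on \<omega>. (g x - h x) * \<phi> x)" .
  qed
qed

section \<open>Functions with vanishing weak gradient\<close>

text \<open>A nonempty open set is not negligible. Applied to a property that does not mention the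
  point, this turns an almost everywhere statement into a plain fact.\<close>

lemma AE_open_ex:
  fixes W :: "'a::euclidean_space set"
  assumes "open W" "W \<noteq> {}" "AE y in lebesgue. y \<in> W \<longrightarrow> P y"
  shows "\<exists>y\<in>W. P y"
proof (rule ccontr)
  assume "\<not> (\<exists>y\<in>W. P y)"
  then have "AE y in lebesgue. y \<notin> W" using assms(3) by (auto elim: eventually_mono)
  then have "W \<in> null_sets lebesgue"
    using completion.null_sets_iff_AE[of W lborel] by simp
  then show False
    using open_not_negligible[OF assms(1,2)] by (simp add: negligible_iff_null_sets)
qed

text \<open>The values of f at single points are meaningless here, so connectedness is applied to
  the function that assigns to x the essential value of f near x.\<close>

lemma AE_constant_of_locally_constant:
  fixes \<omega> :: "'a::euclidean_space set" and f :: "'a \<Rightarrow> 'b"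
  assumes "connected \<omega>" and loc: "\<And>x. x \<in> \<omega> \<Longrightarrow> \<exists>U c. open U \<and> x \<in> U \<and> (AE y in lebesgue. y \<in> U \<longrightarrow> f y = c)"
  shows "\<exists>c. AE y in lebesgue. y \<in> \<omega> \<longrightarrow> f y = c"
proof -
  define P where "P x c \<longleftrightarrow> (\<exists>U. open U \<and> x \<in> U \<and> (AE y in lebesgue. y \<in> U \<longrightarrow> f y = c))" for x c
  have uniq: "c = d" if P: "P x c" "P x d" for x c d
  proof -
    obtain U where U: "open U" "x \<in> U" "AE y in lebesgue. y \<in> U \<longrightarrow> f y = c"
      using P(1) unfolding P_def by blast
    obtain V where V: "open V" "x \<in> V" "AE y in lebesgue. y \<in> V \<longrightarrow> f y = d"
      using P(2) unfolding P_def by blast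
    have "AE y in lebesgue. y \<in> U \<inter> V \<longrightarrow> c = d"
      using U(3) V(3) by eventually_elim auto
    moreover have "open (U \<inter> V)" "U \<inter> V \<noteq> {}" using U V by auto
    ultimately show ?thesis using AE_open_ex[of "U \<inter> V" "\<lambda>_. c = d"] by auto
  qed
  \<comment> \<open>Two local constants at x agree because their neighbourhoods overlap in a
    nonempty open set, so the choice is no choice.\<close>
  define C where "C x = (SOME c. P x c)" for x
  have C: "P x c \<Longrightarrow> C x = c" for x c
    unfolding C_def by (rule uniq[OF someI])
  have "C constant_on \<omega>"
  proof (rule locally_constant_imp_constant[OF assms(1)])
    fix a assume "a \<in> \<omega>"
    from loc[OF this] obtain U c where U: "open U" "a \<in> U" "AE y in lebesgue. y \<in> U \<longrightarrow> f y = c"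
      by blast
    have "C x = c" if x: "x \<in> U" for x
    proof (rule C)
      show "P x c" unfolding P_def using U x by blast
    qed
    then show "\<exists>T. openin (top_of_set \<omega>) T \<and> a \<in> T \<and> (\<forall>x\<in>T. C x = C a)"
      using U \<open>a \<in> \<omega>\<close> by (intro exI[of _ "\<omega> \<inter> U"]) (auto intro: openin_open_Int)
  qed
  then obtain c where c: "\<And>x. x \<in> \<omega> \<Longrightarrow> C x = c" unfolding constant_on_def by blast
  have "AE y in lebesgue. y \<in> \<omega> \<longrightarrow> f y = c"
  proof (rule AE_lebesgue_of_locally)
    fix x assume x: "x \<in> \<omega>"
    from loc[OF this] obtain d where d: "P x d" unfolding P_def by blast
    then have "P x c" using C[OF d] c[OF x] by simp
    then show "\<exists>U. open U \<and> x \<in> U \<and> (AE y in lebesgue. y \<in> U \<longrightarrow> f y = c)" unfolding P_def .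
  qed
  then show ?thesis by blast
qed

text \<open>The mollifications converge to f when paired with test functions, so any other limit G
  in this weak sense must coincide with f.\<close>

lemma AE_eq_of_mollify_limit:
  fixes f G :: "real^'n::finite \<Rightarrow> real"
  assumes f: "integrable lborel f" and U: "open U" "locally_integrable U G"
    and r: "\<And>n. r n > 0" "r \<longlonglongrightarrow> 0"
    and lim: "\<And>\<psi>. test_function U \<psi> \<Longrightarrow>
      (\<lambda>n. LINT y|lborel. mollify f (mollifier (r n)) y * \<psi> y) \<longlonglongrightarrow> (LINT y|lebesgue_on U. G y * \<psi> y)"
  shows "AE x in lebesgue. x \<in> U \<longrightarrow> f x = G x"
  unfolding AE_lebesgue_on_open_iff[OF U(1), symmetric]
proof (rule AE_eq_of_test_functions[OF U(1) locally_integrable_integrable[OF f] U(2)])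
  fix \<psi> assume \<psi>: "test_function U \<psi>"
  have "(LINT x|lborel. f x * \<psi> x) = (LINT y|lebesgue_on U. G y * \<psi> y)"
    by (rule LIMSEQ_unique[OF integral_mollify_tendsto[OF f \<psi> r] lim[OF \<psi>]])
  moreover have "(LINT x|lebesgue_on U. f x * \<psi> x) = (LINT x|lborel. f x * \<psi> x)"
    by (rule integral_lebesgue_on_borel)
      (use U(1) borel_measurable_integrable[OF f] test_function_borel[OF \<psi>] test_function_zero[OF \<psi>] in auto)
  ultimately show "(LINT x|lebesgue_on U. f x * \<psi> x) = (LINT x|lebesgue_on U. G x * \<psi> x)" by simp
qed

text \<open>The witness is the mollifier centred at y, which is supported in U. One \<phi> serves
  all functions and all directions, so a system of weak equations on U becomes a system of pointwise
  equations between the mollified functions at y.\<close>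

lemma mollify_partial_mollifier:
  fixes y :: "real^'n::finite"
  assumes "r > 0" "cball y r \<subseteq> U"
  obtains \<phi> where "test_function U \<phi>"
    "\<And>f i. mollify f (partial i (mollifier r)) y = (LINT x|lborel. f x * partial i \<phi> x)"
proof
  show "test_function U (\<lambda>x. mollifier r (x - y))"
  proof (rule test_function_translate[OF test_function_mollifier[OF assms(1) order_refl]])
    fix x :: "real^'n" assume "x \<in> cball 0 r"
    then have "x + y \<in> cball y r" by (simp add: dist_norm)
    then show "x + y \<in> U" using assms(2) by blast
  qed
  have d: "(mollifier r :: real^'n \<Rightarrow> real) differentiable_on UNIV"
    by (rule test_function_differentiable[OF test_function_mollifier[OF assms(1) order_refl]])
  show "mollify f (partial i (mollifier r)) y = (LINT x|lborel. f x * partial i (\<lambda>x. mollifier r (x - y)) x)" for f i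
    by (simp add: mollify_def partial_translate[OF d])
qed

text \<open>Mollifications of f have vanishing classical gradient on the half ball, hence are
  constant there; only the convergence of these constants has to be shown.\<close>

lemma AE_constant_of_weak_gradient_0_ball:
  fixes f :: "real^'n::finite \<Rightarrow> real"
  assumes f: "integrable lborel f" and "R > 0"
    and 0: "\<And>i \<phi>. test_function (ball z R) \<phi> \<Longrightarrow> (LINT x|lborel. f x * partial i \<phi> x) = 0"
  shows "\<exists>c. AE x in lebesgue. x \<in> ball z (R / 2) \<longrightarrow> f x = c"
proof -
  \<comment> \<open>Radii up to R/4 keep the mollifiers centred in the half ball supported inside
    \<open>ball z R\<close>.\<close>
  define r where "r n = R / 4 * inverse (real (Suc n))" for n
  have r: "r n > 0" "r n \<le> R / 4" for n
    using \<open>R > 0\<close> by (auto simp: r_def field_simps)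
  have rlim: "r \<longlonglongrightarrow> 0"
    unfolding r_def by (rule tendsto_mult_right_zero[OF LIMSEQ_inverse_real_of_nat])
  define m where "m n = mollify f (mollifier (r n))" for n
  have der: "(m n has_derivative (\<lambda>h. 0)) (at y within ball z (R / 2))" if y: "y \<in> ball z (R / 2)" for n y
  proof -
    have sub: "cball y (r n) \<subseteq> ball z R"
    proof
      fix x assume "x \<in> cball y (r n)"
      then show "x \<in> ball z R"
        using y r(2)[of n] \<open>R > 0\<close> dist_triangle[of z x y] by simp
    qed
    obtain \<phi> where "test_function (ball z R) \<phi>"
      "\<And>f i. mollify f (partial i (mollifier (r n))) y = (LINT x|lborel. f x * partial i \<phi> x)"
      by (rule mollify_partial_mollifier[OF r(1) sub]) blast
    then have "mollify f (partial i (mollifier (r n))) y = 0" for i using 0 by simp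
    then show ?thesis
      using mollify_has_derivative[OF f test_function_mollifier[OF r(1) subset_UNIV], of n y]
      by (auto simp: m_def intro: has_derivative_at_withinI)
  qed
  have const: "m n y = m n z" if "y \<in> ball z (R / 2)" for n y
    by (rule has_derivative_zero_unique[OF convex_ball der that]) (use \<open>R > 0\<close> in simp_all)
  have mint: "(LINT y|lborel. m n y * \<psi> y) = m n z * (LINT y|lborel. \<psi> y)" if "test_function (ball z (R / 2)) \<psi>" for n \<psi>
  proof -
    have eq: "m n y * \<psi> y = m n z * \<psi> y" for y
      using const[of y n] test_function_zero[OF that, of y] by (cases "y \<in> ball z (R / 2)") auto
    show ?thesis unfolding eq by simp
  qed
  \<comment> \<open>Testing with a function of integral 1 supported in the half ball reads off the
    constant \<open>m n z\<close>, so weak convergence yields convergence of the constants.\<close>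
  define \<psi>0 where "\<psi>0 x = mollifier (R / 4) (x - z)" for x
  have t4: "test_function (cball 0 (R / 4)) (mollifier (R / 4) :: real^'n \<Rightarrow> real)"
    by (rule test_function_mollifier) (use \<open>R > 0\<close> in auto)
  have \<psi>0: "test_function (ball z (R / 2)) \<psi>0"
    unfolding \<psi>0_def by (rule test_function_translate[OF t4]) (use \<open>R > 0\<close> in \<open>auto simp: dist_norm\<close>)
  have i0: "(LINT y|lborel. \<psi>0 y) = 1"
    unfolding \<psi>0_def using integral_translate[OF test_function_borel[OF t4]] integral_mollifier[of "R / 4", where 'n='n] \<open>R > 0\<close>
    by simp
  define c where "c = (LINT x|lborel. f x * \<psi>0 x)"
  have clim: "(\<lambda>n. m n z) \<longlonglongrightarrow> c"
    using integral_mollify_tendsto[OF f \<psi>0 r(1) rlim] mint[OF \<psi>0] i0 by (simp add: c_def m_def)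
  have "AE x in lebesgue. x \<in> ball z (R / 2) \<longrightarrow> f x = c"
  proof (rule AE_eq_of_mollify_limit[OF f open_ball locally_integrable_continuous[OF continuous_on_const] r(1) rlim])
    fix \<psi> assume \<psi>: "test_function (ball z (R / 2)) \<psi>"
    have eq: "(LINT y|lebesgue_on (ball z (R / 2)). c * \<psi> y) = (LINT y|lborel. c * \<psi> y)"
      by (rule integral_lebesgue_on_borel) (use test_function_borel[OF \<psi>] test_function_zero[OF \<psi>] in auto)
    show "(\<lambda>n. LINT y|lborel. mollify f (mollifier (r n)) y * \<psi> y) \<longlonglongrightarrow> (LINT y|lebesgue_on (ball z (R / 2)). c * \<psi> y)"
      unfolding eq using tendsto_mult[OF clim tendsto_const, of "LINT y|lborel. \<psi> y"] mint[OF \<psi>] by (simp add: m_def)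
  qed
  then show ?thesis by blast
qed

lemma AE_constant_of_weak_gradient_0:
  fixes u :: "real^'n::finite \<Rightarrow> real"
  assumes \<omega>: "open \<omega>" "connected \<omega>" and u: "locally_integrable \<omega> u"
    and 0: "\<And>i \<phi>. test_function \<omega> \<phi> \<Longrightarrow> (LINT x|lebesgue_on \<omega>. u x * partial i \<phi> x) = 0"
  shows "\<exists>c. AE x in lebesgue_on \<omega>. u x = c"
  unfolding AE_lebesgue_on_open_iff[OF \<omega>(1)]
proof (rule AE_constant_of_locally_constant[OF \<omega>(2)])
  fix z assume "z \<in> \<omega>"
  then obtain R where R: "R > 0" "cball z R \<subseteq> \<omega>" using \<omega>(1) open_contains_cball by blast
  obtain g where g: "integrable lborel g" "AE x in lebesgue. x \<in> cball z R \<longrightarrow> u x = g x"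
    "\<And>\<phi>. test_function (cball z R) \<phi> \<Longrightarrow>
       integrable (lebesgue_on \<omega>) (\<lambda>x. u x * \<phi> x) \<and>
       (LINT x|lebesgue_on \<omega>. u x * \<phi> x) = (LINT x|lborel. g x * \<phi> x)"
    by (rule locally_integrable_ae_borel[OF u compact_cball R(2) \<omega>(1)]) blast
  have "\<exists>c. AE x in lebesgue. x \<in> ball z (R / 2) \<longrightarrow> g x = c"
  proof (rule AE_constant_of_weak_gradient_0_ball[OF g(1) R(1)])
    fix i \<phi> assume "test_function (ball z R) \<phi>"
    then have t: "test_function (cball z R) \<phi>" by (rule test_function_mono[OF _ ball_subset_cball])
    show "(LINT x|lborel. g x * partial i \<phi> x) = 0"
      using g(3)[OF test_function_partial[OF t, of i]] 0[OF test_function_mono[OF t R(2)], of i] by simp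
  qed
  then obtain c where c: "AE x in lebesgue. x \<in> ball z (R / 2) \<longrightarrow> g x = c" by blast
  have "AE x in lebesgue. x \<in> ball z (R / 2) \<longrightarrow> u x = c"
    using c g(2) by eventually_elim (use R(1) in auto)
  then show "\<exists>U c. open U \<and> z \<in> U \<and> (AE y in lebesgue. y \<in> U \<longrightarrow> u y = c)"
    using R(1) by (intro exI[of _ "ball z (R / 2)"]) auto
qed

section \<open>Weak Beltrami equations with constant coefficients\<close>

lemma mollify_bounded:
  fixes f :: "real^'n::finite \<Rightarrow> real"
  assumes f: "integrable lborel f" "AE x in lborel. \<bar>f x\<bar> \<le> k" and r: "r > 0"
  shows "\<bar>mollify f (mollifier r) y\<bar> \<le> k"
proof -
  have m: "test_function UNIV (mollifier r :: real^'n \<Rightarrow> real)"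
    by (rule test_function_mollifier[OF r subset_UNIV])
  have int1: "(LINT x|lborel. mollifier r (x - y)) = 1"
    using integral_translate[OF test_function_borel[OF m]] integral_mollifier[OF r] by simp
  then have i: "integrable lborel (\<lambda>x. mollifier r (x - y))"
    using not_integrable_integral_eq by fastforce
  have "norm (mollify f (mollifier r) y) \<le> (LINT x|lborel. norm (f x * mollifier r (x - y)))"
    unfolding mollify_def by (rule integral_norm_bound)
  also have "\<dots> \<le> (LINT x|lborel. k * mollifier r (x - y))"
  proof (rule integral_mono_AE)
    show "integrable lborel (\<lambda>x. norm (f x * mollifier r (x - y)))"
      using integrable_mollify[OF f(1) m] by (rule integrable_norm)
    show "integrable lborel (\<lambda>x. k * mollifier r (x - y))" using i by simp
    show "AE x in lborel. norm (f x * mollifier r (x - y)) \<le> k * mollifier r (x - y)"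
      using f(2)
    proof eventually_elim
      case (elim x)
      from mult_right_mono[OF this mollifier_nonneg[OF r]] show ?case
        by (simp add: abs_mult mollifier_nonneg r)
    qed
  qed
  also have "\<dots> = k" by (simp add: int1)
  finally show ?thesis by simp
qed

text \<open>With f = X + i Y and \<mu> = \<alpha> + i \<tau> the hypotheses are the real and
  imaginary parts of d2 f = \<mu> d1 f. This is the Cauchy-Riemann equation in the complex
  coordinate y1 + \<mu> y2, which is a genuine coordinate because \<tau> is nonzero.\<close>

lemma AE_constant_of_weak_beltrami_ball:
  fixes X Y :: "real^2 \<Rightarrow> real"
  assumes X: "integrable lborel X" and Y: "integrable lborel Y" and R: "R > 0" and \<tau>: "\<tau> > 0" and k: "k \<ge> 0"
    and bd: "AE x in lborel. \<bar>X x\<bar> \<le> k" "AE x in lborel. \<bar>Y x\<bar> \<le> k"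
    and mod: "AE x in lebesgue. x \<in> ball z R \<longrightarrow> (X x)\<^sup>2 + (Y x)\<^sup>2 = k\<^sup>2"
    and X2: "\<And>\<phi>. test_function (ball z R) \<phi> \<Longrightarrow> (LINT x|lborel. X x * partial 2 \<phi> x) =
        \<alpha> * (LINT x|lborel. X x * partial 1 \<phi> x) - \<tau> * (LINT x|lborel. Y x * partial 1 \<phi> x)"
    and Y2: "\<And>\<phi>. test_function (ball z R) \<phi> \<Longrightarrow> (LINT x|lborel. Y x * partial 2 \<phi> x) =
        \<tau> * (LINT x|lborel. X x * partial 1 \<phi> x) + \<alpha> * (LINT x|lborel. Y x * partial 1 \<phi> x)"
  shows "\<exists>c. AE x in lebesgue. x \<in> ball z (R / 2) \<longrightarrow> (X x, Y x) = c"
proof -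
  define r where "r n = R / 4 * inverse (real (Suc n))" for n
  have r: "r n > 0" "r n \<le> R / 4" for n
    using \<open>R > 0\<close> by (auto simp: r_def field_simps)
  have rlim: "r \<longlonglongrightarrow> 0"
    unfolding r_def by (rule tendsto_mult_right_zero[OF LIMSEQ_inverse_real_of_nat])
  define D where "D = ball z (R / 2)"
  define \<mu> where "\<mu> = Complex \<alpha> \<tau>"
  define T :: "complex \<Rightarrow> real^2" where
    "T w = vector [Re w - \<alpha> / \<tau> * Im w, Im w / \<tau>]" for w
  define Z :: "real^2 \<Rightarrow> complex" where "Z y = of_real (y $ 1) + \<mu> * of_real (y $ 2)" for y
  have TZ: "T (Z y) = y" for y
    using \<tau> by (simp add: T_def Z_def \<mu>_def vec_eq_iff forall_2)
  have ZT: "Z (T w) = w" for w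
    using \<tau> by (simp add: T_def Z_def \<mu>_def complex_eq_iff field_simps)
  have linT: "linear T"
    by (rule linearI) (use \<tau> in \<open>auto simp: T_def vec_eq_iff forall_2 field_simps\<close>)
  have contT: "continuous_on A T" for A
    by (rule linear_continuous_on) (use linT in \<open>simp add: linear_conv_bounded_linear\<close>)
  have contZ: "continuous_on A Z" for A
    unfolding Z_def by (intro continuous_intros)
  define S where "S = T -` D"
  have S: "open S"
    unfolding S_def D_def by (rule open_vimage[OF open_ball contT])
  have convS: "connected S"
    unfolding S_def D_def by (intro convex_connected convex_linear_vimage[OF linT] convex_ball)
  define m where "m n = mollify X (mollifier (r n))" for n
  define l where "l n = mollify Y (mollifier (r n))" for n
  have ml: "\<bar>m n y\<bar> \<le> k" "\<bar>l n y\<bar> \<le> k" for n y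
    unfolding m_def l_def by (rule mollify_bounded[OF X bd(1) r(1)], rule mollify_bounded[OF Y bd(2) r(1)])
  define h where "h n w = Complex (m n (T w)) (l n (T w))" for n w
  have hol: "h n holomorphic_on S" for n
    unfolding holomorphic_on_open[OF S]
  proof (intro ballI)
    fix w assume "w \<in> S"
    define y where "y = T w"
    have y: "y \<in> ball z (R / 2)" using \<open>w \<in> S\<close> by (simp add: S_def D_def y_def)
    have sub: "cball y (r n) \<subseteq> ball z R"
    proof
      fix x assume "x \<in> cball y (r n)"
      then show "x \<in> ball z R"
        using y r(2)[of n] \<open>R > 0\<close> dist_triangle[of z x y] by simp
    qed
    obtain \<phi> where \<phi>: "test_function (ball z R) \<phi>"
      "\<And>f i. mollify f (partial i (mollifier (r n))) y = (LINT x|lborel. f x * partial i \<phi> x)"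
      by (rule mollify_partial_mollifier[OF r(1) sub]) blast
    \<comment> \<open>\<open>P\<close> and \<open>Q\<close> are the gradients of \<open>m n\<close>
      and \<open>l n\<close> at y; the sign is that of
      \<open>mollify_has_derivative\<close>.\<close>
    define P where "P i = - mollify X (partial i (mollifier (r n))) y" for i
    define Q where "Q i = - mollify Y (partial i (mollifier (r n))) y" for i
    have P2: "P 2 = \<alpha> * P 1 - \<tau> * Q 1" and Q2: "Q 2 = \<tau> * P 1 + \<alpha> * Q 1"
      unfolding P_def Q_def \<phi>(2) X2[OF \<phi>(1)] Y2[OF \<phi>(1)] by simp_all
    note moll = test_function_mollifier[OF r(1)[of n] subset_UNIV]
    have dm: "(m n has_derivative (\<lambda>h. h $ 1 * P 1 + h $ 2 * P 2)) (at (T w))"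
      using mollify_has_derivative[OF X moll, of y]
      by (simp add: m_def P_def y_def sum_2 algebra_simps)
    have dl: "(l n has_derivative (\<lambda>h. h $ 1 * Q 1 + h $ 2 * Q 2)) (at (T w))"
      using mollify_has_derivative[OF Y moll, of y]
      by (simp add: l_def Q_def y_def sum_2 algebra_simps)
    have dT: "(T has_derivative T) (at w)"
      using linT by (simp add: linear_conv_bounded_linear bounded_linear_imp_has_derivative)
    have heq: "h n = (\<lambda>w. of_real (m n (T w)) + \<i> * of_real (l n (T w)))"
      by (rule ext) (simp add: h_def complex_eq_iff)
    have "(h n has_derivative (\<lambda>u. of_real (T u $ 1 * P 1 + T u $ 2 * P 2) +
        \<i> * of_real (T u $ 1 * Q 1 + T u $ 2 * Q 2))) (at w)"
      unfolding heq
      by (intro has_derivative_add has_derivative_of_real has_derivative_mult_right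
          has_derivative_compose[OF dT dm] has_derivative_compose[OF dT dl])
    \<comment> \<open>The increment u is \<open>T u $ 1 + \<mu> * T u $ 2\<close>, so the relations
      \<open>P2\<close> and \<open>Q2\<close> make the real derivative multiplication by the complex
      number \<open>P 1 + i Q 1\<close>.\<close>
    moreover have "(\<lambda>u. of_real (T u $ 1 * P 1 + T u $ 2 * P 2) +
        \<i> * of_real (T u $ 1 * Q 1 + T u $ 2 * Q 2)) = (*) (Complex (P 1) (Q 1))"
    proof
      fix u
      have u: "u = Complex (T u $ 1 + \<alpha> * T u $ 2) (\<tau> * T u $ 2)"
        using ZT[of u] by (simp add: Z_def \<mu>_def complex_eq_iff)
      have "of_real (T u $ 1 * P 1 + T u $ 2 * P 2) + \<i> * of_real (T u $ 1 * Q 1 + T u $ 2 * Q 2) =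
        Complex (P 1) (Q 1) * Complex (T u $ 1 + \<alpha> * T u $ 2) (\<tau> * T u $ 2)"
        unfolding P2 Q2 by (simp add: complex_eq_iff algebra_simps)
      then show "of_real (T u $ 1 * P 1 + T u $ 2 * P 2) + \<i> * of_real (T u $ 1 * Q 1 + T u $ 2 * Q 2) =
        Complex (P 1) (Q 1) * u" using u by simp
    qed
    ultimately show "\<exists>f'. (h n has_field_derivative f') (at w)"
      unfolding has_field_derivative_def by metis
  qed
  have hb: "norm (h n w) \<le> 2 * k" for n w
    using cmod_le[of "h n w"] ml[of n "T w"] by (simp add: h_def)
  obtain g \<rho> where g: "g holomorphic_on S" "strict_mono (\<rho> :: nat \<Rightarrow> nat)"
    "\<And>x. x \<in> S \<Longrightarrow> ((\<lambda>n. h (\<rho> n) x) \<longlongrightarrow> g x) sequentially"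
  proof (rule Montel[OF S, of "range h" h])
    show "\<And>f. f \<in> range h \<Longrightarrow> f holomorphic_on S" using hol by blast
    show "\<exists>B. \<forall>f\<in>range h. \<forall>z\<in>K. norm (f z) \<le> B" for K using hb by blast
  qed auto
  have contg: "continuous_on D (\<lambda>y. g (Z y))"
  proof (rule continuous_on_compose2[OF holomorphic_on_imp_continuous_on[OF g(1)] contZ])
    show "Z ` D \<subseteq> S" using TZ by (auto simp: S_def)
  qed
  have limg: "(\<lambda>n. Complex (m (\<rho> n) y) (l (\<rho> n) y)) \<longlonglongrightarrow> g (Z y)" if "y \<in> D" for y
    using g(3)[of "Z y"] that TZ[of y] by (simp add: S_def h_def)
  have r': "r (\<rho> n) > 0" for n by (rule r(1))
  have rlim': "(\<lambda>n. r (\<rho> n)) \<longlonglongrightarrow> 0"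
    using LIMSEQ_subseq_LIMSEQ[OF rlim g(2)] by (simp add: o_def)
  \<comment> \<open>Bounded pointwise convergence on D gives convergence of the pairings, and this
    identifies the limit with the original function.\<close>
  have lim: "AE x in lebesgue. x \<in> D \<longrightarrow> f x = G x"
    if f: "integrable lborel f" "AE x in lborel. \<bar>f x\<bar> \<le> k" and G: "continuous_on D G"
      and conv: "\<And>y. y \<in> D \<Longrightarrow> (\<lambda>n. mollify f (mollifier (r (\<rho> n))) y) \<longlonglongrightarrow> G y" for f G
  proof (rule AE_eq_of_mollify_limit[OF f(1) _ locally_integrable_continuous[OF G] r' rlim'])
    show "open D" by (simp add: D_def)
    fix \<psi> assume \<psi>: "test_function D \<psi>"
    \<comment> \<open>G is controlled only on D; its extension by 0 is Borel on the whole space and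
      has the same pairings with test functions on D.\<close>
    define H where "H y = (if y \<in> D then G y else 0)" for y
    have Hm: "(\<lambda>y. H y * \<psi> y) \<in> borel_measurable borel"
    proof -
      have "H \<in> borel_measurable borel"
        unfolding H_def by (rule borel_measurable_continuous_on_if) (use G in \<open>auto simp: D_def\<close>)
      then show ?thesis using test_function_borel[OF \<psi>] by simp
    qed
    have "(LINT y|lebesgue_on D. G y * \<psi> y) = (LINT y|lebesgue_on D. H y * \<psi> y)"
      by (rule Bochner_Integration.integral_cong) (auto simp: H_def)
    also have "\<dots> = (LINT y|lborel. H y * \<psi> y)"
      by (rule integral_lebesgue_on_borel[OF _ Hm]) (auto simp: D_def H_def)
    finally have eq: "(LINT y|lebesgue_on D. G y * \<psi> y) = (LINT y|lborel. H y * \<psi> y)" .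
    show "(\<lambda>n. LINT y|lborel. mollify f (mollifier (r (\<rho> n))) y * \<psi> y) \<longlonglongrightarrow> (LINT y|lebesgue_on D. G y * \<psi> y)"
      unfolding eq
    proof (rule integral_dominated_convergence[where w="\<lambda>y. k * \<bar>\<psi> y\<bar>"])
      show "(\<lambda>y. H y * \<psi> y) \<in> borel_measurable lborel" using Hm by simp
      have "continuous_on UNIV (mollify f (mollifier (r (\<rho> n))))" for n
        using mollify_has_derivative[OF f(1) test_function_mollifier[OF r' subset_UNIV]]
        by (intro continuous_at_imp_continuous_on ballI has_derivative_continuous) blast
      then show "(\<lambda>y. mollify f (mollifier (r (\<rho> n))) y * \<psi> y) \<in> borel_measurable lborel" for n
        using test_function_borel[OF \<psi>] borel_measurable_continuous_onI[of "mollify f (mollifier (r (\<rho> n)))"]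
        by simp
      show "integrable lborel (\<lambda>y. k * \<bar>\<psi> y\<bar>)" using integrable_test_function[OF \<psi>] by simp
      show "AE y in lborel. (\<lambda>n. mollify f (mollifier (r (\<rho> n))) y * \<psi> y) \<longlonglongrightarrow> H y * \<psi> y"
      proof (rule AE_I2)
        fix y
        show "(\<lambda>n. mollify f (mollifier (r (\<rho> n))) y * \<psi> y) \<longlonglongrightarrow> H y * \<psi> y"
        proof (cases "y \<in> D")
          case True
          then show ?thesis using tendsto_mult[OF conv tendsto_const] by (simp add: H_def)
        next
          case False
          then show ?thesis using test_function_zero[OF \<psi>] by simp
        qed
      qed
      show "AE y in lborel. norm (mollify f (mollifier (r (\<rho> n))) y * \<psi> y) \<le> k * \<bar>\<psi> y\<bar>" for n
        using mult_right_mono[OF mollify_bounded[OF f r'[of n]] abs_ge_zero]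
        by (intro AE_I2) (simp add: abs_mult)
    qed
  qed
  have XG: "AE x in lebesgue. x \<in> D \<longrightarrow> X x = Re (g (Z x))"
    by (rule lim[OF X bd(1) continuous_on_Re[OF contg]]) (use tendsto_Re[OF limg] in \<open>simp add: m_def\<close>)
  have YG: "AE x in lebesgue. x \<in> D \<longrightarrow> Y x = Im (g (Z x))"
    by (rule lim[OF Y bd(2) continuous_on_Im[OF contg]]) (use tendsto_Im[OF limg] in \<open>simp add: l_def\<close>)
  have gk: "AE x in lebesgue. x \<in> D \<longrightarrow> norm (g (Z x)) = k"
    using XG YG mod
  proof eventually_elim
    case (elim x)
    show ?case
    proof
      assume "x \<in> D"
      moreover from this have "x \<in> ball z R" using R by (simp add: D_def)
      ultimately show "norm (g (Z x)) = k" using elim k by (simp add: cmod_def)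
    qed
  qed
  \<comment> \<open>The set where the modulus of the continuous function \<open>g (Z x)\<close>
    differs from k is open and null, hence empty. The maximum principle needs the identity at every
    point.\<close>
  have all: "norm (g (Z x)) = k" if "x \<in> D" for x
  proof (rule ccontr)
    assume ne: "norm (g (Z x)) \<noteq> k"
    define W where "W = {x \<in> D. norm (g (Z x)) \<in> - {k}}"
    have "open W"
      unfolding W_def
      using continuous_open_preimage[OF continuous_on_norm[OF contg] _ open_Compl[OF closed_singleton], of k]
      by (simp add: D_def vimage_def Int_def)
    moreover have "W \<noteq> {}" using that ne by (auto simp: W_def)
    moreover have "AE x in lebesgue. x \<in> W \<longrightarrow> False" using gk by eventually_elim (auto simp: W_def)
    ultimately show False using AE_open_ex[of W "\<lambda>_. False"] by blast
  qed
  have all': "norm (g w) = k" if "w \<in> S" for w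
    using all[of "T w"] that ZT by (simp add: S_def)
  have zS: "Z z \<in> S" using R TZ by (simp add: S_def D_def)
  have "g constant_on S"
    by (rule maximum_modulus_principle[OF g(1) S convS S order_refl zS]) (use all' zS in simp)
  then obtain c where c: "\<And>w. w \<in> S \<Longrightarrow> g w = c" unfolding constant_on_def by blast
  have "AE x in lebesgue. x \<in> D \<longrightarrow> (X x, Y x) = (Re c, Im c)"
    using XG YG by eventually_elim (use c TZ in \<open>auto simp: S_def\<close>)
  then show ?thesis unfolding D_def by blast
qed

lemma AE_constant_of_weak_beltrami:
  fixes X Y :: "real^2 \<Rightarrow> real"
  assumes \<omega>: "open \<omega>" "connected \<omega>" and X: "locally_integrable \<omega> X" and Y: "locally_integrable \<omega> Y"
    and \<tau>: "\<tau> > 0" and k: "k \<ge> 0"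
    and mod: "AE x in lebesgue_on \<omega>. (X x)\<^sup>2 + (Y x)\<^sup>2 = k\<^sup>2"
    and X2: "\<And>\<phi>. test_function \<omega> \<phi> \<Longrightarrow> (LINT x|lebesgue_on \<omega>. X x * partial 2 \<phi> x) =
        \<alpha> * (LINT x|lebesgue_on \<omega>. X x * partial 1 \<phi> x) - \<tau> * (LINT x|lebesgue_on \<omega>. Y x * partial 1 \<phi> x)"
    and Y2: "\<And>\<phi>. test_function \<omega> \<phi> \<Longrightarrow> (LINT x|lebesgue_on \<omega>. Y x * partial 2 \<phi> x) =
        \<tau> * (LINT x|lebesgue_on \<omega>. X x * partial 1 \<phi> x) + \<alpha> * (LINT x|lebesgue_on \<omega>. Y x * partial 1 \<phi> x)"
  shows "\<exists>c. AE x in lebesgue_on \<omega>. (X x, Y x) = c"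
  unfolding AE_lebesgue_on_open_iff[OF \<omega>(1)]
proof (rule AE_constant_of_locally_constant[OF \<omega>(2)])
  fix z assume "z \<in> \<omega>"
  then obtain R where R: "R > 0" "cball z R \<subseteq> \<omega>" using \<omega>(1) open_contains_cball by blast
  obtain f where f: "integrable lborel f" "\<And>x. x \<notin> cball z R \<Longrightarrow> f x = 0" "AE x in lebesgue. x \<in> cball z R \<longrightarrow> X x = f x"
    "\<And>\<phi>. test_function (cball z R) \<phi> \<Longrightarrow>
       integrable (lebesgue_on \<omega>) (\<lambda>x. X x * \<phi> x) \<and>
       (LINT x|lebesgue_on \<omega>. X x * \<phi> x) = (LINT x|lborel. f x * \<phi> x)"
    by (rule locally_integrable_ae_borel[OF X compact_cball R(2) \<omega>(1)]) blast
  obtain g where g: "integrable lborel g" "\<And>x. x \<notin> cball z R \<Longrightarrow> g x = 0" "AE x in lebesgue. x \<in> cball z R \<longrightarrow> Y x = g x"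
    "\<And>\<phi>. test_function (cball z R) \<phi> \<Longrightarrow>
       integrable (lebesgue_on \<omega>) (\<lambda>x. Y x * \<phi> x) \<and>
       (LINT x|lebesgue_on \<omega>. Y x * \<phi> x) = (LINT x|lborel. g x * \<phi> x)"
    by (rule locally_integrable_ae_borel[OF Y compact_cball R(2) \<omega>(1)]) blast
  have mod': "AE x in lebesgue. x \<in> \<omega> \<longrightarrow> (X x)\<^sup>2 + (Y x)\<^sup>2 = k\<^sup>2"
    using mod by (simp add: AE_lebesgue_on_open_iff[OF \<omega>(1)])
  have fg: "AE x in lebesgue. x \<in> cball z R \<longrightarrow> (f x)\<^sup>2 + (g x)\<^sup>2 = k\<^sup>2"
    using mod' f(3) g(3) by eventually_elim (use R(2) in auto)
  \<comment> \<open>The representatives vanish outside the closed ball, so the bound that follows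
    from the modulus inside it holds on the whole space.\<close>
  have "AE x in lebesgue. \<bar>f x\<bar> \<le> k \<and> \<bar>g x\<bar> \<le> k"
    using fg
  proof eventually_elim
    case (elim x)
    show ?case
    proof (cases "x \<in> cball z R")
      case True
      then have "(f x)\<^sup>2 + (g x)\<^sup>2 = k\<^sup>2" using elim by blast
      then have "\<bar>f x\<bar>\<^sup>2 \<le> k\<^sup>2" "\<bar>g x\<bar>\<^sup>2 \<le> k\<^sup>2"
        using zero_le_power2[of "f x"] zero_le_power2[of "g x"] unfolding power2_abs by linarith+
      then show ?thesis using k by (auto intro: power2_le_imp_le)
    next
      case False
      then show ?thesis using f(2) g(2) k by simp
    qed
  qed
  then have bdfg: "AE x in lborel. \<bar>f x\<bar> \<le> k \<and> \<bar>g x\<bar> \<le> k"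
    by (simp only: AE_completion_iff)
  have t: "test_function (cball z R) \<phi>" if "test_function (ball z R) \<phi>" for \<phi>
    using that by (rule test_function_mono[OF _ ball_subset_cball])
  have eqs: "(LINT x|lborel. f x * partial i \<phi> x) = (LINT x|lebesgue_on \<omega>. X x * partial i \<phi> x)"
    "(LINT x|lborel. g x * partial i \<phi> x) = (LINT x|lebesgue_on \<omega>. Y x * partial i \<phi> x)"
    if "test_function (ball z R) \<phi>" for i \<phi>
    using f(4)[OF test_function_partial[OF t[OF that]]] g(4)[OF test_function_partial[OF t[OF that]]] by simp_all
  have "\<exists>c. AE x in lebesgue. x \<in> ball z (R / 2) \<longrightarrow> (f x, g x) = c"
  proof (rule AE_constant_of_weak_beltrami_ball[OF f(1) g(1) R(1) \<tau> k])
    show "AE x in lborel. \<bar>f x\<bar> \<le> k" "AE x in lborel. \<bar>g x\<bar> \<le> k"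
      using bdfg by (eventually_elim, simp)+
    show "AE x in lebesgue. x \<in> ball z R \<longrightarrow> (f x)\<^sup>2 + (g x)\<^sup>2 = k\<^sup>2"
      using fg by eventually_elim auto
    fix \<phi> assume \<phi>: "test_function (ball z R) \<phi>"
    note \<phi>' = test_function_mono[OF t[OF \<phi>] R(2)]
    show "(LINT x|lborel. f x * partial 2 \<phi> x) =
        \<alpha> * (LINT x|lborel. f x * partial 1 \<phi> x) - \<tau> * (LINT x|lborel. g x * partial 1 \<phi> x)"
      unfolding eqs[OF \<phi>] by (rule X2[OF \<phi>'])
    show "(LINT x|lborel. g x * partial 2 \<phi> x) =
        \<tau> * (LINT x|lborel. f x * partial 1 \<phi> x) + \<alpha> * (LINT x|lborel. g x * partial 1 \<phi> x)"
      unfolding eqs[OF \<phi>] by (rule Y2[OF \<phi>'])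
  qed
  then obtain c where c: "AE x in lebesgue. x \<in> ball z (R / 2) \<longrightarrow> (f x, g x) = c" by blast
  have "AE x in lebesgue. x \<in> ball z (R / 2) \<longrightarrow> (X x, Y x) = c"
    using c f(3) g(3) by eventually_elim (use R(1) in auto)
  then show "\<exists>U c. open U \<and> z \<in> U \<and> (AE y in lebesgue. y \<in> U \<longrightarrow> (X y, Y y) = c)"
    using R(1) by (intro exI[of _ "ball z (R / 2)"] exI[of _ c]) auto
qed

section \<open>Rigidity of weak Hessians\<close>

lemma weak_hessian_has_weak_derivative:
  assumes "v \<in> W22 \<omega>"
  shows "has_weak_derivative \<omega> [i, j] v (\<lambda>x. weak_hessian \<omega> v x $ i $ j)"
proof -
  have "\<exists>g. has_weak_derivative \<omega> [i, j] v g"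
    using assms unfolding W22_def by force
  then have "has_weak_derivative \<omega> [i, j] v (SOME g. has_weak_derivative \<omega> [i, j] v g)"
    by (rule someI_ex)
  then show ?thesis by (simp add: weak_hessian_def)
qed

text \<open>Equality as predicates, not just equivalence for one candidate, makes the choice
  operator in \<open>weak_hessian\<close> pick the same representative for both orders. The weak
  Hessian is therefore symmetric at every point.\<close>

lemma has_weak_derivative_swap: "has_weak_derivative \<omega> [i, j] v = has_weak_derivative \<omega> [j, i] v"
proof -
  have "has_weak_derivative \<omega> [j, i] v g" if wd: "has_weak_derivative \<omega> [i, j] v g" for i j g
    unfolding has_weak_derivative_def
  proof (intro conjI allI impI)
    show "locally_integrable \<omega> v" "locally_integrable \<omega> g"
      using wd unfolding has_weak_derivative_def by blast+
    fix \<phi> assume \<phi>: "test_function \<omega> \<phi>"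
    have "(LINT x|lebesgue_on \<omega>. v x * partials [i, j] \<phi> x) =
        (- 1) ^ length [i, j] * (LINT x|lebesgue_on \<omega>. g x * \<phi> x)"
      using wd \<phi> unfolding has_weak_derivative_def by blast
    then show "(LINT x|lebesgue_on \<omega>. v x * partials [j, i] \<phi> x) =
        (- 1) ^ length [j, i] * (LINT x|lebesgue_on \<omega>. g x * \<phi> x)"
      using partial_commute[OF test_function_Ck[OF \<phi>], of i j] by simp
  qed
  then show ?thesis by (intro ext iffI)
qed

lemma weak_hessian_sym: "weak_hessian \<omega> v x $ i $ j = weak_hessian \<omega> v x $ j $ i"
  by (simp add: weak_hessian_def has_weak_derivative_swap[of \<omega> i j])

text \<open>The rows are gradients in the sense of distributions. Apart from symmetry of the
  matrices, this is all that the rigidity arguments retain of v.\<close>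

definition weakly_curl_free :: "(real^'n::finite) set \<Rightarrow> (real^'n \<Rightarrow> real^'n^'n) \<Rightarrow> bool" where
  "weakly_curl_free \<omega> F \<longleftrightarrow> (\<forall>i j. locally_integrable \<omega> (\<lambda>x. F x $ i $ j)) \<and>
     (\<forall>\<phi> i j k. test_function \<omega> \<phi> \<longrightarrow>
        (LINT x|lebesgue_on \<omega>. F x $ i $ j * partial k \<phi> x) =
        (LINT x|lebesgue_on \<omega>. F x $ i $ k * partial j \<phi> x))"

text \<open>Both pairings equal the integral of v against a third derivative of \<phi>, and the two
  orders of differentiation agree by \<open>partial_commute\<close>.\<close>

lemma weakly_curl_free_weak_hessian:
  assumes "v \<in> W22 \<omega>"
  shows "weakly_curl_free \<omega> (weak_hessian \<omega> v)"
  unfolding weakly_curl_free_def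
proof (intro conjI allI impI)
  note wd = weak_hessian_has_weak_derivative[OF assms]
  show "locally_integrable \<omega> (\<lambda>x. weak_hessian \<omega> v x $ i $ j)" for i j
    using wd[of i j] unfolding has_weak_derivative_def by blast
  fix \<phi> i j k assume \<phi>: "test_function \<omega> \<phi>"
  have *: "(LINT x|lebesgue_on \<omega>. weak_hessian \<omega> v x $ i $ j * partial k \<phi> x) =
      (LINT x|lebesgue_on \<omega>. v x * partial i (partial j (partial k \<phi>)) x)" for j k
    using wd[of i j] test_function_partial[OF \<phi>, of k] unfolding has_weak_derivative_def by simp
  show "(LINT x|lebesgue_on \<omega>. weak_hessian \<omega> v x $ i $ j * partial k \<phi> x) =
      (LINT x|lebesgue_on \<omega>. weak_hessian \<omega> v x $ i $ k * partial j \<phi> x)"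
    unfolding * partial_commute[OF test_function_Ck[OF \<phi>], of j k] ..
qed

text \<open>The constant c disappears because a derivative of a test function has integral
  0.\<close>

lemma integral_affine_partial:
  fixes X Y :: "real^'n::finite \<Rightarrow> real"
  assumes "open \<omega>" "locally_integrable \<omega> X" "locally_integrable \<omega> Y" "test_function \<omega> \<phi>"
  shows "(LINT x|lebesgue_on \<omega>. (c + a * X x + b * Y x) * partial i \<phi> x) =
    a * (LINT x|lebesgue_on \<omega>. X x * partial i \<phi> x) + b * (LINT x|lebesgue_on \<omega>. Y x * partial i \<phi> x)"
proof -
  note t = test_function_partial[OF assms(4), of i]
  have i: "integrable (lebesgue_on \<omega>) (\<lambda>x. X x * partial i \<phi> x)" "integrable (lebesgue_on \<omega>) (\<lambda>x. Y x * partial i \<phi> x)"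
    by (rule integrable_locally_integrable_mult_test[OF assms(2,1) t],
        rule integrable_locally_integrable_mult_test[OF assms(3,1) t])
  have i1: "integrable (lebesgue_on \<omega>) (partial i \<phi>)"
    using integrable_locally_integrable_mult_test[OF locally_integrable_continuous[OF continuous_on_const] assms(1) t, of 1]
    by simp
  have "(LINT x|lebesgue_on \<omega>. (c + a * X x + b * Y x) * partial i \<phi> x) =
    (LINT x|lebesgue_on \<omega>. c * partial i \<phi> x + a * (X x * partial i \<phi> x) + b * (Y x * partial i \<phi> x))"
    by (simp add: algebra_simps)
  also have "\<dots> = c * (LINT x|lebesgue_on \<omega>. partial i \<phi> x) + a * (LINT x|lebesgue_on \<omega>. X x * partial i \<phi> x)
      + b * (LINT x|lebesgue_on \<omega>. Y x * partial i \<phi> x)"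
    using i i1 by simp
  finally show ?thesis
    using integral_partial_test_function[OF assms(1,4), of i] by simp
qed

lemma locally_integrable_affine:
  fixes X Y :: "real^'n::finite \<Rightarrow> real"
  assumes "locally_integrable \<omega> X" "locally_integrable \<omega> Y"
  shows "locally_integrable \<omega> (\<lambda>x. c + a * X x + b * Y x)"
  unfolding locally_integrable_def
proof (intro allI impI)
  fix K assume K: "compact K \<and> K \<subseteq> \<omega>"
  have "integrable (lebesgue_on K) (\<lambda>x. c)"
    using locally_integrable_continuous[OF continuous_on_const[of K c]] K
    unfolding locally_integrable_def by blast
  then show "integrable (lebesgue_on K) (\<lambda>x. c + a * X x + b * Y x)"
    using assms K unfolding locally_integrable_def by simp
qed

lemma homogeneous_2x2:
  fixes a b c d x y :: real
  assumes "a * y = b * x" "c * y = d * x" "a * d - b * c \<noteq> 0"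
  shows "x = 0 \<and> y = 0"
proof -
  have "(a * d - b * c) * x = 0" "(a * d - b * c) * y = 0"
    using assms(1,2) by algebra+
  then show ?thesis using assms(3) by simp
qed

text \<open>If \<open>F = F1 + X (F2 - F1)\<close>, curl-freeness makes the invertible matrix \<open>F2 - F1\<close> annihilate the
  rotated gradient of \<open>X\<close>.\<close>

lemma weakly_curl_free_two_values:
  fixes F :: "real^2 \<Rightarrow> real^2^2"
  assumes \<omega>: "open \<omega>" "connected \<omega>" and F: "weakly_curl_free \<omega> F"
    and ae: "AE x in lebesgue_on \<omega>. F x = F1 \<or> F x = F2"
    and det: "F1 = F2 \<or> det (F1 - F2) \<noteq> 0"
  shows "\<exists>H. AE x in lebesgue_on \<omega>. F x = H"
proof (cases "F1 = F2")
  case True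
  then show ?thesis using ae by (intro exI[of _ F1]) (auto elim: eventually_mono)
next
  case False
  define D where "D = F2 - F1"
  have "det D = det (F1 - F2)" by (simp add: D_def det_2 algebra_simps)
  then have dD: "D$1$1 * D$2$2 - D$1$2 * D$2$1 \<noteq> 0"
    using det False by (simp only: det_2 simp_thms)
  define X where "X x = (if F x = F1 then 0 else 1 :: real)" for x
  have FX: "AE x in lebesgue_on \<omega>. F x = F1 + X x *\<^sub>R D"
    using ae by eventually_elim (auto simp: X_def D_def)
  have comp: "AE x in lebesgue_on \<omega>. F x $ i $ j = F1 $ i $ j + D $ i $ j * X x" for i j
    using FX by eventually_elim (simp add: mult.commute)
  have li: "locally_integrable \<omega> (\<lambda>x. F x $ i $ j)" for i j
    using F unfolding weakly_curl_free_def by blast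
  \<comment> \<open>X is an affine function of any entry of F for which the entry of D is nonzero;
    the first row of the invertible D contains one.\<close>
  have lX: "locally_integrable \<omega> X"
  proof -
    have "D $ 1 $ 1 \<noteq> 0 \<or> D $ 1 $ 2 \<noteq> 0" using dD by auto
    then obtain i j where ij: "D $ i $ j \<noteq> 0" by blast
    have l: "locally_integrable \<omega> (\<lambda>x. - F1 $ i $ j / D $ i $ j + (1 / D $ i $ j) * F x $ i $ j + 0 * F x $ i $ j)"
      by (rule locally_integrable_affine[OF li li])
    show ?thesis
      by (rule locally_integrable_cong_AE[OF l \<omega>(1)], use comp[of i j] in eventually_elim)
        (use ij in \<open>simp add: field_simps\<close>)
  qed
  have X0: "(LINT x|lebesgue_on \<omega>. X x * partial i \<phi> x) = 0" if \<phi>: "test_function \<omega> \<phi>" for i \<phi>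
  proof -
    define I where "I k = (LINT x|lebesgue_on \<omega>. X x * partial k \<phi> x)" for k
    have int: "(LINT x|lebesgue_on \<omega>. F x $ i $ j * partial k \<phi> x) = D $ i $ j * I k" for i j k
    proof -
      note t = test_function_partial[OF \<phi>, of k]
      have l: "locally_integrable \<omega> (\<lambda>x. F1 $ i $ j + D $ i $ j * X x + 0 * X x)"
        by (rule locally_integrable_affine[OF lX lX])
      have "(LINT x|lebesgue_on \<omega>. F x $ i $ j * partial k \<phi> x) =
          (LINT x|lebesgue_on \<omega>. (F1 $ i $ j + D $ i $ j * X x + 0 * X x) * partial k \<phi> x)"
        by (rule integrable_lebesgue_on_cong_AE(2)[OF integrable_locally_integrable_mult_test[OF l \<omega>(1) t]])
          (use \<omega>(1) in simp, use comp[of i j] in eventually_elim, simp)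
      also have "\<dots> = D $ i $ j * I k"
        using integral_affine_partial[OF \<omega>(1) lX lX \<phi>, of "F1 $ i $ j" "D $ i $ j" 0 k] by (simp add: I_def)
      finally show ?thesis .
    qed
    have De: "D $ i $ 1 * I 2 = D $ i $ 2 * I 1" for i
    proof -
      have "(LINT x|lebesgue_on \<omega>. F x $ i $ 1 * partial 2 \<phi> x) = (LINT x|lebesgue_on \<omega>. F x $ i $ 2 * partial 1 \<phi> x)"
        using F \<phi> unfolding weakly_curl_free_def by blast
      then show ?thesis unfolding int .
    qed
    note e = De[of 1] De[of 2]
    have 12: "I 1 = 0" "I 2 = 0"
      using homogeneous_2x2[OF e dD] by blast+
    have "\<forall>i. I i = 0" unfolding forall_2 using 12 by blast
    then show ?thesis by (simp add: I_def)
  qed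
  obtain c where "AE x in lebesgue_on \<omega>. X x = c"
    using AE_constant_of_weak_gradient_0[OF \<omega> lX X0] by blast
  then have "AE x in lebesgue_on \<omega>. F x = F1 + c *\<^sub>R D"
    using FX by eventually_elim simp
  then show ?thesis by blast
qed

text \<open>With \<open>f = X + i Y\<close> the linear relation turns curl-freeness into \<open>\<partial>\<^sub>2 f = (\<alpha> + i \<tau>) \<partial>\<^sub>1 f\<close>, while
  \<open>det F = 0\<close> says \<open>|f| = |q|\<close>.\<close>

lemma weakly_curl_free_elliptic:
  fixes F :: "real^2 \<Rightarrow> real^2^2"
  assumes \<omega>: "open \<omega>" "connected \<omega>" and F: "weakly_curl_free \<omega> F" and \<tau>: "\<tau> > 0"
    and sym: "\<And>x. F x $ 2 $ 1 = F x $ 1 $ 2"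
    and ae: "AE x in lebesgue_on \<omega>. det (F x) = 0 \<and>
      (\<alpha>\<^sup>2 + \<tau>\<^sup>2) * F x $ 1 $ 1 - 2 * \<alpha> * F x $ 1 $ 2 + F x $ 2 $ 2 = q"
  shows "\<exists>H. AE x in lebesgue_on \<omega>. F x = H"
proof -
  have li: "locally_integrable \<omega> (\<lambda>x. F x $ i $ j)" for i j
    using F unfolding weakly_curl_free_def by blast
  \<comment> \<open>With \<mu> = \<alpha> + i \<tau>, the functions X and Y are the real and
    imaginary parts of F22 - 2 cnj \<mu> F12 + (cnj \<mu>)^2 F11 after F22 has been eliminated by
    the linear relation. The zero terms give both the shape expected by
    \<open>integral_affine_partial\<close>.\<close>
  define X where "X x = q + (- 2 * \<tau>\<^sup>2) * F x $ 1 $ 1 + 0 * F x $ 1 $ 1" for x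
  define Y where "Y x = 0 + (- 2 * \<tau> * \<alpha>) * F x $ 1 $ 1 + (2 * \<tau>) * F x $ 1 $ 2" for x
  have lX: "locally_integrable \<omega> X" and lY: "locally_integrable \<omega> Y"
    unfolding X_def Y_def by (rule locally_integrable_affine[OF li li])+
  have F22: "AE x in lebesgue_on \<omega>. F x $ 2 $ 2 = q + (- (\<alpha>\<^sup>2 + \<tau>\<^sup>2)) * F x $ 1 $ 1 + (2 * \<alpha>) * F x $ 1 $ 2"
    using ae by eventually_elim (auto simp: algebra_simps)
  have mod: "AE x in lebesgue_on \<omega>. (X x)\<^sup>2 + (Y x)\<^sup>2 = \<bar>q\<bar>\<^sup>2"
    using ae F22
  proof eventually_elim
    case (elim x)
    let ?A = "F x $ 1 $ 1" and ?B = "F x $ 1 $ 2" and ?C = "F x $ 2 $ 2"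
    have B: "?B * ?B = ?A * ?C" using elim by (simp add: det_2 sym)
    have C: "?C = q + (- (\<alpha>\<^sup>2 + \<tau>\<^sup>2)) * ?A + (2 * \<alpha>) * ?B" using elim by blast
    \<comment> \<open>Once F22 is put back for the affine expression, the right-hand side is -4
      \<tau>^2 det F.\<close>
    have "(X x)\<^sup>2 + (Y x)\<^sup>2 - q\<^sup>2 =
        4 * \<tau>\<^sup>2 * (?B * ?B - ?A * (q + (- (\<alpha>\<^sup>2 + \<tau>\<^sup>2)) * ?A + (2 * \<alpha>) * ?B))"
      unfolding X_def Y_def by (simp add: power2_eq_square algebra_simps)
    also have "\<dots> = 0" unfolding B C[symmetric] by simp
    finally show ?case by simp
  qed
  have curl: "(LINT x|lebesgue_on \<omega>. F x $ 1 $ 1 * partial 2 \<phi> x) = (LINT x|lebesgue_on \<omega>. F x $ 1 $ 2 * partial 1 \<phi> x)"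
    "(LINT x|lebesgue_on \<omega>. F x $ 1 $ 2 * partial 2 \<phi> x) =
      - (\<alpha>\<^sup>2 + \<tau>\<^sup>2) * (LINT x|lebesgue_on \<omega>. F x $ 1 $ 1 * partial 1 \<phi> x) +
      2 * \<alpha> * (LINT x|lebesgue_on \<omega>. F x $ 1 $ 2 * partial 1 \<phi> x)"
    if \<phi>: "test_function \<omega> \<phi>" for \<phi>
  proof -
    show "(LINT x|lebesgue_on \<omega>. F x $ 1 $ 1 * partial 2 \<phi> x) = (LINT x|lebesgue_on \<omega>. F x $ 1 $ 2 * partial 1 \<phi> x)"
      using F \<phi> unfolding weakly_curl_free_def by blast
    have "(LINT x|lebesgue_on \<omega>. F x $ 1 $ 2 * partial 2 \<phi> x) = (LINT x|lebesgue_on \<omega>. F x $ 2 $ 1 * partial 2 \<phi> x)"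
      by (simp add: sym)
    also have "\<dots> = (LINT x|lebesgue_on \<omega>. F x $ 2 $ 2 * partial 1 \<phi> x)"
      using F \<phi> unfolding weakly_curl_free_def by blast
    also have "\<dots> = (LINT x|lebesgue_on \<omega>. (q + (- (\<alpha>\<^sup>2 + \<tau>\<^sup>2)) * F x $ 1 $ 1 + (2 * \<alpha>) * F x $ 1 $ 2) * partial 1 \<phi> x)"
      by (rule integrable_lebesgue_on_cong_AE(2)[OF integrable_locally_integrable_mult_test[OF
            locally_integrable_affine[OF li li] \<omega>(1) test_function_partial[OF \<phi>]]])
        (use \<omega>(1) in simp, use F22 in eventually_elim, simp)
    also have "\<dots> = - (\<alpha>\<^sup>2 + \<tau>\<^sup>2) * (LINT x|lebesgue_on \<omega>. F x $ 1 $ 1 * partial 1 \<phi> x) +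
      2 * \<alpha> * (LINT x|lebesgue_on \<omega>. F x $ 1 $ 2 * partial 1 \<phi> x)"
      by (rule integral_affine_partial[OF \<omega>(1) li li \<phi>])
    finally show "(LINT x|lebesgue_on \<omega>. F x $ 1 $ 2 * partial 2 \<phi> x) =
      - (\<alpha>\<^sup>2 + \<tau>\<^sup>2) * (LINT x|lebesgue_on \<omega>. F x $ 1 $ 1 * partial 1 \<phi> x) +
      2 * \<alpha> * (LINT x|lebesgue_on \<omega>. F x $ 1 $ 2 * partial 1 \<phi> x)" .
  qed
  have "\<exists>c. AE x in lebesgue_on \<omega>. (X x, Y x) = c"
  proof (rule AE_constant_of_weak_beltrami[OF \<omega> lX lY \<tau> abs_ge_zero mod])
    fix \<phi> assume \<phi>: "test_function \<omega> \<phi>"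
    have XI: "(LINT x|lebesgue_on \<omega>. X x * partial i \<phi> x) = - 2 * \<tau>\<^sup>2 * (LINT x|lebesgue_on \<omega>. F x $ 1 $ 1 * partial i \<phi> x)" for i
      unfolding X_def integral_affine_partial[OF \<omega>(1) li li \<phi>] by simp
    have YI: "(LINT x|lebesgue_on \<omega>. Y x * partial i \<phi> x) =
        - 2 * \<tau> * \<alpha> * (LINT x|lebesgue_on \<omega>. F x $ 1 $ 1 * partial i \<phi> x) +
        2 * \<tau> * (LINT x|lebesgue_on \<omega>. F x $ 1 $ 2 * partial i \<phi> x)" for i
      unfolding Y_def integral_affine_partial[OF \<omega>(1) li li \<phi>] by simp
    show "(LINT x|lebesgue_on \<omega>. X x * partial 2 \<phi> x) =
        \<alpha> * (LINT x|lebesgue_on \<omega>. X x * partial 1 \<phi> x) - \<tau> * (LINT x|lebesgue_on \<omega>. Y x * partial 1 \<phi> x)"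
      unfolding XI YI curl[OF \<phi>] by (simp add: power2_eq_square algebra_simps)
    show "(LINT x|lebesgue_on \<omega>. Y x * partial 2 \<phi> x) =
        \<tau> * (LINT x|lebesgue_on \<omega>. X x * partial 1 \<phi> x) + \<alpha> * (LINT x|lebesgue_on \<omega>. Y x * partial 1 \<phi> x)"
      unfolding XI YI curl[OF \<phi>] by (simp add: power2_eq_square algebra_simps)
  qed
  then obtain c where c: "AE x in lebesgue_on \<omega>. (X x, Y x) = c" by blast
  \<comment> \<open>A and B solve the definitions of X and Y for F11 and F12; the last entry of H is
    then forced by the linear relation.\<close>
  define A where "A = (fst c - q) / (- 2 * \<tau>\<^sup>2)"
  define B where "B = (snd c + 2 * \<tau> * \<alpha> * A) / (2 * \<tau>)"
  define H :: "real^2^2" where "H = vector [vector [A, B], vector [B, q - (\<alpha>\<^sup>2 + \<tau>\<^sup>2) * A + 2 * \<alpha> * B]]"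
  have "AE x in lebesgue_on \<omega>. F x = H"
    using c F22
  proof eventually_elim
    case (elim x)
    have 1: "F x $ 1 $ 1 = A" using elim(1) \<tau> by (auto simp: A_def X_def)
    have 2: "F x $ 1 $ 2 = B" using elim(1) \<tau> unfolding B_def 1[symmetric] by (auto simp: Y_def field_simps)
    show ?case using elim(2) 1 2 by (simp add: H_def vec_eq_iff forall_2 sym) (simp add: algebra_simps)
  qed
  then show ?thesis by blast
qed

section \<open>Functions with constant weak Hessian\<close>

lemma partial_affine_quadratic:
  fixes H :: "real^'n::finite^'n"
  assumes "transpose H = H"
  shows "Ck k (\<lambda>x. 1/2 * (x \<bullet> (H *v x)) + (a \<bullet> x + b))"
    and "partial i (\<lambda>x. 1/2 * (x \<bullet> (H *v x)) + (a \<bullet> x + b)) = (\<lambda>x. (H *v x) $ i + a $ i)"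
    and "partial j (\<lambda>x. (H *v x) $ i + a $ i) = (\<lambda>x. H $ i $ j)"
proof -
  show "Ck k (\<lambda>x. 1/2 * (x \<bullet> (H *v x)) + (a \<bullet> x + b))"
    unfolding inner_vec_def matrix_vector_mult_def vec_lambda_beta inner_real_def
    by (intro Ck_add Ck_const Ck_sum Ck_mult Ck_component)
  have bl: "bounded_linear ((*v) H)" by (simp add: linear_conv_bounded_linear[symmetric])
  have d: "((*v) H has_derivative (*v) H) (at x)" for x
    by (rule bounded_linear_imp_has_derivative[OF bl])
  have sym: "y \<bullet> (H *v x) = x \<bullet> (H *v y)" for x y
    by (metis assms dot_lmul_matrix inner_commute transpose_matrix_vector)
  have "((\<lambda>x. 1/2 * (x \<bullet> (H *v x)) + (a \<bullet> x + b)) has_derivative (\<lambda>h. h \<bullet> (H *v x) + a \<bullet> h)) (at x)" for x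
  proof -
    have "((\<lambda>x. 1/2 * (x \<bullet> (H *v x)) + (a \<bullet> x + b)) has_derivative
        (\<lambda>h. 1/2 * (x \<bullet> (H *v h) + h \<bullet> (H *v x)) + (a \<bullet> h + 0))) (at x)"
      by (rule has_derivative_add, rule has_derivative_mult_right, rule has_derivative_inner[OF has_derivative_ident d],
          rule has_derivative_add, rule has_derivative_inner_right[OF has_derivative_ident], rule has_derivative_const)
    then show ?thesis using sym[of x] by simp
  qed
  from partial_eq[OF this]
  show "partial i (\<lambda>x. 1/2 * (x \<bullet> (H *v x)) + (a \<bullet> x + b)) = (\<lambda>x. (H *v x) $ i + a $ i)"
    by (auto simp: inner_axis' inner_axis)
  have "((\<lambda>x. (H *v x) $ i + a $ i) has_derivative (\<lambda>h. (H *v h) $ i + 0)) (at x)" for x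
    by (rule has_derivative_add, rule bounded_linear.has_derivative[OF bounded_linear_vec_nth d], rule has_derivative_const)
  from partial_eq[OF this]
  show "partial j (\<lambda>x. (H *v x) $ i + a $ i) = (\<lambda>x. H $ i $ j)"
    by (auto simp: matrix_vector_mul_component inner_axis)
qed

lemma has_weak_derivative_quadratic:
  fixes H :: "real^'n::finite^'n"
  assumes "open \<omega>" "transpose H = H"
  shows "has_weak_derivative \<omega> [i, j] (\<lambda>x. 1/2 * (x \<bullet> (H *v x)) + (a \<bullet> x + b)) (\<lambda>x. H $ i $ j)"
    and "has_weak_derivative \<omega> [i] (\<lambda>x. 1/2 * (x \<bullet> (H *v x)) + (a \<bullet> x + b)) (\<lambda>x. (H *v x) $ i + a $ i)"
    and "has_weak_derivative \<omega> [] (\<lambda>x. 1/2 * (x \<bullet> (H *v x)) + (a \<bullet> x + b)) (\<lambda>x. 1/2 * (x \<bullet> (H *v x)) + (a \<bullet> x + b))"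
  using has_weak_derivative_Ck[OF assms(1) partial_affine_quadratic(1)[OF assms(2), of _ a b], of "[i, j]"]
    has_weak_derivative_Ck[OF assms(1) partial_affine_quadratic(1)[OF assms(2), of _ a b], of "[i]"]
    has_weak_derivative_Ck[OF assms(1) partial_affine_quadratic(1)[OF assms(2), of _ a b], of "[]"]
  unfolding rev.simps append.simps partials.simps partial_affine_quadratic(2,3)[OF assms(2)] .

text \<open>After subtraction of the quadratic, the weak Hessian vanishes. Each weak first
  derivative then has zero weak gradient and is constant, and subtracting the corresponding linear
  function leaves a function of zero weak gradient.\<close>

lemma W22_constant_hessian_imp_quadratic:
  fixes v :: "real^'n::finite \<Rightarrow> real"
  assumes \<omega>: "open \<omega>" "connected \<omega>" and v: "v \<in> W22 \<omega>"
    and H: "transpose H = H" "AE x in lebesgue_on \<omega>. weak_hessian \<omega> v x = H"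
  shows "\<exists>a b. AE x in lebesgue_on \<omega>. v x = 1/2 * (x \<bullet> (H *v x)) + (a \<bullet> x + b)"
proof -
  \<comment> \<open>The zero affine part gives p the form of
    \<open>has_weak_derivative_quadratic\<close>; for the same reason a zero matrix appears in w
    below.\<close>
  define p where "p x = 1/2 * (x \<bullet> (H *v x)) + ((0::real^'n) \<bullet> x + 0)" for x
  define u where "u x = v x - p x" for x
  have "\<exists>g. has_weak_derivative \<omega> [j] v g" for j
    using v unfolding W22_def by force
  then obtain g where g: "\<And>j. has_weak_derivative \<omega> [j] v (g j)" by metis
  have u1: "has_weak_derivative \<omega> [j] u (\<lambda>x. g j x - ((H *v x) $ j + (0::real^'n) $ j))" for j
    unfolding u_def p_def
    by (rule has_weak_derivative_diff[OF \<omega>(1) g has_weak_derivative_quadratic(2)[OF \<omega>(1) H(1)]])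
  define gu where "gu j x = g j x - ((H *v x) $ j + (0::real^'n) $ j)" for j x
  have u2: "has_weak_derivative \<omega> [i, j] u (\<lambda>x. 0)" for i j
  proof -
    have "has_weak_derivative \<omega> [i, j] u (\<lambda>x. weak_hessian \<omega> v x $ i $ j - H $ i $ j)"
      unfolding u_def p_def
      by (rule has_weak_derivative_diff[OF \<omega>(1) weak_hessian_has_weak_derivative[OF v]
            has_weak_derivative_quadratic(1)[OF \<omega>(1) H(1)]])
    then show ?thesis
      by (rule has_weak_derivative_cong_AE[OF _ \<omega>(1)]) (simp, use H(2) in eventually_elim, simp)
  qed
  have "\<exists>c. AE x in lebesgue_on \<omega>. gu j x = c" for j
  proof (rule AE_constant_of_weak_gradient_0[OF \<omega>])
    show "locally_integrable \<omega> (gu j)"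
      using u1[of j] unfolding has_weak_derivative_def gu_def by blast
    fix i \<phi> assume \<phi>: "test_function \<omega> \<phi>"
    have "(LINT x|lebesgue_on \<omega>. u x * partial j (partial i \<phi>) x) = - (LINT x|lebesgue_on \<omega>. gu j x * partial i \<phi> x)"
      using u1[of j] test_function_partial[OF \<phi>, of i] unfolding has_weak_derivative_def gu_def by simp
    moreover have "(LINT x|lebesgue_on \<omega>. u x * partial j (partial i \<phi>) x) = 0"
      using u2[of j i] \<phi> unfolding has_weak_derivative_def by simp
    ultimately show "(LINT x|lebesgue_on \<omega>. gu j x * partial i \<phi> x) = 0" by simp
  qed
  then obtain c where c: "\<And>j. AE x in lebesgue_on \<omega>. gu j x = c j" by metis
  define a where "a = (\<chi> j. c j)"
  define w where "w x = u x - (1/2 * (x \<bullet> (0 *v x)) + (a \<bullet> x + 0))" for x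
  have w1: "has_weak_derivative \<omega> [j] w (\<lambda>x. 0)" for j
  proof -
    have "has_weak_derivative \<omega> [j] w (\<lambda>x. gu j x - ((0 *v x) $ j + a $ j))"
      unfolding w_def gu_def
      by (rule has_weak_derivative_diff[OF \<omega>(1) u1 has_weak_derivative_quadratic(2)[OF \<omega>(1)]])
        (simp add: transpose_def vec_eq_iff)
    then show ?thesis
      by (rule has_weak_derivative_cong_AE[OF _ \<omega>(1)]) (simp, use c[of j] in eventually_elim, simp add: a_def)
  qed
  have "\<exists>b. AE x in lebesgue_on \<omega>. w x = b"
  proof (rule AE_constant_of_weak_gradient_0[OF \<omega>])
    show "locally_integrable \<omega> w" using w1 unfolding has_weak_derivative_def by blast
    fix i \<phi> assume "test_function \<omega> \<phi>"
    then show "(LINT x|lebesgue_on \<omega>. w x * partial i \<phi> x) = 0"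
      using w1[of i] unfolding has_weak_derivative_def by simp
  qed
  then obtain b where "AE x in lebesgue_on \<omega>. w x = b" by blast
  then have "AE x in lebesgue_on \<omega>. v x = 1/2 * (x \<bullet> (H *v x)) + (a \<bullet> x + b)"
    by eventually_elim (simp add: w_def u_def p_def)
  then show ?thesis by blast
qed

section \<open>Projections onto the cone of singular symmetric matrices\<close>

definition singular_cone :: "(real^3) set" where
  "singular_cone = {a. a $ 1 * a $ 2 = (a $ 3)\<^sup>2}"

text \<open>Coordinates of n \<otimes> n for n = (x, y).\<close>

definition cone_point :: "real \<Rightarrow> real \<Rightarrow> real^3" where
  "cone_point x y = vector [x\<^sup>2, y\<^sup>2, x * y]"

definition cone_nearest :: "(real^3 \<Rightarrow> real^3 \<Rightarrow> real) \<Rightarrow> real^3 \<Rightarrow> (real^3) set" where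
  "cone_nearest B f = {a \<in> singular_cone. \<forall>a'\<in>singular_cone. B (a - f) (a - f) \<le> B (a' - f) (a' - f)}"

lemma cone_point_in_cone: "s *\<^sub>R cone_point x y \<in> singular_cone"
  by (simp add: singular_cone_def cone_point_def power2_eq_square)

lemma singular_cone_scale: "a \<in> singular_cone \<Longrightarrow> t *\<^sub>R a \<in> singular_cone"
  by (simp add: singular_cone_def power2_eq_square)

text \<open>A nonzero singular symmetric matrix has rank one. The factor s carries its sign, since n
  \<otimes> n alone is positive semidefinite.\<close>

lemma cone_point_cases:
  assumes "a \<in> singular_cone" "a \<noteq> 0"
  obtains s x y where "s \<noteq> 0" "x \<noteq> 0 \<or> y \<noteq> 0" "a = s *\<^sub>R cone_point x y"
proof (cases "a $ 1 = 0")
  case True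
  then have "a $ 3 = 0" using assms(1) by (simp add: singular_cone_def)
  then have "a = (a $ 2) *\<^sub>R cone_point 0 1" "a $ 2 \<noteq> 0"
    using True assms(2) by (auto simp: cone_point_def vec_eq_iff forall_3)
  then show ?thesis using that[of "a $ 2" 0 1] by simp
next
  case False
  then have "a = (a $ 1) *\<^sub>R cone_point 1 (a $ 3 / a $ 1)"
    using assms(1) by (simp add: singular_cone_def cone_point_def vec_eq_iff forall_3 power2_eq_square field_simps)
  then show ?thesis using that[of "a $ 1" 1 "a $ 3 / a $ 1"] False by simp
qed

text \<open>Divided by t, the cubic is nonnegative for t > 0 and nonpositive for t < 0, and its
  limit at 0 is p. This expresses that a zero of a nonnegative function is double.\<close>

lemma cubic_nonneg_imp_linear_coeff_0:
  fixes p r s :: real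
  assumes "\<And>t. p * t + r * t\<^sup>2 + s * t ^ 3 \<ge> 0"
  shows "p = 0"
proof -
  have lim: "((\<lambda>t. p + r * t + s * t\<^sup>2) \<longlongrightarrow> p) (at 0)"
    by (auto intro!: tendsto_eq_intros)
  have eq: "p * t + r * t\<^sup>2 + s * t ^ 3 = t * (p + r * t + s * t\<^sup>2)" for t
    by (simp add: algebra_simps power2_eq_square power3_eq_cube)
  have "0 \<le> p + r * t + s * t\<^sup>2" if "t > 0" for t
    using assms[of t] that unfolding eq by (simp add: zero_le_mult_iff)
  then have "\<forall>\<^sub>F t in at_right 0. 0 \<le> p + r * t + s * t\<^sup>2"
    by (simp add: eventually_at_filter)
  then have "p \<ge> 0"
    by (rule tendsto_lowerbound[OF filterlim_mono[OF lim order_refl at_le[OF subset_UNIV]]]) simp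
  moreover have "p + r * t + s * t\<^sup>2 \<le> 0" if "t < 0" for t
    using assms[of t] that unfolding eq by (simp add: zero_le_mult_iff)
  then have "\<forall>\<^sub>F t in at_left 0. p + r * t + s * t\<^sup>2 \<le> 0"
    by (simp add: eventually_at_filter)
  then have "p \<le> 0"
    by (rule tendsto_upperbound[OF filterlim_mono[OF lim order_refl at_le[OF subset_UNIV]]]) simp
  ultimately show ?thesis by simp
qed

section \<open>Nearest points as projections onto the lines of the cone\<close>

locale coercive_form =
  fixes B :: "real^3 \<Rightarrow> real^3 \<Rightarrow> real" and \<kappa> :: real and f :: "real^3"
  assumes bil: "bilinear B" and sym: "B x y = B y x" and \<kappa>: "\<kappa> > 0" and coer: "\<kappa> * (norm x)\<^sup>2 \<le> B x x"
begin

lemmas B_simps = bilinear_ladd[OF bil] bilinear_radd[OF bil] bilinear_lmul[OF bil] bilinear_rmul[OF bil]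
  bilinear_lsub[OF bil] bilinear_rsub[OF bil] bilinear_lzero[OF bil] bilinear_rzero[OF bil]

lemma pos: "x \<noteq> 0 \<Longrightarrow> B x x > 0"
  using coer[of x] \<kappa> by (smt (verit) mult_pos_pos zero_less_norm_iff zero_less_power)

lemma nonneg: "B x x \<ge> 0"
  using pos[of x] by (cases "x = 0") (auto simp: B_simps)

lemma dist_expand: "B (t *\<^sub>R a - f) (t *\<^sub>R a - f) = t\<^sup>2 * B a a - 2 * t * B a f + B f f"
  by (simp add: B_simps sym[of f a] power2_eq_square algebra_simps)

text \<open>The cone contains the whole line through a, positive and negative multiples, so a must
  be the projection of f onto that line. The comparison point is this projection, with factor
  \<open>B a f / B a a\<close>.\<close>

lemma cone_nearest_scaling:
  assumes "a \<in> cone_nearest B f"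
  shows "B a a = B a f"
proof (cases "a = 0")
  case False
  note p = pos[OF False]
  define t where "t = B a f / B a a"
  have "B (1 *\<^sub>R a - f) (1 *\<^sub>R a - f) \<le> B (t *\<^sub>R a - f) (t *\<^sub>R a - f)"
    using assms singular_cone_scale[of a t] by (simp add: cone_nearest_def)
  then have "B a a - 2 * B a f \<le> t\<^sup>2 * B a a - 2 * t * B a f"
    unfolding dist_expand by simp
  also have "\<dots> = - ((B a f)\<^sup>2 / B a a)"
    using p by (simp add: t_def power2_eq_square)
  finally have "B a a - 2 * B a f + (B a f)\<^sup>2 / B a a \<le> 0" by simp
  moreover have "B a a - 2 * B a f + (B a f)\<^sup>2 / B a a = (B a a - B a f)\<^sup>2 / B a a"
    using p by (simp add: power2_eq_square field_simps)
  ultimately have "(B a a - B a f)\<^sup>2 \<le> 0" using p by (simp add: divide_le_0_iff)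
  then show ?thesis by simp
qed (simp add: B_simps)

text \<open>By \<open>cone_nearest_scaling\<close> the squared distance of a nearest point from f is
  \<open>B f f - B a a\<close>, and all nearest points share it.\<close>

lemma cone_nearest_value:
  assumes "a \<in> cone_nearest B f" "b \<in> cone_nearest B f"
  shows "B a a = B b b"
proof -
  have "B (1 *\<^sub>R a - f) (1 *\<^sub>R a - f) = B (1 *\<^sub>R b - f) (1 *\<^sub>R b - f)"
    using assms by (intro antisym) (auto simp: cone_nearest_def)
  then show ?thesis
    unfolding dist_expand using cone_nearest_scaling[OF assms(1)] cone_nearest_scaling[OF assms(2)] by simp
qed

text \<open>For nonzero e the squared distance of f from the line through e is
  \<open>B f f - (B e f)\<^sup>2 / B e e\<close>; it cannot be smaller than the minimum
  \<open>B f f - B a a\<close>.\<close>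

lemma cone_nearest_bound:
  assumes a: "a \<in> cone_nearest B f" and e: "e \<in> singular_cone"
  shows "(B e f)\<^sup>2 \<le> B a a * B e e"
proof (cases "e = 0")
  case False
  note p = pos[OF False]
  define t where "t = B e f / B e e"
  have "B (1 *\<^sub>R a - f) (1 *\<^sub>R a - f) \<le> B (t *\<^sub>R e - f) (t *\<^sub>R e - f)"
    using a singular_cone_scale[OF e, of t] by (simp add: cone_nearest_def)
  then have "- B a a \<le> t\<^sup>2 * B e e - 2 * t * B e f"
    unfolding dist_expand using cone_nearest_scaling[OF a] by simp
  also have "\<dots> = - ((B e f)\<^sup>2 / B e e)"
    using p by (simp add: t_def power2_eq_square)
  finally show ?thesis using p by (simp add: divide_le_eq)
qed (simp add: B_simps)


end

text \<open>The square of a sum: the mixed vector holds the coordinates of n1 \<otimes> n2 + n2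
  \<otimes> n1.\<close>

lemma cone_point_combine:
  "cone_point (\<alpha> * x1 + \<beta> * x2) (\<alpha> * y1 + \<beta> * y2) =
    \<alpha>\<^sup>2 *\<^sub>R cone_point x1 y1 + \<beta>\<^sup>2 *\<^sub>R cone_point x2 y2 +
    (\<alpha> * \<beta>) *\<^sub>R vector [2 * x1 * x2, 2 * y1 * y2, x1 * y2 + x2 * y1]"
  by (simp add: cone_point_def vec_eq_iff forall_3 power2_eq_square algebra_simps)

lemma cross_0_imp_parallel:
  fixes x y x' y' :: real
  assumes "x \<noteq> 0 \<or> y \<noteq> 0" "x * y' - x' * y = 0"
  obtains l where "x' = l * x" "y' = l * y"
proof (cases "x = 0")
  case True
  then show ?thesis using assms that[of "y' / y"] by auto
next
  case False
  then have "y' = (x' / x) * y" using assms(2) by (simp add: field_simps)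
  then show ?thesis using that[of "x' / x"] False by simp
qed

text \<open>Cramer's rule. The explicit coefficients are exported because their numerators show when
  they are nonzero.\<close>

lemma cross_basis:
  fixes x1 y1 x2 y2 x y :: real
  assumes d: "x1 * y2 - x2 * y1 \<noteq> 0"
  obtains \<alpha> \<beta> where "x = \<alpha> * x1 + \<beta> * x2" "y = \<alpha> * y1 + \<beta> * y2"
    "\<alpha> = (x * y2 - x2 * y) / (x1 * y2 - x2 * y1)" "\<beta> = (x1 * y - x * y1) / (x1 * y2 - x2 * y1)"
proof -
  define D where "D = x1 * y2 - x2 * y1"
  have D: "D \<noteq> 0" using d by (simp add: D_def)
  have "(x * y2 - x2 * y) * x1 + (x1 * y - x * y1) * x2 = x * D"
    "(x * y2 - x2 * y) * y1 + (x1 * y - x * y1) * y2 = y * D"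
    by (simp_all add: D_def algebra_simps)
  then have "x = (x * y2 - x2 * y) / D * x1 + (x1 * y - x * y1) / D * x2"
    "y = (x * y2 - x2 * y) / D * y1 + (x1 * y - x * y1) / D * y2"
    using D by (simp_all add: field_simps)
  then show ?thesis using that unfolding D_def by blast
qed

context coercive_form
begin

text \<open>On a single line the projection of f is unique, so different nearest points span
  different lines. Nonvanishing \<open>B a a\<close> excludes the point 0, which lies on every
  line.\<close>

lemma cone_nearest_independent:
  assumes a: "a \<in> cone_nearest B f" and b: "b \<in> cone_nearest B f" and ne: "a \<noteq> b" and q: "B a a \<noteq> 0"
    and a': "s \<noteq> 0" "x \<noteq> 0 \<or> y \<noteq> 0" "a = s *\<^sub>R cone_point x y"
    and b': "b = s' *\<^sub>R cone_point x' y'"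
  shows "x * y' - x' * y \<noteq> 0"
proof
  assume "x * y' - x' * y = 0"
  then obtain l where l: "x' = l * x" "y' = l * y" using cross_0_imp_parallel a'(2) by blast
  have "cone_point x' y' = l\<^sup>2 *\<^sub>R cone_point x y"
    by (simp add: cone_point_def vec_eq_iff forall_3 l power2_eq_square)
  define r where "r = s' * l\<^sup>2 / s"
  have bl: "b = r *\<^sub>R a"
    using a' b' \<open>cone_point x' y' = l\<^sup>2 *\<^sub>R cone_point x y\<close> by (simp add: r_def)
  have "B b f = r * B a f" unfolding bl by (simp add: B_simps)
  moreover have "B b f = B a f" "B a f \<noteq> 0"
    using cone_nearest_scaling[OF a] cone_nearest_scaling[OF b] cone_nearest_value[OF a b] q by simp_all
  ultimately have "r = 1" by simp
  then show False using bl ne by simp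
qed

text \<open>On the cone, \<open>q B(n, n) - B(n, f)\<^sup>2\<close> is a nonnegative binary quartic in the direction of \<open>n\<close>,
  vanishing exactly in the directions of the nearest points; with three zeros, all of them
  double, it vanishes identically.\<close>

lemma cone_nearest_three:
  assumes a: "a \<in> cone_nearest B f" and b: "b \<in> cone_nearest B f" and c: "c \<in> cone_nearest B f"
    and ne: "a \<noteq> b" "a \<noteq> c" "b \<noteq> c"
  shows "B a a > 0 \<and> (\<forall>x y. (B (cone_point x y) f)\<^sup>2 = B a a * B (cone_point x y) (cone_point x y))"
proof -
  define q where "q = B a a"
  have q_eq: "B b b = q" "B c c = q" "B a f = q" "B b f = q" "B c f = q"
    using cone_nearest_scaling[OF a] cone_nearest_scaling[OF b] cone_nearest_scaling[OF c]
      cone_nearest_value[OF a b] cone_nearest_value[OF a c] by (simp_all add: q_def)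
  have q: "q > 0"
  proof (rule ccontr)
    assume "\<not> q > 0"
    then have "a = 0" "b = 0" using pos[of a] pos[of b] q_eq by (auto simp: q_def)
    then show False using ne by simp
  qed
  have nz: "a \<noteq> 0" "b \<noteq> 0" "c \<noteq> 0" using q q_eq by (auto simp: q_def B_simps)
  have cone: "a \<in> singular_cone" "b \<in> singular_cone" "c \<in> singular_cone"
    using a b c by (auto simp: cone_nearest_def)
  obtain s1 x1 y1 where 1: "s1 \<noteq> 0" "x1 \<noteq> 0 \<or> y1 \<noteq> 0" "a = s1 *\<^sub>R cone_point x1 y1"
    by (rule cone_point_cases[OF cone(1) nz(1)])
  obtain s2 x2 y2 where 2: "s2 \<noteq> 0" "x2 \<noteq> 0 \<or> y2 \<noteq> 0" "b = s2 *\<^sub>R cone_point x2 y2"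
    by (rule cone_point_cases[OF cone(2) nz(2)])
  obtain s3 x3 y3 where 3: "s3 \<noteq> 0" "x3 \<noteq> 0 \<or> y3 \<noteq> 0" "c = s3 *\<^sub>R cone_point x3 y3"
    by (rule cone_point_cases[OF cone(3) nz(3)])
  have d12: "x1 * y2 - x2 * y1 \<noteq> 0"
    by (rule cone_nearest_independent[OF a b ne(1) _ 1 2(3)]) (use q in \<open>simp add: q_def\<close>)
  have d13: "x1 * y3 - x3 * y1 \<noteq> 0"
    by (rule cone_nearest_independent[OF a c ne(2) _ 1 3(3)]) (use q in \<open>simp add: q_def\<close>)
  have d23: "x2 * y3 - x3 * y2 \<noteq> 0"
    by (rule cone_nearest_independent[OF b c ne(3) _ 2 3(3)]) (use q q_eq in simp)
  \<comment> \<open>E is a quadratic form on all of \<open>real^3\<close>; the quartic is its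
    restriction to the points n \<otimes> n.\<close>
  define E where "E u w = q * B u w - B u f * B w f" for u w
  have Esym: "E u w = E w u" for u w by (simp add: E_def sym)
  have Es: "E (t *\<^sub>R u) (t *\<^sub>R u) = t\<^sup>2 * E u u" for t u
    by (simp add: E_def B_simps power2_eq_square algebra_simps)
  have E0: "E a a = 0" "E b b = 0" "E c c = 0" using q_eq by (simp_all add: E_def q_def)
  define u where "u = cone_point x1 y1"
  define w where "w = cone_point x2 y2"
  define m :: "real^3" where "m = vector [2 * x1 * x2, 2 * y1 * y2, x1 * y2 + x2 * y1]"
  have Eu: "E u u = 0" using E0(1) 1 Es[of s1 u] by (simp add: u_def)
  have Ew: "E w w = 0" using E0(2) 2 Es[of s2 w] by (simp add: w_def)
  define e where "e = E m m + 2 * E u w"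
  have expand: "E (cone_point (\<alpha> * x1 + \<beta> * x2) (\<alpha> * y1 + \<beta> * y2)) (cone_point (\<alpha> * x1 + \<beta> * x2) (\<alpha> * y1 + \<beta> * y2)) =
      2 * \<alpha> ^ 3 * \<beta> * E u m + \<alpha>\<^sup>2 * \<beta>\<^sup>2 * e + 2 * \<alpha> * \<beta> ^ 3 * E w m" for \<alpha> \<beta>
  proof -
    have "E (\<alpha>\<^sup>2 *\<^sub>R u + \<beta>\<^sup>2 *\<^sub>R w + (\<alpha> * \<beta>) *\<^sub>R m) (\<alpha>\<^sup>2 *\<^sub>R u + \<beta>\<^sup>2 *\<^sub>R w + (\<alpha> * \<beta>) *\<^sub>R m) =
      \<alpha> ^ 4 * E u u + \<beta> ^ 4 * E w w + \<alpha>\<^sup>2 * \<beta>\<^sup>2 * (E m m + 2 * E u w) + 2 * \<alpha> ^ 3 * \<beta> * E u m + 2 * \<alpha> * \<beta> ^ 3 * E w m"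
      unfolding E_def
      by (simp add: B_simps sym[of w u] sym[of m u] sym[of m w] power2_eq_square power3_eq_cube power4_eq_xxxx algebra_simps)
    then show ?thesis
      unfolding cone_point_combine u_def[symmetric] w_def[symmetric] m_def[symmetric] by (simp add: Eu Ew e_def)
  qed
  have Enn: "E (cone_point x y) (cone_point x y) \<ge> 0" for x y
    using cone_nearest_bound[OF a cone_point_in_cone[of 1 x y]] by (simp add: E_def q_def power2_eq_square)
  \<comment> \<open>In the basis formed by the first two zeros, \<open>expand\<close> has no pure
    fourth powers. Nonnegativity along n1 + t n2, and then along t n1 + n2, makes both zeros
    double.\<close>
  have "2 * E u m = 0"
  proof (rule cubic_nonneg_imp_linear_coeff_0)
    show "2 * E u m * t + e * t\<^sup>2 + 2 * E w m * t ^ 3 \<ge> 0" for t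
      using Enn[of "1 * x1 + t * x2" "1 * y1 + t * y2"] unfolding expand by (simp add: mult_ac)
  qed
  moreover have "2 * E w m = 0"
  proof (rule cubic_nonneg_imp_linear_coeff_0)
    show "2 * E w m * t + e * t\<^sup>2 + 2 * E u m * t ^ 3 \<ge> 0" for t
      using Enn[of "t * x1 + 1 * x2" "t * y1 + 1 * y2"] unfolding expand by (simp add: mult_ac)
  qed
  ultimately have m0: "E u m = 0" "E w m = 0" by simp_all
  \<comment> \<open>Only the term with \<alpha>^2 \<beta>^2 is left. The third zero is independent
    of each of the first two, so both of its coefficients are nonzero and e must vanish.\<close>
  obtain \<alpha> \<beta> where ab: "x3 = \<alpha> * x1 + \<beta> * x2" "y3 = \<alpha> * y1 + \<beta> * y2"
    "\<alpha> = (x3 * y2 - x2 * y3) / (x1 * y2 - x2 * y1)" "\<beta> = (x1 * y3 - x3 * y1) / (x1 * y2 - x2 * y1)"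
    by (rule cross_basis[OF d12])
  have ab0: "\<alpha> \<noteq> 0" "\<beta> \<noteq> 0" using ab(3,4) d12 d13 d23 by auto
  have "E (cone_point x3 y3) (cone_point x3 y3) = 0" using E0(3) 3 Es[of s3 "cone_point x3 y3"] by simp
  then have "\<alpha>\<^sup>2 * \<beta>\<^sup>2 * e = 0" using expand[of \<alpha> \<beta>] m0 ab(1,2) by simp
  then have e0: "e = 0" using ab0 by simp
  have "E (cone_point x y) (cone_point x y) = 0" for x y
  proof -
    obtain \<alpha> \<beta> where "x = \<alpha> * x1 + \<beta> * x2" "y = \<alpha> * y1 + \<beta> * y2" by (rule cross_basis[OF d12])
    then show ?thesis using expand[of \<alpha> \<beta>] m0 e0 by simp
  qed
  then show ?thesis using q by (simp add: E_def q_def power2_eq_square)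
qed

text \<open>Two distinct nearest points s1 n1 \<otimes> n1 and s2 n2 \<otimes> n2 have independent
  directions, and the determinant of their difference is -s1 s2 times the square of the cross
  product of n1 and n2. With three nearest points, every nearest point a satisfies the linear
  equation \<open>B a f = q\<close>, and \<open>cone_nearest_three\<close> makes its coefficients
  definite.\<close>

lemma cone_nearest_structure:
  "(\<exists>a b. cone_nearest B f \<subseteq> {a, b} \<and> (a = b \<or> (a $ 1 - b $ 1) * (a $ 2 - b $ 2) \<noteq> (a $ 3 - b $ 3)\<^sup>2)) \<or>
   (\<exists>\<alpha> \<tau> k. \<tau> > 0 \<and> (\<forall>a\<in>cone_nearest B f. (\<alpha>\<^sup>2 + \<tau>\<^sup>2) * a $ 1 - 2 * \<alpha> * a $ 3 + a $ 2 = k))"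
proof (cases "\<exists>a b c. a \<in> cone_nearest B f \<and> b \<in> cone_nearest B f \<and> c \<in> cone_nearest B f \<and> a \<noteq> b \<and> a \<noteq> c \<and> b \<noteq> c")
  case True
  then obtain a b c where abc: "a \<in> cone_nearest B f" "b \<in> cone_nearest B f" "c \<in> cone_nearest B f"
    "a \<noteq> b" "a \<noteq> c" "b \<noteq> c" by (elim exE conjE)
  define q where "q = B a a"
  have q: "q > 0"
    unfolding q_def by (rule cone_nearest_three[OF abc, THEN conjunct1])
  have all: "(B (cone_point x y) f)\<^sup>2 = q * B (cone_point x y) (cone_point x y)" for x y
    unfolding q_def using cone_nearest_three[OF abc, THEN conjunct2] by simp
  define g1 where "g1 = B (axis 1 1) f"
  define g2 where "g2 = B (axis 2 1) f"
  define g3 where "g3 = B (axis 3 1) f"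
  have lin: "B u f = u $ 1 * g1 + u $ 2 * g2 + u $ 3 * g3" for u
  proof -
    have "u = (u $ 1) *\<^sub>R axis 1 1 + (u $ 2) *\<^sub>R axis 2 1 + (u $ 3) *\<^sub>R axis 3 1"
      by (simp add: vec_eq_iff forall_3 axis_def)
    then have "B u f = B ((u $ 1) *\<^sub>R axis 1 1 + (u $ 2) *\<^sub>R axis 2 1 + (u $ 3) *\<^sub>R axis 3 1) f" by simp
    then show ?thesis unfolding B_simps g1_def g2_def g3_def by simp
  qed
  have nz: "x\<^sup>2 * g1 + y\<^sup>2 * g2 + x * y * g3 \<noteq> 0" if "x \<noteq> 0 \<or> y \<noteq> 0" for x y
  proof
    assume "x\<^sup>2 * g1 + y\<^sup>2 * g2 + x * y * g3 = 0"
    then have "B (cone_point x y) f = 0" by (simp add: lin cone_point_def)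
    then have "B (cone_point x y) (cone_point x y) = 0" using all[of x y] q by simp
    then have "cone_point x y = 0" using pos by force
    then show False using that by (auto simp: cone_point_def vec_eq_iff forall_3)
  qed
  have g2: "g2 \<noteq> 0" using nz[of 0 1] by simp
  \<comment> \<open>The square of x^2 g1 + y^2 g2 + x y g3 is q times the positive number
    \<open>B (cone_point x y) (cone_point x y)\<close>, so this binary form has no real root and
    negative discriminant.\<close>
  have disc: "g3\<^sup>2 - 4 * g1 * g2 < 0"
  proof (rule ccontr)
    assume "\<not> ?thesis"
    then have D: "(sqrt (g3\<^sup>2 - 4 * g1 * g2))\<^sup>2 = g3\<^sup>2 - 4 * g1 * g2" by simp
    define y where "y = (- g3 + sqrt (g3\<^sup>2 - 4 * g1 * g2)) / (2 * g2)"
    have "2 * g2 * y + g3 = sqrt (g3\<^sup>2 - 4 * g1 * g2)" using g2 by (simp add: y_def)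
    then have "(2 * g2 * y + g3)\<^sup>2 = g3\<^sup>2 - 4 * g1 * g2" using D by simp
    then have "4 * g2 * (1\<^sup>2 * g1 + y\<^sup>2 * g2 + 1 * y * g3) = 0"
      by (simp add: power2_eq_square algebra_simps)
    then show False using nz[of 1 y] g2 by simp
  qed
  \<comment> \<open>\<alpha> + i \<tau> and its conjugate are the roots y/x of the form; divided by
    g2, it becomes (\<alpha>^2 + \<tau>^2) x^2 - 2 \<alpha> x y + y^2.\<close>
  define \<alpha> where "\<alpha> = - g3 / (2 * g2)"
  define \<tau> where "\<tau> = sqrt (g1 / g2 - \<alpha>\<^sup>2)"
  have "g1 / g2 - \<alpha>\<^sup>2 = - (g3\<^sup>2 - 4 * g1 * g2) / (4 * g2\<^sup>2)"
    using g2 by (simp add: \<alpha>_def power2_eq_square field_simps)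
  also have "\<dots> > 0" using disc g2 by (intro divide_pos_pos) auto
  finally have \<tau>: "\<tau> > 0" "\<alpha>\<^sup>2 + \<tau>\<^sup>2 = g1 / g2" by (simp_all add: \<tau>_def)
  have "(\<alpha>\<^sup>2 + \<tau>\<^sup>2) * a' $ 1 - 2 * \<alpha> * a' $ 3 + a' $ 2 = q / g2" if a': "a' \<in> cone_nearest B f" for a'
  proof -
    have "a' $ 1 * g1 + a' $ 2 * g2 + a' $ 3 * g3 = q"
      using cone_nearest_scaling[OF a'] cone_nearest_value[OF abc(1) a'] by (simp add: lin[symmetric] q_def)
    then show ?thesis unfolding \<tau>(2) using g2 by (simp add: \<alpha>_def field_simps)
  qed
  with \<tau>(1) show ?thesis
    by (intro disjI2 exI[of _ \<alpha>] exI[of _ \<tau>] exI[of _ "q / g2"] conjI ballI)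
next
  case False
  show ?thesis
  proof (cases "\<exists>a b. a \<in> cone_nearest B f \<and> b \<in> cone_nearest B f \<and> a \<noteq> b")
    case True
    then obtain a b where ab: "a \<in> cone_nearest B f" "b \<in> cone_nearest B f" "a \<noteq> b"
      by (elim exE conjE)
    have sub: "cone_nearest B f \<subseteq> {a, b}"
    proof
      fix x assume "x \<in> cone_nearest B f"
      then show "x \<in> {a, b}" using False ab by (cases "x = a"; cases "x = b") auto
    qed
    have q: "B a a \<noteq> 0"
    proof
      assume "B a a = 0"
      then have "a = 0" "b = 0" using pos[of a] pos[of b] cone_nearest_value[OF ab(1,2)] by fastforce+
      then show False using ab(3) by simp
    qed
    have nz: "a \<noteq> 0" "b \<noteq> 0" using q cone_nearest_value[OF ab(1,2)] by (auto simp: B_simps)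
    have cone: "a \<in> singular_cone" "b \<in> singular_cone" using ab by (auto simp: cone_nearest_def)
    obtain s1 x1 y1 where 1: "s1 \<noteq> 0" "x1 \<noteq> 0 \<or> y1 \<noteq> 0" "a = s1 *\<^sub>R cone_point x1 y1"
      by (rule cone_point_cases[OF cone(1) nz(1)])
    obtain s2 x2 y2 where 2: "s2 \<noteq> 0" "x2 \<noteq> 0 \<or> y2 \<noteq> 0" "b = s2 *\<^sub>R cone_point x2 y2"
      by (rule cone_point_cases[OF cone(2) nz(2)])
    have d12: "x1 * y2 - x2 * y1 \<noteq> 0"
      by (rule cone_nearest_independent[OF ab q 1 2(3)])
    have "(a $ 1 - b $ 1) * (a $ 2 - b $ 2) - (a $ 3 - b $ 3)\<^sup>2 = - (s1 * s2 * (x1 * y2 - x2 * y1)\<^sup>2)"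
      unfolding 1(3) 2(3) by (simp add: cone_point_def power2_eq_square algebra_simps)
    moreover have "s1 * s2 * (x1 * y2 - x2 * y1)\<^sup>2 \<noteq> 0" using 1(1) 2(1) d12 by simp
    ultimately have "(a $ 1 - b $ 1) * (a $ 2 - b $ 2) \<noteq> (a $ 3 - b $ 3)\<^sup>2" by linarith
    with sub show ?thesis
      by (intro disjI1 exI[of _ a] exI[of _ b] conjI disjI2)
  next
    case False
    then have sub: "cone_nearest B f \<subseteq> {a, a}" if "a \<in> cone_nearest B f" for a
      using that by auto
    have "\<exists>a. cone_nearest B f \<subseteq> {a, a}"
      by (cases "cone_nearest B f = {}") (use sub in auto)
    then obtain a where "cone_nearest B f \<subseteq> {a, a}" by (elim exE)
    then show ?thesis
      by (intro disjI1 exI[of _ a] conjI) simp_all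
  qed
qed

lemma cone_nearest_nonempty: "cone_nearest B f \<noteq> {}"
proof -
  \<comment> \<open>Beyond this radius coercivity makes the distance from f at least
    \<open>B f f\<close>, which the cone point 0 already achieves, so the search is confined to a
    compact set.\<close>
  define R where "R = norm f + sqrt (B f f / \<kappa>)"
  define S where "S = singular_cone \<inter> cball 0 R"
  have Bc: "continuous_on A (\<lambda>a. B (a - f) (a - f))" for A
  proof -
    have bb: "bounded_bilinear B" using bil by (simp add: bilinear_conv_bounded_bilinear)
    show ?thesis by (rule bounded_bilinear.continuous_on[OF bb]) (intro continuous_intros)+
  qed
  have "closed singular_cone"
    unfolding singular_cone_def by (intro closed_Collect_eq continuous_intros)
  then have S: "compact S" unfolding S_def by (simp add: closed_Int_compact)
  have Rn: "R \<ge> 0" using nonneg[of f] \<kappa> by (simp add: R_def)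
  have "0 \<in> S" using Rn by (simp add: S_def singular_cone_def)
  then obtain a where a: "a \<in> S" "\<And>a'. a' \<in> S \<Longrightarrow> B (a - f) (a - f) \<le> B (a' - f) (a' - f)"
    using continuous_attains_inf[OF S _ Bc] by blast
  have "B (a - f) (a - f) \<le> B (a' - f) (a' - f)" if "a' \<in> singular_cone" for a'
  proof (cases "a' \<in> S")
    case False
    then have "norm a' > R" using that by (simp add: S_def)
    then have "sqrt (B f f / \<kappa>) \<le> norm (a' - f)"
      using norm_triangle_ineq2[of a' f] by (simp add: R_def)
    then have "(sqrt (B f f / \<kappa>))\<^sup>2 \<le> (norm (a' - f))\<^sup>2"
      using nonneg[of f] \<kappa> by (intro power_mono) auto
    then have "B f f \<le> \<kappa> * (norm (a' - f))\<^sup>2"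
      using nonneg[of f] \<kappa> by (simp add: field_simps)
    also have "\<dots> \<le> B (a' - f) (a' - f)" by (rule coer)
    finally have "B f f \<le> B (a' - f) (a' - f)" .
    moreover have "B (a - f) (a - f) \<le> B f f"
      using a(2)[OF \<open>0 \<in> S\<close>] by (simp add: B_simps bilinear_lneg[OF bil] bilinear_rneg[OF bil])
    ultimately show ?thesis by linarith
  qed (use a in blast)
  then show ?thesis using a(1) unfolding cone_nearest_def S_def by blast
qed

end

section \<open>The reduced quadratic form\<close>

lemma coords_add: "coords (A + A') = coords A + coords A'"
  and coords_diff: "coords (A - A') = coords A - coords A'"
  and coords_scaleR: "coords (t *\<^sub>R A) = t *\<^sub>R coords A"
  by (simp_all add: coords_def vec_eq_iff forall_3)

lemma coords_of_coords: "coords (of_coords a) = a"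
  by (simp add: coords_def of_coords_def vec_eq_iff forall_3)

lemma of_coords_sym: "of_coords a \<in> sym_matrices"
  by (simp add: of_coords_def sym_matrices_def transpose_def vec_eq_iff forall_2)

lemma sym_matrices_iff: "A \<in> (sym_matrices :: (real^2^2) set) \<longleftrightarrow> A $ 1 $ 2 = A $ 2 $ 1"
  by (auto simp: sym_matrices_def transpose_def vec_eq_iff forall_2)

lemma of_coords_coords: "A \<in> sym_matrices \<Longrightarrow> of_coords (coords A) = A"
  by (auto simp: sym_matrices_iff coords_def of_coords_def vec_eq_iff forall_2)

text \<open>The Frobenius norm counts the off-diagonal entry twice, so the coordinates are not
  isometric; the inequality has the direction needed for coercivity.\<close>

lemma norm_of_coords: "(norm a)\<^sup>2 \<le> (norm (of_coords a))\<^sup>2"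
  unfolding power2_norm_eq_inner by (simp add: inner_vec_def sum_2 sum_3 of_coords_def)

lemma sym_matrices_add: "A \<in> sym_matrices \<Longrightarrow> A' \<in> sym_matrices \<Longrightarrow> A + A' \<in> (sym_matrices :: (real^2^2) set)"
  and sym_matrices_diff: "A \<in> sym_matrices \<Longrightarrow> A' \<in> sym_matrices \<Longrightarrow> A - A' \<in> (sym_matrices :: (real^2^2) set)"
  and sym_matrices_scaleR: "A \<in> sym_matrices \<Longrightarrow> t *\<^sub>R A \<in> (sym_matrices :: (real^2^2) set)"
  by (auto simp: sym_matrices_iff)

section \<open>The symmetric matrix of a quadratic form\<close>

abbreviation coord_unit :: "3 \<Rightarrow> real^2^2" where
  "coord_unit i \<equiv> of_coords (axis i 1)"

text \<open>An explicit formula for the matrix that \<open>form_matrix\<close> characterises by a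
  definite description. Its entries are combinations of three values of q, so measurability and
  bounds in t pass from Q2 to the matrix.\<close>

definition polar_matrix :: "(real^2^2 \<Rightarrow> real) \<Rightarrow> real^3^3" where
  "polar_matrix q = (\<chi> i j. (q (coord_unit i + coord_unit j) - q (coord_unit i) - q (coord_unit j)) / 2)"

lemma polar_matrix_inner:
  assumes b: "bilinear b" "\<And>x y. b x y = b y x" "\<And>x. q x = b x x"
  shows "x \<bullet> (polar_matrix q *v y) = b (of_coords x) (of_coords y)"
proof -
  note bs = bilinear_ladd[OF b(1)] bilinear_radd[OF b(1)] bilinear_lmul[OF b(1)] bilinear_rmul[OF b(1)]
  have P: "polar_matrix q $ i $ j = b (coord_unit i) (coord_unit j)" for i j
    by (simp add: polar_matrix_def b(3) bs b(2)[of "coord_unit j" "coord_unit i"])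
  have dec: "of_coords x = (x $ 1) *\<^sub>R coord_unit 1 + (x $ 2) *\<^sub>R coord_unit 2 + (x $ 3) *\<^sub>R coord_unit 3" for x
    by (simp add: of_coords_def vec_eq_iff forall_2 axis_def)
  have "x \<bullet> (polar_matrix q *v y) = (\<Sum>i\<in>UNIV. x $ i * (\<Sum>j\<in>UNIV. b (coord_unit i) (coord_unit j) * y $ j))"
    by (simp add: inner_vec_def matrix_vector_mult_def P)
  also have "\<dots> = b (of_coords x) (of_coords y)"
    unfolding dec[of x] dec[of y] bs sum_3 by (simp add: algebra_simps)
  finally show ?thesis .
qed

lemma symmetric_matrix_eq_0:
  fixes D :: "real^'n::finite^'n"
  assumes "transpose D = D" "\<And>a. a \<bullet> (D *v a) = 0"
  shows "D = 0"
proof -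
  have sym: "y \<bullet> (D *v x) = x \<bullet> (D *v y)" for x y
    by (metis assms(1) dot_lmul_matrix inner_commute transpose_matrix_vector)
  have "x \<bullet> (D *v y) = 0" for x y
    using assms(2)[of "x + y"] assms(2)[of x] assms(2)[of y] sym[of y x]
    by (simp add: inner_add matrix_vector_right_distrib)
  then have "D *v y = 0 *v y" for y by (metis inner_eq_zero_iff matrix_vector_mult_0)
  then show ?thesis by (simp add: matrix_eq)
qed

lemma transpose_iff_symmetric_inner:
  fixes M :: "real^'n::finite^'n"
  shows "transpose M = M \<longleftrightarrow> (\<forall>x y. x \<bullet> (M *v y) = y \<bullet> (M *v x))"
proof
  assume "transpose M = M"
  then show "\<forall>x y. x \<bullet> (M *v y) = y \<bullet> (M *v x)"
    by (metis dot_lmul_matrix inner_commute transpose_matrix_vector)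
next
  assume *: "\<forall>x y. x \<bullet> (M *v y) = y \<bullet> (M *v x)"
  have c: "axis i 1 \<bullet> (M *v axis j 1) = M $ i $ j" for i j
    by (simp add: inner_axis' matrix_vector_mult_basis column_def)
  show "transpose M = M"
    unfolding transpose_def vec_eq_iff using c *[rule_format, of "axis _ 1" "axis _ 1"] by simp
qed

text \<open>Uniqueness is polarisation: two symmetric matrices with the same quadratic form differ
  by a symmetric matrix with zero form. Coercivity on symmetric matrices supplies the positive
  definiteness demanded by \<open>form_matrix\<close>.\<close>

lemma form_matrix_eq_polar:
  assumes q: "quadratic_form q" and c: "c > 0" and coer: "\<forall>G\<in>sym_matrices. q G \<ge> c * (norm G)\<^sup>2"
  shows "form_matrix q = polar_matrix q" (is ?eq)
    and "x \<bullet> (polar_matrix q *v y) = y \<bullet> (polar_matrix q *v x)"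
    and "c * (norm x)\<^sup>2 \<le> x \<bullet> (polar_matrix q *v x)"
    and "A \<in> sym_matrices \<Longrightarrow> q A = coords A \<bullet> (polar_matrix q *v coords A)"
proof -
  obtain b where b: "bilinear b" "\<And>x y. b x y = b y x" "\<And>x. q x = b x x"
    using q unfolding quadratic_form_def by (elim exE conjE) simp
  note P = polar_matrix_inner[OF b]
  have sym: "x \<bullet> (polar_matrix q *v y) = y \<bullet> (polar_matrix q *v x)" for x y
    using P[of x y] P[of y x] b(2)[of "of_coords x" "of_coords y"] by simp
  have qA: "q A = coords A \<bullet> (polar_matrix q *v coords A)" if "A \<in> sym_matrices" for A
    unfolding P of_coords_coords[OF that] by (rule b(3))
  have lower: "c * (norm x)\<^sup>2 \<le> x \<bullet> (polar_matrix q *v x)" for x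
  proof -
    have "c * (norm x)\<^sup>2 \<le> c * (norm (of_coords x))\<^sup>2" using c norm_of_coords by simp
    also have "\<dots> \<le> q (of_coords x)" using coer of_coords_sym by blast
    finally show ?thesis unfolding P b(3) .
  qed
  show "x \<bullet> (polar_matrix q *v y) = y \<bullet> (polar_matrix q *v x)" by (rule sym)
  show "c * (norm x)\<^sup>2 \<le> x \<bullet> (polar_matrix q *v x)" by (rule lower)
  show "A \<in> sym_matrices \<Longrightarrow> q A = coords A \<bullet> (polar_matrix q *v coords A)" by (rule qA)
  have tr: "transpose (polar_matrix q) = polar_matrix q"
    using sym by (simp add: transpose_iff_symmetric_inner)
  show ?eq
    unfolding form_matrix_def
  proof (rule the_equality)
    have "a \<bullet> (polar_matrix q *v a) > 0" if "a \<noteq> 0" for a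
    proof -
      have "0 < c * (norm a)\<^sup>2" using c that by simp
      then show ?thesis using lower[of a] by linarith
    qed
    then show "transpose (polar_matrix q) = polar_matrix q \<and> (\<forall>a. a \<noteq> 0 \<longrightarrow> a \<bullet> (polar_matrix q *v a) > 0) \<and>
      (\<forall>A\<in>sym_matrices. q A = coords A \<bullet> (polar_matrix q *v coords A))"
      using tr qA by simp
    fix M :: "real^3^3"
    assume M: "transpose M = M \<and> (\<forall>a. a \<noteq> 0 \<longrightarrow> a \<bullet> (M *v a) > 0) \<and>
      (\<forall>A\<in>sym_matrices. q A = coords A \<bullet> (M *v coords A))"
    have "a \<bullet> (M *v a) = a \<bullet> (polar_matrix q *v a)" for a
      using M qA[OF of_coords_sym[of a]] of_coords_sym[of a] coords_of_coords[of a] by metis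
    then have "a \<bullet> ((M - polar_matrix q) *v a) = 0" for a
      by (simp add: matrix_vector_mult_diff_rdistrib inner_diff_right)
    moreover have "transpose (M - polar_matrix q) = M - polar_matrix q"
      using M tr by (simp add: transpose_def vec_eq_iff)
    ultimately have "M - polar_matrix q = 0" by (intro symmetric_matrix_eq_0)
    then show "M = polar_matrix q" by simp
  qed
qed

section \<open>Integration over the thickness\<close>

lemma integrable_euclidean_components:
  fixes f :: "'a \<Rightarrow> 'b::euclidean_space"
  assumes "\<And>b. b \<in> Basis \<Longrightarrow> integrable M (\<lambda>x. f x \<bullet> b)"
  shows "integrable M f"
proof -
  have "integrable M (\<lambda>x. \<Sum>b\<in>Basis. (f x \<bullet> b) *\<^sub>R b)"
    by (intro Bochner_Integration.integrable_sum integrable_scaleR_left assms)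
  then show ?thesis by (simp add: euclidean_representation)
qed

lemma integrable_vec_components:
  fixes f :: "'a \<Rightarrow> real^'n::finite"
  assumes "\<And>i. integrable M (\<lambda>x. f x $ i)"
  shows "integrable M f"
  by (rule integrable_euclidean_components) (use assms in \<open>auto simp: Basis_vec_def inner_axis\<close>)

lemma integrable_matrix_components:
  fixes f :: "'a \<Rightarrow> real^'n::finite^'m::finite"
  assumes "\<And>i j. integrable M (\<lambda>x. f x $ i $ j)"
  shows "integrable M f"
  by (rule integrable_euclidean_components) (use assms in \<open>auto simp: Basis_vec_def inner_axis\<close>)

lemma finite_measure_thickness: "finite_measure thickness"
  by (rule finite_measure_lebesgue_on) (metis box_real(1) lmeasurable_box)

text \<open>For k = 0, 1, 2 the values are 1, 0 and 1/12; the last is the origin of the 12 in the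
  coercivity constants.\<close>

lemma thickness_integral_power:
  "integrable thickness (\<lambda>t. t ^ k)"
  "(LINT t|thickness. t ^ k) = ((1/2) ^ Suc k - (-1/2) ^ Suc k) / Suc k"
proof -
  interpret finite_measure thickness by (rule finite_measure_thickness)
  have m: "(\<lambda>t::real. t ^ k) \<in> borel_measurable thickness"
    by (intro continuous_imp_measurable_on_sets_lebesgue continuous_intros) simp
  have "\<bar>t\<bar> ^ k \<le> 1" if "t \<in> {-1/2<..<1/2}" for t :: real
    using that by (intro power_le_one) auto
  then have "AE t in thickness. norm (t ^ k) \<le> 1"
    by (auto simp: AE_restrict_space_iff power_abs)
  from integrable_const_bound[OF this m] show i: "integrable thickness (\<lambda>t. t ^ k)" .
  have "((\<lambda>t::real. t ^ k) has_integral ((1/2) ^ Suc k / Suc k - (-1/2) ^ Suc k / Suc k)) {-1/2..1/2}"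
    by (rule fundamental_theorem_of_calculus)
      (auto intro!: derivative_eq_intros simp: has_real_derivative_iff_has_vector_derivative[symmetric] simp del: power_Suc)
  then have "integral {-1/2<..<1/2} (\<lambda>t::real. t ^ k) = (1/2) ^ Suc k / Suc k - (-1/2) ^ Suc k / Suc k"
    using integral_open_interval[of "-1/2" "1/2" "\<lambda>t::real. t ^ k"] by (simp add: integral_unique box_real cbox_interval)
  then show "(LINT t|thickness. t ^ k) = ((1/2) ^ Suc k - (-1/2) ^ Suc k) / Suc k"
    unfolding diff_divide_distrib using lebesgue_integral_eq_integral[OF i] by simp
qed

locale plate_data =
  fixes Q2 :: "real \<Rightarrow> real^2^2 \<Rightarrow> real" and B :: "real \<Rightarrow> real^2^2" and c C :: real
  assumes c_pos: "c > 0" and adm: "admissible_form c C Q2" and Linf: "Linf_sym B"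
begin

abbreviation "P t \<equiv> polar_matrix (Q2 t)"
abbreviation "b t \<equiv> coords (B t)"
abbreviation "M0 \<equiv> moment Q2 0"
abbreviation "M1 \<equiv> moment Q2 1"
abbreviation "M2 \<equiv> moment Q2 2"
abbreviation "Ms \<equiv> moment_star Q2"
abbreviation "b1 \<equiv> coords (B1 Q2 B)"
abbreviation "b2 \<equiv> coords (B2 Q2 B)"

lemma ae_form: "AE t in thickness. quadratic_form (Q2 t) \<and> (\<forall>G. Q2 t G \<le> C * (norm G)\<^sup>2) \<and>
    (\<forall>G\<in>sym_matrices. Q2 t G \<ge> c * (norm G)\<^sup>2)"
  using adm unfolding admissible_form_def by (auto elim: eventually_mono)

lemma ae_polar: "AE t in thickness. form_matrix (Q2 t) = P t \<and>
    (\<forall>x y. x \<bullet> (P t *v y) = y \<bullet> (P t *v x)) \<and> (\<forall>x. c * (norm x)\<^sup>2 \<le> x \<bullet> (P t *v x)) \<and>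
    (\<forall>A\<in>sym_matrices. Q2 t A = coords A \<bullet> (P t *v coords A))"
  using ae_form
proof eventually_elim
  case (elim t)
  note F = form_matrix_eq_polar[OF conjunct1[OF elim] c_pos conjunct2[OF conjunct2[OF elim]]]
  show ?case by (intro conjI allI ballI F) 
qed

lemma ae_form_matrix: "AE t in thickness. form_matrix (Q2 t) = P t"
  using ae_polar by eventually_elim (rule conjunct1)

lemma polar_entry_measurable: "(\<lambda>t. P t $ i $ j) \<in> borel_measurable thickness"
proof -
  have "(\<lambda>t. Q2 t G) \<in> borel_measurable thickness" for G
    using adm unfolding admissible_form_def by blast
  then show ?thesis unfolding polar_matrix_def vec_lambda_beta
    by (intro borel_measurable_divide borel_measurable_diff borel_measurable_const)
qed

text \<open>The entries polarise values of Q2 at symmetric matrices, where the form lies between 0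
  and C times the squared norm. The absolute value of C keeps the summands of K nonnegative.\<close>

lemma polar_entry_bounded: "\<exists>K. AE t in thickness. \<forall>i j. \<bar>P t $ i $ j\<bar> \<le> K"
proof -
  define K where "K = (\<Sum>i\<in>UNIV. \<Sum>j\<in>UNIV. \<bar>C\<bar> * ((norm (coord_unit i + coord_unit j))\<^sup>2 + (norm (coord_unit i))\<^sup>2 + (norm (coord_unit j))\<^sup>2))"
  have "AE t in thickness. \<forall>i j. \<bar>P t $ i $ j\<bar> \<le> K"
    using ae_form
  proof eventually_elim
    case (elim t)
    have q: "0 \<le> Q2 t G" "Q2 t G \<le> \<bar>C\<bar> * (norm G)\<^sup>2" if "G \<in> sym_matrices" for G
    proof -
      have "0 \<le> c * (norm G)\<^sup>2" using c_pos by simp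
      then show "0 \<le> Q2 t G" using elim that by force
      have "Q2 t G \<le> C * (norm G)\<^sup>2" using elim by blast
      also have "\<dots> \<le> \<bar>C\<bar> * (norm G)\<^sup>2" by (intro mult_right_mono) auto
      finally show "Q2 t G \<le> \<bar>C\<bar> * (norm G)\<^sup>2" .
    qed
    show ?case
    proof (intro allI)
      fix i j
      note s = of_coords_sym[of "axis i 1"] of_coords_sym[of "axis j 1"]
      have "\<bar>P t $ i $ j\<bar> \<le> Q2 t (coord_unit i + coord_unit j) + Q2 t (coord_unit i) + Q2 t (coord_unit j)"
        using q(1)[OF s(1)] q(1)[OF s(2)] q(1)[OF sym_matrices_add[OF s]] by (simp add: polar_matrix_def)
      also have "\<dots> \<le> \<bar>C\<bar> * ((norm (coord_unit i + coord_unit j))\<^sup>2 + (norm (coord_unit i))\<^sup>2 + (norm (coord_unit j))\<^sup>2)"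
        using q(2)[OF s(1)] q(2)[OF s(2)] q(2)[OF sym_matrices_add[OF s]] by (simp add: distrib_left)
      also have "\<dots> \<le> (\<Sum>j\<in>UNIV. \<bar>C\<bar> * ((norm (coord_unit i + coord_unit j))\<^sup>2 + (norm (coord_unit i))\<^sup>2 + (norm (coord_unit j))\<^sup>2))"
        by (rule member_le_sum[where f="\<lambda>j. \<bar>C\<bar> * ((norm (coord_unit i + coord_unit j))\<^sup>2 + (norm (coord_unit i))\<^sup>2 + (norm (coord_unit j))\<^sup>2)"]) auto
      also have "\<dots> \<le> K"
        unfolding K_def
        by (rule member_le_sum[where f="\<lambda>i. \<Sum>j\<in>UNIV. \<bar>C\<bar> * ((norm (coord_unit i + coord_unit j))\<^sup>2 + (norm (coord_unit i))\<^sup>2 + (norm (coord_unit j))\<^sup>2)"])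
          (auto intro!: sum_nonneg)
      finally show "\<bar>P t $ i $ j\<bar> \<le> K" .
    qed
  qed
  then show ?thesis by blast
qed

lemma coords_B_measurable: "(\<lambda>t. b t $ i) \<in> borel_measurable thickness"
proof -
  have "(\<lambda>t. B t $ i $ j) \<in> borel_measurable thickness" for i j
  proof -
    have B: "B \<in> borel_measurable thickness" using Linf unfolding Linf_sym_def by blast
    have "continuous_on UNIV (\<lambda>A::real^2^2. A $ i $ j)" by (intro continuous_intros)
    from borel_measurable_continuous_on[OF this B] show ?thesis .
  qed
  then have "\<forall>i. (\<lambda>t. b t $ i) \<in> borel_measurable thickness"
    unfolding forall_3 by (simp add: coords_def)
  then show ?thesis by blast
qed

lemma coords_B_bounded: "\<exists>K. AE t in thickness. \<forall>i. \<bar>b t $ i\<bar> \<le> K"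
proof -
  obtain K where "AE t in thickness. norm (B t) \<le> K" using Linf unfolding Linf_sym_def by blast
  then have "AE t in thickness. \<forall>i. \<bar>b t $ i\<bar> \<le> K"
  proof eventually_elim
    case (elim t)
    have "\<bar>B t $ i $ j\<bar> \<le> K" for i j
      using component_le_norm_cart[of "B t $ i" j] Finite_Cartesian_Product.norm_nth_le[of "B t" i] elim by linarith
    then show ?case unfolding forall_3 by (simp add: coords_def)
  qed
  then show ?thesis by blast
qed

lemma power_thickness_bound: "AE t in thickness. \<bar>t ^ k\<bar> \<le> 1"
proof -
  have "\<bar>t\<bar> ^ k \<le> 1" if "t \<in> {-1/2<..<1/2}" for t :: real
    using that by (intro power_le_one) auto
  then show ?thesis by (auto simp: AE_restrict_space_iff power_abs)
qed

lemma integrable_thickness_bounded: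
  fixes f :: "real \<Rightarrow> real"
  assumes "f \<in> borel_measurable thickness" "AE t in thickness. \<bar>f t\<bar> \<le> K"
  shows "integrable thickness f"
  by (rule finite_measure.integrable_const_bound[OF finite_measure_thickness _ assms(1)])
    (unfold real_norm_def, rule assms(2))

lemma power_measurable: "(\<lambda>t. t ^ k) \<in> borel_measurable thickness"
  using thickness_integral_power(1) by (rule borel_measurable_integrable)

lemma moment_integrable: "integrable thickness (\<lambda>t. t ^ k *\<^sub>R form_matrix (Q2 t))"
proof -
  have "integrable thickness (\<lambda>t. t ^ k *\<^sub>R P t)"
  proof (rule integrable_matrix_components)
    fix i j
    obtain K where K: "AE t in thickness. \<forall>i j. \<bar>P t $ i $ j\<bar> \<le> K" using polar_entry_bounded by blast
    show "integrable thickness (\<lambda>t. (t ^ k *\<^sub>R P t) $ i $ j)"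
    proof (rule integrable_thickness_bounded)
      show "(\<lambda>t. (t ^ k *\<^sub>R P t) $ i $ j) \<in> borel_measurable thickness"
        using borel_measurable_times[OF power_measurable polar_entry_measurable] by simp
      show "AE t in thickness. \<bar>(t ^ k *\<^sub>R P t) $ i $ j\<bar> \<le> 1 * K"
        using K power_thickness_bound[of k]
      proof eventually_elim
        case (elim t)
        show ?case
          unfolding vector_scaleR_component real_scaleR_def abs_mult
          by (rule mult_mono) (use elim in auto)
      qed
    qed
  qed
  then show ?thesis
    by (rule integrable_lebesgue_on_cong_AE(1)) (simp, use ae_form_matrix in eventually_elim, simp)
qed

lemma load_component_bounded:
  "\<exists>K. AE t in thickness. \<forall>i. \<bar>(P t *v b t) $ i\<bar> \<le> K"
proof -
  obtain K where K: "AE t in thickness. \<forall>i j. \<bar>P t $ i $ j\<bar> \<le> K" using polar_entry_bounded by blast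
  obtain L where L: "AE t in thickness. \<forall>i. \<bar>b t $ i\<bar> \<le> L" using coords_B_bounded by blast
  have "AE t in thickness. \<forall>i. \<bar>(P t *v b t) $ i\<bar> \<le> 3 * (K * L)"
    using K L
  proof eventually_elim
    case (elim t)
    show ?case
    proof
      fix i
      have "\<bar>(P t *v b t) $ i\<bar> \<le> (\<Sum>j\<in>UNIV. \<bar>P t $ i $ j * b t $ j\<bar>)"
        unfolding matrix_vector_mult_def by simp
      also have "\<dots> \<le> (\<Sum>j\<in>(UNIV::3 set). K * L)"
        unfolding abs_mult
        by (intro sum_mono mult_mono) (use elim in \<open>auto intro: order_trans[OF abs_ge_zero]\<close>)
      finally show "\<bar>(P t *v b t) $ i\<bar> \<le> 3 * (K * L)" by simp
    qed
  qed
  then show ?thesis by blast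
qed

lemma load_component_measurable: "(\<lambda>t. (P t *v b t) $ i) \<in> borel_measurable thickness"
  using polar_entry_measurable coords_B_measurable
  by (simp add: matrix_vector_mult_def)

lemma load_integrable: "integrable thickness (\<lambda>t. t ^ k *\<^sub>R (form_matrix (Q2 t) *v b t))"
proof -
  have "integrable thickness (\<lambda>t. t ^ k *\<^sub>R (P t *v b t))"
  proof (rule integrable_vec_components)
    fix i
    obtain K where K: "AE t in thickness. \<forall>i. \<bar>(P t *v b t) $ i\<bar> \<le> K" using load_component_bounded by blast
    show "integrable thickness (\<lambda>t. (t ^ k *\<^sub>R (P t *v b t)) $ i)"
    proof (rule integrable_thickness_bounded)
      show "(\<lambda>t. (t ^ k *\<^sub>R (P t *v b t)) $ i) \<in> borel_measurable thickness"
        using borel_measurable_times[OF power_measurable load_component_measurable] by simp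
      show "AE t in thickness. \<bar>(t ^ k *\<^sub>R (P t *v b t)) $ i\<bar> \<le> 1 * K"
        using K power_thickness_bound[of k]
      proof eventually_elim
        case (elim t)
        show ?case
          unfolding vector_scaleR_component real_scaleR_def abs_mult
          by (rule mult_mono) (use elim in auto)
      qed
    qed
  qed
  then show ?thesis
    by (rule integrable_lebesgue_on_cong_AE(1)) (simp, use ae_form_matrix in eventually_elim, simp)
qed

lemma energy_integrable: "integrable thickness (\<lambda>t. b t \<bullet> (P t *v b t))"
proof -
  obtain K where K: "AE t in thickness. \<forall>i. \<bar>(P t *v b t) $ i\<bar> \<le> K" using load_component_bounded by blast
  obtain L where L: "AE t in thickness. \<forall>i. \<bar>b t $ i\<bar> \<le> L" using coords_B_bounded by blast
  have "integrable thickness (\<lambda>t. b t $ i * (P t *v b t) $ i)" for i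
  proof (rule integrable_thickness_bounded)
    show "(\<lambda>t. b t $ i * (P t *v b t) $ i) \<in> borel_measurable thickness"
      by (intro borel_measurable_times coords_B_measurable load_component_measurable)
    show "AE t in thickness. \<bar>b t $ i * (P t *v b t) $ i\<bar> \<le> L * K"
      using K L
    proof eventually_elim
      case (elim t)
      show ?case unfolding abs_mult
        by (rule mult_mono) (use elim in \<open>auto intro: order_trans[OF abs_ge_zero]\<close>)
    qed
  qed
  then show ?thesis unfolding inner_vec_def by simp
qed

text \<open>For fixed x and y the map M -> x \<bullet> (M *v y) is linear and commutes with the
  matrix-valued integral, so the moments can be handled through scalar integrals of the explicit
  matrices \<open>P t\<close>.\<close>

lemma moment_inner:
  "integrable thickness (\<lambda>t. t ^ k * (x \<bullet> (P t *v y)))"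
  "(LINT t|thickness. t ^ k * (x \<bullet> (P t *v y))) = x \<bullet> (moment Q2 k *v y)"
proof -
  have "linear (\<lambda>A::real^3^3. x \<bullet> (A *v y))"
    by (rule linearI) (simp_all add: matrix_vector_mult_add_rdistrib inner_add_right flip: scaleR_matrix_vector_assoc)
  then have bl: "bounded_linear (\<lambda>A::real^3^3. x \<bullet> (A *v y))" by (simp add: linear_conv_bounded_linear)
  have i: "integrable thickness (\<lambda>t. x \<bullet> ((t ^ k *\<^sub>R form_matrix (Q2 t)) *v y))"
    by (rule integrable_bounded_linear[OF bl moment_integrable])
  have ae: "AE t in thickness. x \<bullet> ((t ^ k *\<^sub>R form_matrix (Q2 t)) *v y) = t ^ k * (x \<bullet> (P t *v y))"
    using ae_form_matrix by eventually_elim (simp flip: scaleR_matrix_vector_assoc)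
  show "integrable thickness (\<lambda>t. t ^ k * (x \<bullet> (P t *v y)))"
    by (rule integrable_lebesgue_on_cong_AE(1)[OF i _ ae]) simp
  have "(LINT t|thickness. t ^ k * (x \<bullet> (P t *v y))) = (LINT t|thickness. x \<bullet> ((t ^ k *\<^sub>R form_matrix (Q2 t)) *v y))"
    by (rule integrable_lebesgue_on_cong_AE(2)[OF i _ ae]) simp
  also have "\<dots> = x \<bullet> (moment Q2 k *v y)"
    unfolding moment_def by (rule integral_bounded_linear[OF bl moment_integrable])
  finally show "(LINT t|thickness. t ^ k * (x \<bullet> (P t *v y))) = x \<bullet> (moment Q2 k *v y)" .
qed

lemma load_inner:
  "integrable thickness (\<lambda>t. t ^ k * (x \<bullet> (P t *v b t)))"
  "(LINT t|thickness. t ^ k * (x \<bullet> (P t *v b t))) = x \<bullet> (LINT t|thickness. t ^ k *\<^sub>R (form_matrix (Q2 t) *v b t))"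
proof -
  have bl: "bounded_linear (\<lambda>v. x \<bullet> v)" by (rule bounded_linear_inner_right)
  have i: "integrable thickness (\<lambda>t. x \<bullet> (t ^ k *\<^sub>R (form_matrix (Q2 t) *v b t)))"
    by (rule integrable_bounded_linear[OF bl load_integrable])
  have ae: "AE t in thickness. x \<bullet> (t ^ k *\<^sub>R (form_matrix (Q2 t) *v b t)) = t ^ k * (x \<bullet> (P t *v b t))"
    using ae_form_matrix by eventually_elim simp
  show "integrable thickness (\<lambda>t. t ^ k * (x \<bullet> (P t *v b t)))"
    by (rule integrable_lebesgue_on_cong_AE(1)[OF i _ ae]) simp
  have "(LINT t|thickness. t ^ k * (x \<bullet> (P t *v b t))) = (LINT t|thickness. x \<bullet> (t ^ k *\<^sub>R (form_matrix (Q2 t) *v b t)))"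
    by (rule integrable_lebesgue_on_cong_AE(2)[OF i _ ae]) simp
  also have "\<dots> = x \<bullet> (LINT t|thickness. t ^ k *\<^sub>R (form_matrix (Q2 t) *v b t))"
    by (rule integral_bounded_linear[OF bl load_integrable])
  finally show "(LINT t|thickness. t ^ k * (x \<bullet> (P t *v b t))) = x \<bullet> (LINT t|thickness. t ^ k *\<^sub>R (form_matrix (Q2 t) *v b t))" .
qed

lemma b1_inner: "(LINT t|thickness. t ^ 0 * (x \<bullet> (P t *v b t))) = x \<bullet> b1"
  unfolding load_inner(2) B1_def coords_of_coords by simp

lemma b2_inner: "(LINT t|thickness. t ^ 1 * (x \<bullet> (P t *v b t))) = x \<bullet> b2"
  unfolding load_inner(2) B2_def coords_of_coords by simp

lemma moment_sym: "x \<bullet> (moment Q2 k *v y) = y \<bullet> (moment Q2 k *v x)"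
proof -
  have ae: "AE t in thickness. t ^ k * (x \<bullet> (P t *v y)) = t ^ k * (y \<bullet> (P t *v x))"
    using ae_polar by eventually_elim metis
  show ?thesis
    unfolding moment_inner(2)[symmetric]
    by (rule integrable_lebesgue_on_cong_AE(2)[OF moment_inner(1) _ ae, symmetric]) simp
qed

section \<open>The thickness energy and its completed square\<close>

definition energy_const :: real where
  "energy_const = (LINT t|thickness. b t \<bullet> (P t *v b t))"

definition energy :: "real^3 \<Rightarrow> real^3 \<Rightarrow> real" where
  "energy e f = e \<bullet> (M0 *v e) + 2 * (e \<bullet> (M1 *v f)) + f \<bullet> (M2 *v f) + 2 * (e \<bullet> b1) + 2 * (f \<bullet> b2) + energy_const"

lemma thickness_energy:
  assumes E: "E \<in> sym_matrices" and F: "F \<in> sym_matrices"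
  shows "(LINT t|thickness. Q2 t (E + t *\<^sub>R F + B t)) = energy (coords E) (coords F)"
proof -
  define e where "e = coords E"
  define f where "f = coords F"
  define g where "g t = t ^ 0 * (e \<bullet> (P t *v e)) + 2 * (t ^ 1 * (e \<bullet> (P t *v f))) + t ^ 2 * (f \<bullet> (P t *v f)) +
      2 * (t ^ 0 * (e \<bullet> (P t *v b t))) + 2 * (t ^ 1 * (f \<bullet> (P t *v b t))) + b t \<bullet> (P t *v b t)" for t
  have g: "integrable thickness g"
    unfolding g_def
    by (intro Bochner_Integration.integrable_add integrable_mult_right moment_inner(1) load_inner(1) energy_integrable)
  have gi: "(LINT t|thickness. g t) = energy e f"
    unfolding g_def energy_def energy_const_def
      moment_inner(2)[symmetric] b1_inner[symmetric] b2_inner[symmetric]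
    by (simp only: Bochner_Integration.integral_add Bochner_Integration.integrable_add integrable_mult_right
        moment_inner(1) load_inner(1) energy_integrable integral_mult_right_zero)
  have "AE t in thickness. B t \<in> sym_matrices" using Linf unfolding Linf_sym_def by blast
  with ae_polar have ae: "AE t in thickness. g t = Q2 t (E + t *\<^sub>R F + B t)"
  proof eventually_elim
    case (elim t)
    then have s: "x \<bullet> (P t *v y) = y \<bullet> (P t *v x)" for x y by blast
    have "E + t *\<^sub>R F + B t \<in> sym_matrices"
      using elim(2) E F by (intro sym_matrices_add sym_matrices_scaleR)
    then have "Q2 t (E + t *\<^sub>R F + B t) = (e + t *\<^sub>R f + b t) \<bullet> (P t *v (e + t *\<^sub>R f + b t))"
      using elim(1) by (simp add: coords_add coords_scaleR e_def f_def)
    also have "\<dots> = g t"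
      unfolding g_def
      by (simp add: matrix_vector_right_distrib matrix_vector_mult_scaleR inner_add power2_eq_square
          s[of f e] s[of "b t" e] s[of "b t" f] algebra_simps)
    finally show ?case by simp
  qed
  have "(LINT t|thickness. Q2 t (E + t *\<^sub>R F + B t)) = (LINT t|thickness. g t)"
    by (rule integrable_lebesgue_on_cong_AE(2)[OF g _ ae]) simp
  then show ?thesis unfolding gi e_def f_def .
qed

text \<open>Integrate the pointwise bound for the vector e + t f: the mixed term drops out because t
  has mean 0, and t^2 has mean 1/12.\<close>

lemma moment_coercive:
  "c * ((norm e)\<^sup>2 + (norm f)\<^sup>2 / 12) \<le> e \<bullet> (M0 *v e) + 2 * (e \<bullet> (M1 *v f)) + f \<bullet> (M2 *v f)"
proof -
  define g where "g t = t ^ 0 * (e \<bullet> (P t *v e)) + 2 * (t ^ 1 * (e \<bullet> (P t *v f))) + t ^ 2 * (f \<bullet> (P t *v f))" for t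
  define h where "h t = (c * (norm e)\<^sup>2) * t ^ 0 + (2 * c * (e \<bullet> f)) * t ^ 1 + (c * (norm f)\<^sup>2) * t ^ 2" for t
  have g: "integrable thickness g"
    unfolding g_def
    by (intro Bochner_Integration.integrable_add integrable_mult_right moment_inner(1))
  have h: "integrable thickness h"
    unfolding h_def
    by (intro Bochner_Integration.integrable_add integrable_mult_right thickness_integral_power(1))
  have gi: "(LINT t|thickness. g t) = e \<bullet> (M0 *v e) + 2 * (e \<bullet> (M1 *v f)) + f \<bullet> (M2 *v f)"
    unfolding g_def moment_inner(2)[symmetric]
    by (simp only: Bochner_Integration.integral_add Bochner_Integration.integrable_add integrable_mult_right
        moment_inner(1) integral_mult_right_zero)
  have "(LINT t|thickness. h t) = (c * (norm e)\<^sup>2) * (LINT t|thickness. t ^ 0) +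
      (2 * c * (e \<bullet> f)) * (LINT t|thickness. t ^ 1) + (c * (norm f)\<^sup>2) * (LINT t|thickness. t ^ 2)"
    unfolding h_def
    by (simp only: Bochner_Integration.integral_add Bochner_Integration.integrable_add integrable_mult_right
        thickness_integral_power(1) integral_mult_right_zero)
  also have "\<dots> = c * ((norm e)\<^sup>2 + (norm f)\<^sup>2 / 12)"
    unfolding thickness_integral_power(2) by (simp add: field_simps power2_eq_square power3_eq_cube)
  finally have hi: "(LINT t|thickness. h t) = c * ((norm e)\<^sup>2 + (norm f)\<^sup>2 / 12)" .
  have "(LINT t|thickness. h t) \<le> (LINT t|thickness. g t)"
  proof (rule integral_mono_AE[OF h g])
    show "AE t in thickness. h t \<le> g t"
      using ae_polar
    proof eventually_elim
      case (elim t)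
      then have s: "x \<bullet> (P t *v y) = y \<bullet> (P t *v x)" for x y by blast
      have "h t = c * (norm (e + t *\<^sub>R f))\<^sup>2"
        unfolding h_def power2_norm_eq_inner
        by (simp add: inner_add inner_commute[of f e] power2_eq_square algebra_simps)
      also have "\<dots> \<le> (e + t *\<^sub>R f) \<bullet> (P t *v (e + t *\<^sub>R f))" using elim by blast
      also have "\<dots> = g t"
        unfolding g_def
        by (simp add: matrix_vector_right_distrib matrix_vector_mult_scaleR inner_add power2_eq_square
            s[of f e] algebra_simps)
      finally show ?case .
    qed
  qed
  then show ?thesis unfolding gi hi .
qed

lemma M0_coercive: "c * (norm e)\<^sup>2 \<le> e \<bullet> (M0 *v e)"
  using moment_coercive[of e 0] by simp

lemma M0_inverse: "M0 *v (matrix_inv M0 *v x) = x"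
proof -
  have "M0 *v x = 0 \<Longrightarrow> x = 0" for x
    using M0_coercive[of x] c_pos by (auto simp: mult_le_0_iff)
  then have "\<exists>A. A ** M0 = mat 1" unfolding matrix_left_invertible_ker by blast
  then have "invertible M0" by (simp add: invertible_left_inverse)
  then have "M0 ** matrix_inv M0 = mat 1"
    unfolding invertible_def matrix_inv_def by (rule someI2_ex) simp
  then show ?thesis by (simp add: matrix_vector_mul_assoc)
qed

text \<open>The vector \<open>- relax f\<close> minimises the quadratic part of
  \<open>energy\<close> in e for given f. Substituting it produces the Schur complement
  \<open>moment_star\<close>.\<close>

definition relax :: "real^3 \<Rightarrow> real^3" where "relax f = matrix_inv M0 *v (M1 *v f)"

lemma M0_relax: "M0 *v relax f = M1 *v f"
  unfolding relax_def by (rule M0_inverse)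

lemma Ms_apply: "Ms *v f = M2 *v f - M1 *v relax f"
  by (simp add: moment_star_def relax_def matrix_vector_mult_diff_rdistrib matrix_vector_mul_assoc matrix_mul_assoc del: One_nat_def)

lemma M1_relax: "x \<bullet> (M1 *v relax y) = relax x \<bullet> (M0 *v relax y)"
  by (metis M0_relax moment_sym)

lemma Ms_sym: "x \<bullet> (Ms *v y) = y \<bullet> (Ms *v x)"
proof -
  have "x \<bullet> (M1 *v relax y) = y \<bullet> (M1 *v relax x)"
    unfolding M1_relax by (rule moment_sym)
  then show ?thesis
    unfolding Ms_apply using moment_sym[of x 2 y] by (simp add: inner_diff_right)
qed

text \<open>The Schur complement inherits the joint coercivity of the moments by inserting e =
  \<open>- relax f\<close>.\<close>

lemma Ms_coercive: "c / 12 * (norm f)\<^sup>2 \<le> f \<bullet> (Ms *v f)"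
proof -
  have e1: "f \<bullet> (M1 *v relax f) = relax f \<bullet> (M0 *v relax f)" by (rule M1_relax)
  have neg: "M0 *v (- x) = - (M0 *v x)" for x
    using matrix_vector_mult_scaleR[of M0 "-1" x] by simp
  have e2: "relax f \<bullet> (M1 *v f) = relax f \<bullet> (M0 *v relax f)" by (simp add: M0_relax del: One_nat_def)
  have "c * ((norm (- relax f))\<^sup>2 + (norm f)\<^sup>2 / 12) \<le>
      (- relax f) \<bullet> (M0 *v (- relax f)) + 2 * ((- relax f) \<bullet> (M1 *v f)) + f \<bullet> (M2 *v f)"
    by (rule moment_coercive)
  also have "\<dots> = f \<bullet> (Ms *v f)"
    unfolding Ms_apply by (simp add: inner_diff_right e1 e2 neg del: One_nat_def)
  finally have "c * (norm (relax f))\<^sup>2 + c / 12 * (norm f)\<^sup>2 \<le> f \<bullet> (Ms *v f)"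
    by (simp add: distrib_left)
  moreover have "0 \<le> c * (norm (relax f))\<^sup>2" using c_pos by simp
  ultimately show ?thesis by linarith
qed

text \<open>A right inverse g of M shows that A lies in the image of the symmetric matrices, which
  is all that \<open>inv_into\<close> needs in order to be a right inverse at A.\<close>

lemma coord_map_inv_eq:
  assumes surj: "\<And>x. M *v (g x) = x" and A: "A \<in> sym_matrices"
  shows "M *v coords (coord_map_inv M A) = coords A"
proof -
  have "coord_map M (of_coords (g (coords A))) = A"
    unfolding coord_map_def coords_of_coords surj by (rule of_coords_coords[OF A])
  then have im: "A \<in> coord_map M ` sym_matrices" using of_coords_sym by (metis imageI)
  have "coord_map M (coord_map_inv M A) = A" unfolding coord_map_inv_def by (rule f_inv_into_f[OF im])
  then show "M *v coords (coord_map_inv M A) = coords A" unfolding coord_map_def by (metis coords_of_coords)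
qed

lemma Ms_inverse: "\<exists>A. \<forall>x. Ms *v (A *v x) = x"
proof -
  have "Ms *v x = 0 \<Longrightarrow> x = 0" for x
    using Ms_coercive[of x] c_pos by (auto simp: mult_le_0_iff)
  then have "\<exists>A. A ** Ms = mat 1" unfolding matrix_left_invertible_ker by blast
  then obtain A where "A ** Ms = mat 1" by blast
  then have "Ms ** A = mat 1" by (simp add: matrix_left_right_inverse)
  then have "Ms *v (A *v x) = x" for x by (simp add: matrix_vector_mul_assoc)
  then show ?thesis by blast
qed

abbreviation "e0 \<equiv> coords (coord_map_inv M0 (B1 Q2 B))"
abbreviation "f0 \<equiv> coords (F0 Q2 B)"

lemma M0_e0: "M0 *v e0 = b1"
  by (rule coord_map_inv_eq[OF M0_inverse]) (simp add: B1_def of_coords_sym)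

lemma Ms_f0: "Ms *v f0 = M1 *v e0 - b2"
proof -
  obtain A where A: "\<And>x. Ms *v (A *v x) = x" using Ms_inverse by blast
  have s: "coord_map M1 (coord_map_inv M0 (B1 Q2 B)) - B2 Q2 B \<in> sym_matrices"
    by (intro sym_matrices_diff) (simp_all add: coord_map_def B2_def of_coords_sym)
  have "Ms *v f0 = coords (coord_map M1 (coord_map_inv M0 (B1 Q2 B)) - B2 Q2 B)"
    unfolding F0_def by (rule coord_map_inv_eq[OF A s])
  then show "Ms *v f0 = M1 *v e0 - b2" by (simp add: coords_diff coord_map_def coords_of_coords del: One_nat_def)
qed

text \<open>In e the square is centred at \<open>- relax f - e0\<close>, the response to the
  curvature and to the load b1. The terms linear in f collect to b2 - M1 e0, which is -Ms f0 by
  \<open>Ms_f0\<close>; this explains the formula for \<open>F0\<close>.\<close>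

lemma energy_complete_square:
  "energy e f = (e + relax f + e0) \<bullet> (M0 *v (e + relax f + e0)) +
     f \<bullet> (Ms *v f) - 2 * (f \<bullet> (Ms *v f0)) + energy_const - e0 \<bullet> b1"
proof -
  have m: "x \<bullet> (M1 *v y) = x \<bullet> (M0 *v relax y)" for x y by (simp add: M0_relax del: One_nat_def)
  have b: "x \<bullet> b1 = x \<bullet> (M0 *v e0)" for x by (simp add: M0_e0)
  have f0: "f \<bullet> (Ms *v f0) = relax f \<bullet> (M0 *v e0) - f \<bullet> b2"
  proof -
    have "f \<bullet> (M1 *v e0) = relax f \<bullet> (M0 *v e0)"
      by (metis M0_relax moment_sym)
    then show ?thesis by (simp add: Ms_f0 inner_diff_right del: One_nat_def)
  qed
  have ms: "f \<bullet> (Ms *v f) = f \<bullet> (M2 *v f) - relax f \<bullet> (M0 *v relax f)"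
    unfolding Ms_apply by (simp add: inner_diff_right M1_relax del: One_nat_def)
  show ?thesis
    unfolding energy_def f0 ms
    by (simp add: m b matrix_vector_right_distrib inner_add
        moment_sym[of "relax f" 0 e] moment_sym[of e0 0 e] moment_sym[of e0 0 "relax f"] del: One_nat_def)
qed

text \<open>The value of \<open>Qbar\<close> at \<open>F0\<close>, which is its minimum over
  symmetric arguments when the determinant is unconstrained.\<close>

definition kappa :: real where
  "kappa = energy_const - e0 \<bullet> b1 - f0 \<bullet> (Ms *v f0)"

lemma Qbar_eq_Qstar:
  assumes F: "F \<in> sym_matrices"
  shows "Qbar Q2 B F = Qstar Q2 (F - F0 Q2 B) + kappa"
proof -
  define f where "f = coords F"
  \<comment> \<open>This choice makes the square in e vanish, so the infimum is attained.\<close>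
  define E where "E = of_coords (- relax f - e0)"
  define m where "m = f \<bullet> (Ms *v f) - 2 * (f \<bullet> (Ms *v f0)) + energy_const - e0 \<bullet> b1"
  have "Qbar Q2 B F = Inf ((\<lambda>E. energy (coords E) f) ` sym_matrices)"
    unfolding Qbar_def f_def using thickness_energy[OF _ F] by (metis (mono_tags, lifting) image_cong)
  also have "\<dots> = m"
  proof (rule cInf_eq_minimum)
    have "energy (coords E) f = m"
      unfolding energy_complete_square E_def coords_of_coords m_def by simp
    then show "m \<in> (\<lambda>E. energy (coords E) f) ` sym_matrices"
      using of_coords_sym by (metis E_def imageI)
    fix y assume "y \<in> (\<lambda>E. energy (coords E) f) ` sym_matrices"
    then obtain E where y: "y = energy (coords E) f" by blast
    define z where "z = coords E + relax f + e0"
    have "0 \<le> c * (norm z)\<^sup>2" using c_pos by simp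
    also have "\<dots> \<le> z \<bullet> (M0 *v z)" by (rule M0_coercive)
    finally show "m \<le> y" unfolding y energy_complete_square m_def z_def by simp
  qed
  also have "m = Qstar Q2 (F - F0 Q2 B) + kappa"
    unfolding m_def kappa_def Qstar_def coords_diff f_def[symmetric]
    using Ms_sym[of f0 f] by (simp add: matrix_vector_mult_diff_distrib inner_diff_left inner_diff_right)
  finally show ?thesis .
qed

section \<open>The optimal curvatures as nearest points of the cone\<close>

definition star_form :: "real^3 \<Rightarrow> real^3 \<Rightarrow> real" where
  "star_form x y = x \<bullet> (Ms *v y)"

lemma coercive_star_form: "coercive_form star_form (c / 12)"
proof
  show "bilinear star_form"
    unfolding bilinear_def star_form_def
    by (intro conjI allI linearI)
      (simp_all add: inner_add_left inner_add_right matrix_vector_right_distrib matrix_vector_mult_scaleR)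
  show "star_form x y = star_form y x" for x y unfolding star_form_def by (rule Ms_sym)
  show "c / 12 > 0" using c_pos by simp
  show "c / 12 * (norm x)\<^sup>2 \<le> star_form x x" for x unfolding star_form_def by (rule Ms_coercive)
qed

lemma Qstar_eq: "Qstar Q2 (F - F0 Q2 B) = star_form (coords F - f0) (coords F - f0)"
  by (simp add: Qstar_def star_form_def coords_diff)

lemma det_eq_0_iff_coords: "F \<in> sym_matrices \<Longrightarrow> det F = 0 \<longleftrightarrow> coords F \<in> singular_cone"
  by (auto simp: det_2 sym_matrices_iff singular_cone_def coords_def power2_eq_square)

lemma opt_curvatures_iff:
  "F \<in> opt_curvatures Q2 B \<longleftrightarrow> F \<in> sym_matrices \<and> coords F \<in> cone_nearest star_form f0"
proof -
  have "F \<in> opt_curvatures Q2 B \<longleftrightarrow> F \<in> sym_matrices \<and> coords F \<in> singular_cone \<and>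
    (\<forall>F'. F' \<in> sym_matrices \<and> coords F' \<in> singular_cone \<longrightarrow>
      star_form (coords F - f0) (coords F - f0) \<le> star_form (coords F' - f0) (coords F' - f0))"
    unfolding opt_curvatures_def is_arg_min_linorder Qstar_eq mem_Collect_eq
    using det_eq_0_iff_coords by blast
  also have "\<dots> \<longleftrightarrow> F \<in> sym_matrices \<and> coords F \<in> cone_nearest star_form f0"
    unfolding cone_nearest_def mem_Collect_eq by (metis coords_of_coords of_coords_sym)
  finally show ?thesis .
qed

lemma opt_curvatures_nonempty: "opt_curvatures Q2 B \<noteq> {}"
proof -
  interpret coercive_form star_form "c / 12" f0 by (rule coercive_star_form)
  obtain a where "a \<in> cone_nearest star_form f0" using cone_nearest_nonempty by blast
  then have "of_coords a \<in> opt_curvatures Q2 B"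
    by (simp add: opt_curvatures_iff of_coords_sym coords_of_coords)
  then show ?thesis by blast
qed

end

section \<open>Square integrability on bounded domains\<close>

lemma finite_measure_lebesgue_on_bounded:
  "open \<omega> \<Longrightarrow> bounded \<omega> \<Longrightarrow> finite_measure (lebesgue_on \<omega>)"
  by (intro finite_measure_lebesgue_on lmeasurable_open)

lemma L2_on_continuous:
  fixes g :: "real^'n::finite \<Rightarrow> real"
  assumes \<omega>: "open \<omega>" "bounded \<omega>" and g: "continuous_on UNIV g"
  shows "L2_on \<omega> g"
proof -
  have m: "f \<in> borel_measurable (lebesgue_on \<omega>)" if "continuous_on UNIV f" for f :: "real^'n \<Rightarrow> real"
    by (rule continuous_imp_measurable_on_sets_lebesgue[OF continuous_on_subset[OF that subset_UNIV]])
      (use \<omega>(1) in simp)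
  have g2: "continuous_on UNIV (\<lambda>x. (g x)\<^sup>2)" by (intro continuous_intros g)
  have "compact (closure \<omega>)" using \<omega>(2) by (rule compact_closure[THEN iffD2])
  then have "bounded ((\<lambda>x. (g x)\<^sup>2) ` closure \<omega>)"
    by (intro compact_imp_bounded compact_continuous_image continuous_on_subset[OF g2 subset_UNIV])
  then obtain M where M: "\<And>x. x \<in> closure \<omega> \<Longrightarrow> norm ((g x)\<^sup>2) \<le> M"
    unfolding bounded_iff by auto
  have "AE x in lebesgue_on \<omega>. norm ((g x)\<^sup>2) \<le> M"
    unfolding AE_lebesgue_on_open_iff[OF \<omega>(1)]
    by (intro AE_I2 impI M) (rule subsetD[OF closure_subset])
  from finite_measure.integrable_const_bound[OF finite_measure_lebesgue_on_bounded[OF \<omega>] this m[OF g2]]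
  show ?thesis using m[OF g] unfolding L2_on_def by blast
qed

lemma L2_on_cong_AE:
  fixes f g :: "real^'n::finite \<Rightarrow> real"
  assumes f: "L2_on \<omega> f" and \<omega>: "open \<omega>" and ae: "AE x in lebesgue_on \<omega>. f x = g x"
  shows "L2_on \<omega> g"
proof -
  have \<omega>s: "\<omega> \<in> sets lebesgue" using \<omega> by simp
  have "g \<in> borel_measurable (lebesgue_on \<omega>)"
    using f unfolding L2_on_def by (intro lebesgue_on_measurable_cong_AE[OF _ \<omega>s ae]) blast
  moreover have "AE x in lebesgue_on \<omega>. (f x)\<^sup>2 = (g x)\<^sup>2"
    using ae by eventually_elim simp
  from integrable_lebesgue_on_cong_AE(1)[OF _ \<omega>s this]
  have "integrable (lebesgue_on \<omega>) (\<lambda>x. (g x)\<^sup>2)" using f unfolding L2_on_def by blast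
  ultimately show ?thesis unfolding L2_on_def by blast
qed

lemma L2_on_mult_integrable:
  assumes "L2_on \<omega> f" "L2_on \<omega> g"
  shows "integrable (lebesgue_on \<omega>) (\<lambda>x. f x * g x)"
proof (rule Bochner_Integration.integrable_bound[of _ "\<lambda>x. (f x)\<^sup>2 + (g x)\<^sup>2"])
  show "integrable (lebesgue_on \<omega>) (\<lambda>x. (f x)\<^sup>2 + (g x)\<^sup>2)"
    using assms unfolding L2_on_def by simp
  show "(\<lambda>x. f x * g x) \<in> borel_measurable (lebesgue_on \<omega>)"
    using assms unfolding L2_on_def by (intro borel_measurable_times) blast+
  have "\<bar>a * b\<bar> \<le> a\<^sup>2 + b\<^sup>2" for a b :: real
  proof -
    have "2 * (\<bar>a\<bar> * \<bar>b\<bar>) \<le> a\<^sup>2 + b\<^sup>2"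
      using sum_squares_bound[of "\<bar>a\<bar>" "\<bar>b\<bar>"] by (simp add: mult.assoc)
    moreover have "0 \<le> \<bar>a\<bar> * \<bar>b\<bar>" by simp
    ultimately show ?thesis unfolding abs_mult by linarith
  qed
  then show "AE x in lebesgue_on \<omega>. norm (f x * g x) \<le> norm ((f x)\<^sup>2 + (g x)\<^sup>2)"
    by (intro AE_I2) simp
qed

text \<open>The entries of minus the weak Hessian, relative to those of \<open>F0\<close>, have this
  form. Boundedness of \<omega> makes the constants square integrable.\<close>

lemma L2_on_uminus_diff_const:
  fixes f :: "real^'n::finite \<Rightarrow> real"
  assumes "open \<omega>" "bounded \<omega>" "L2_on \<omega> f"
  shows "L2_on \<omega> (\<lambda>x. - f x - d)"
proof -
  interpret finite_measure "lebesgue_on \<omega>" by (rule finite_measure_lebesgue_on_bounded[OF assms(1,2)])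
  have 1: "L2_on \<omega> (\<lambda>x. 1)" by (rule L2_on_continuous[OF assms(1,2) continuous_on_const])
  have i: "integrable (lebesgue_on \<omega>) (\<lambda>x. (f x)\<^sup>2 + 2 * d * (f x * 1) + d\<^sup>2)"
    using L2_on_mult_integrable[OF assms(3) 1] assms(3) unfolding L2_on_def by simp
  have "(- f x - d)\<^sup>2 = (f x)\<^sup>2 + 2 * d * (f x * 1) + d\<^sup>2" for x
    by (simp add: power2_eq_square algebra_simps)
  then have "integrable (lebesgue_on \<omega>) (\<lambda>x. (- f x - d)\<^sup>2)" using i by simp
  moreover have "(\<lambda>x. - f x - d) \<in> borel_measurable (lebesgue_on \<omega>)"
    using assms(3) unfolding L2_on_def
    by (intro borel_measurable_diff borel_measurable_uminus borel_measurable_const) blast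
  ultimately show ?thesis unfolding L2_on_def by blast
qed

text \<open>Membership in \<open>W22\<close> provides some square integrable representative, while
  \<open>weak_hessian\<close> picks an arbitrary one; uniqueness of weak derivatives connects
  them.\<close>

lemma weak_hessian_L2:
  assumes \<omega>: "open \<omega>" and v: "v \<in> W22 \<omega>"
  shows "L2_on \<omega> (\<lambda>x. weak_hessian \<omega> v x $ i $ j)"
proof -
  have "length [i, j] \<le> 2" by simp
  then obtain g where g: "L2_on \<omega> g" "has_weak_derivative \<omega> [i, j] v g"
    using v unfolding W22_def by blast
  show ?thesis
    by (rule L2_on_cong_AE[OF g(1) \<omega> has_weak_derivative_unique[OF \<omega> g(2) weak_hessian_has_weak_derivative[OF v]]])
qed

lemma quadratic_in_W22:
  fixes v :: "real^'n::finite \<Rightarrow> real"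
  assumes \<omega>: "open \<omega>" "bounded \<omega>" and H: "transpose H = H"
    and v: "AE x in lebesgue_on \<omega>. v x = 1/2 * (x \<bullet> (H *v x)) + (a \<bullet> x + b)"
  shows "v \<in> W22 \<omega>" and "AE x in lebesgue_on \<omega>. weak_hessian \<omega> v x = H"
proof -
  let ?p = "\<lambda>x. 1/2 * (x \<bullet> (H *v x)) + (a \<bullet> x + b)"
  have v': "AE x in lebesgue_on \<omega>. ?p x = v x" using v by eventually_elim simp
  note q = has_weak_derivative_quadratic[OF \<omega>(1) H, where a=a and b=b]
  note cong = has_weak_derivative_cong_AE[OF _ \<omega>(1) v']
  have c0: "continuous_on UNIV ?p"
    by (rule Ck_continuous[OF partial_affine_quadratic(1)[OF H]])
  have c1: "continuous_on UNIV (\<lambda>x. (H *v x) $ i + a $ i)" for i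
    unfolding matrix_vector_mult_def vec_lambda_beta by (intro continuous_intros)
  have w2: "has_weak_derivative \<omega> [i, j] v (\<lambda>x. H $ i $ j)" for i j
    by (rule cong[OF q(1)]) simp
  have w1: "has_weak_derivative \<omega> [i] v (\<lambda>x. (H *v x) $ i + a $ i)" for i
    by (rule cong[OF q(2)]) simp
  have w0: "has_weak_derivative \<omega> [] v ?p"
    by (rule cong[OF q(3)]) simp
  have "\<exists>g. L2_on \<omega> g \<and> has_weak_derivative \<omega> is v g" if len: "length is \<le> 2" for "is"
  proof -
    consider "is = []" | i where "is = [i]" | i j where "is = [i, j]"
      using len by (cases "is" rule: list.exhaust; cases "tl is" rule: list.exhaust; cases "tl (tl is)" rule: list.exhaust) auto
    then show ?thesis
    proof cases
      case 1
      then show ?thesis using w0 L2_on_continuous[OF \<omega> c0] by blast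
    next
      case (2 i)
      then show ?thesis using w1[of i] L2_on_continuous[OF \<omega> c1[of i]] by blast
    next
      case (3 i j)
      then show ?thesis using w2[of i j] L2_on_continuous[OF \<omega> continuous_on_const] by blast
    qed
  qed
  then show W: "v \<in> W22 \<omega>" unfolding W22_def by blast
  have "AE x in lebesgue_on \<omega>. weak_hessian \<omega> v x $ i $ j = H $ i $ j" for i j
    by (rule has_weak_derivative_unique[OF \<omega>(1) weak_hessian_has_weak_derivative[OF W] w2])
  then have "AE x in lebesgue_on \<omega>. \<forall>i j. weak_hessian \<omega> v x $ i $ j = H $ i $ j"
    by (simp add: AE_all_countable)
  then show "AE x in lebesgue_on \<omega>. weak_hessian \<omega> v x = H"
    by eventually_elim (simp add: vec_eq_iff)
qed

section \<open>Characterisation of the minimisers\<close>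

lemma uminus_weak_hessian_sym: "- weak_hessian \<omega> v x \<in> (sym_matrices :: (real^2^2) set)"
  by (simp add: sym_matrices_iff weak_hessian_sym[of \<omega> v x 1 2])

lemma det_uminus_2: "det (- A) = det (A :: real^2^2)"
  by (simp add: det_2)

context plate_data
begin

lemma weak_hessian_constant:
  assumes \<omega>: "open \<omega>" "connected \<omega>" and v: "v \<in> W22 \<omega>"
    and ae: "AE x in lebesgue_on \<omega>. - weak_hessian \<omega> v x \<in> opt_curvatures Q2 B"
  shows "\<exists>H. AE x in lebesgue_on \<omega>. weak_hessian \<omega> v x = H"
proof -
  interpret coercive_form star_form "c / 12" f0 by (rule coercive_star_form)
  let ?F = "weak_hessian \<omega> v"
  note curl = weakly_curl_free_weak_hessian[OF v]
  from cone_nearest_structure show ?thesis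
  proof (rule disjE)
    assume "\<exists>a b. cone_nearest star_form f0 \<subseteq> {a, b} \<and>
      (a = b \<or> (a $ 1 - b $ 1) * (a $ 2 - b $ 2) \<noteq> (a $ 3 - b $ 3)\<^sup>2)"
    then obtain a b where sub: "cone_nearest star_form f0 \<subseteq> {a, b}"
      and ab: "a = b \<or> (a $ 1 - b $ 1) * (a $ 2 - b $ 2) \<noteq> (a $ 3 - b $ 3)\<^sup>2"
      by (elim exE conjE)
    show ?thesis
    proof (rule weakly_curl_free_two_values[OF \<omega> curl])
      show "AE x in lebesgue_on \<omega>. ?F x = - of_coords a \<or> ?F x = - of_coords b"
        using ae
      proof eventually_elim
        case (elim x)
        then have s: "- ?F x \<in> sym_matrices" and "coords (- ?F x) \<in> {a, b}"
          using sub by (auto simp: opt_curvatures_iff)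
        then have "- ?F x = of_coords a \<or> - ?F x = of_coords b"
          using of_coords_coords[OF s] by auto
        then show ?case by (metis minus_minus)
      qed
      have "det (- of_coords a - - of_coords b) = (a $ 1 - b $ 1) * (a $ 2 - b $ 2) - (a $ 3 - b $ 3)\<^sup>2"
        by (simp add: det_2 of_coords_def power2_eq_square algebra_simps)
      then show "- of_coords a = - of_coords b \<or> det (- of_coords a - - of_coords b) \<noteq> 0"
        using ab by auto
    qed
  next
    assume "\<exists>\<alpha> \<tau> k. \<tau> > 0 \<and> (\<forall>a\<in>cone_nearest star_form f0. (\<alpha>\<^sup>2 + \<tau>\<^sup>2) * a $ 1 - 2 * \<alpha> * a $ 3 + a $ 2 = k)"
    then obtain \<alpha> \<tau> k where \<tau>: "\<tau> > 0"
      and rel: "\<forall>a\<in>cone_nearest star_form f0. (\<alpha>\<^sup>2 + \<tau>\<^sup>2) * a $ 1 - 2 * \<alpha> * a $ 3 + a $ 2 = k"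
      by (elim exE conjE)
    show ?thesis
    proof (rule weakly_curl_free_elliptic[OF \<omega> curl \<tau>])
      show "?F x $ 2 $ 1 = ?F x $ 1 $ 2" for x by (rule weak_hessian_sym)
      show "AE x in lebesgue_on \<omega>. det (?F x) = 0 \<and>
        (\<alpha>\<^sup>2 + \<tau>\<^sup>2) * ?F x $ 1 $ 1 - 2 * \<alpha> * ?F x $ 1 $ 2 + ?F x $ 2 $ 2 = - k"
        using ae
      proof eventually_elim
        case (elim x)
        then have s: "- ?F x \<in> sym_matrices" and n: "coords (- ?F x) \<in> cone_nearest star_form f0"
          by (auto simp: opt_curvatures_iff)
        have "det (- ?F x) = 0"
          using n by (simp add: det_eq_0_iff_coords[OF s] cone_nearest_def)
        moreover have "(\<alpha>\<^sup>2 + \<tau>\<^sup>2) * (- ?F x $ 1 $ 1) - 2 * \<alpha> * (- ?F x $ 1 $ 2) + (- ?F x $ 2 $ 2) = k"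
          using rel n by (auto simp: coords_def)
        ultimately show ?case by (simp add: det_uminus_2)
      qed
    qed
  qed
qed

lemma minimal_curvature_imp_quadratic:
  assumes \<omega>: "open \<omega>" "connected \<omega>" "\<omega> \<noteq> {}" and v: "v \<in> W22 \<omega>"
    and ae: "AE x in lebesgue_on \<omega>. - weak_hessian \<omega> v x \<in> opt_curvatures Q2 B"
  shows "\<exists>F\<in>opt_curvatures Q2 B. \<exists>a b. AE x in lebesgue_on \<omega>. v x = - (1/2 * (x \<bullet> (F *v x))) + (a \<bullet> x + b)"
proof -
  obtain H where H: "AE x in lebesgue_on \<omega>. weak_hessian \<omega> v x = H"
    using weak_hessian_constant[OF \<omega>(1,2) v ae] by blast
  \<comment> \<open>The property no longer involves x, so holding almost everywhere on a nonempty
    open set it simply holds.\<close>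
  have "AE x in lebesgue_on \<omega>. - H \<in> opt_curvatures Q2 B"
    using H ae by eventually_elim simp
  then have "AE x in lebesgue. x \<in> \<omega> \<longrightarrow> - H \<in> opt_curvatures Q2 B"
    by (simp only: AE_lebesgue_on_open_iff[OF \<omega>(1)])
  from AE_open_ex[OF \<omega>(1,3) this] have HN: "- H \<in> opt_curvatures Q2 B" by blast
  then have "- H \<in> sym_matrices" by (simp add: opt_curvatures_iff)
  then have "transpose H = H" by (simp add: sym_matrices_def transpose_def vec_eq_iff)
  from W22_constant_hessian_imp_quadratic[OF \<omega>(1,2) v this H]
  obtain a b where "AE x in lebesgue_on \<omega>. v x = 1/2 * (x \<bullet> (H *v x)) + (a \<bullet> x + b)" by blast
  moreover have "(- H) *v x = - (H *v x)" for x
    by (simp add: matrix_vector_mult_def vec_eq_iff sum_negf)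
  ultimately have "AE x in lebesgue_on \<omega>. v x = - (1/2 * (x \<bullet> ((- H) *v x))) + (a \<bullet> x + b)" by simp
  then show ?thesis using HN by blast
qed

lemma quadratic_imp_minimal_curvature:
  assumes \<omega>: "open \<omega>" "bounded \<omega>" and F: "F \<in> opt_curvatures Q2 B"
    and v: "AE x in lebesgue_on \<omega>. v x = - (1/2 * (x \<bullet> (F *v x))) + (a \<bullet> x + d)"
  shows "v \<in> W22sh \<omega>" and "AE x in lebesgue_on \<omega>. - weak_hessian \<omega> v x \<in> opt_curvatures Q2 B"
proof -
  have Fs: "F \<in> sym_matrices" using F by (simp add: opt_curvatures_iff)
  have t: "transpose (- F) = - F" using Fs by (simp add: sym_matrices_def transpose_def vec_eq_iff)
  have neg: "(- F) *v x = - (F *v x)" for x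
    by (simp add: matrix_vector_mult_def vec_eq_iff sum_negf)
  have v': "AE x in lebesgue_on \<omega>. v x = 1/2 * (x \<bullet> ((- F) *v x)) + (a \<bullet> x + d)"
    using v by eventually_elim (simp add: neg)
  note q = quadratic_in_W22[OF \<omega> t v']
  have "det (- F) = 0"
    using F unfolding opt_curvatures_def is_arg_min_linorder by (simp add: det_uminus_2)
  then have "AE x in lebesgue_on \<omega>. det (weak_hessian \<omega> v x) = 0"
    using q(2) by (auto elim: eventually_mono)
  then show "v \<in> W22sh \<omega>" using q(1) unfolding W22sh_def by blast
  show "AE x in lebesgue_on \<omega>. - weak_hessian \<omega> v x \<in> opt_curvatures Q2 B"
    using q(2) by eventually_elim (simp add: F)
qed

text \<open>Integrability is needed to split off the additive constant and to infer from a zero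
  integral of a nonnegative function that it vanishes almost everywhere; otherwise the value 0 could
  be a mere convention.\<close>

lemma Qstar_hessian_integrable:
  assumes \<omega>: "open \<omega>" "bounded \<omega>" and v: "v \<in> W22 \<omega>"
  shows "integrable (lebesgue_on \<omega>) (\<lambda>x. Qstar Q2 (- weak_hessian \<omega> v x - F0 Q2 B))"
proof -
  define w where "w x = coords (- weak_hessian \<omega> v x) - f0" for x
  have "\<forall>k. L2_on \<omega> (\<lambda>x. w x $ k)"
    unfolding forall_3 w_def
    using L2_on_uminus_diff_const[OF \<omega> weak_hessian_L2[OF \<omega>(1) v]] by (simp add: coords_def)
  then have L: "L2_on \<omega> (\<lambda>x. w x $ k)" for k by blast
  have "integrable (lebesgue_on \<omega>) (\<lambda>x. \<Sum>i\<in>UNIV. \<Sum>j\<in>UNIV. Ms $ i $ j * (w x $ i * w x $ j))"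
    by (intro Bochner_Integration.integrable_sum integrable_mult_right L2_on_mult_integrable L)
  moreover have "(\<Sum>i\<in>UNIV. \<Sum>j\<in>UNIV. Ms $ i $ j * (w x $ i * w x $ j)) = Qstar Q2 (- weak_hessian \<omega> v x - F0 Q2 B)" for x
    unfolding Qstar_eq w_def[symmetric] star_form_def inner_vec_def matrix_vector_mult_def
    by (simp add: sum_distrib_left mult_ac)
  ultimately show ?thesis by simp
qed

text \<open>The constrained pointwise minimum m is attained by a constant matrix, which is the
  Hessian of a quadratic polynomial up to sign. The pointwise lower bound is thus the infimum of the
  functional, and a minimiser must attain it almost everywhere.\<close>

lemma minimisers_characterisation:
  assumes \<omega>: "open \<omega>" "connected \<omega>" "bounded \<omega>" "\<omega> \<noteq> {}"
  shows "is_arg_min (I_lKi Q2 B \<omega>) (\<lambda>_. True) v \<longleftrightarrow>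
    (\<exists>F\<in>opt_curvatures Q2 B. \<exists>a b. AE x in lebesgue_on \<omega>. v x = - (1/2 * (x \<bullet> (F *v x))) + (a \<bullet> x + b))"
proof -
  interpret fm: finite_measure "lebesgue_on \<omega>"
    by (rule finite_measure_lebesgue_on_bounded[OF \<omega>(1,3)])
  obtain Fm where Fm: "Fm \<in> opt_curvatures Q2 B" using opt_curvatures_nonempty by blast
  define m where "m = Qstar Q2 (Fm - F0 Q2 B)"
  have m_le: "m \<le> Qstar Q2 (F - F0 Q2 B)" if "F \<in> sym_matrices" "det F = 0" for F
    using Fm that unfolding opt_curvatures_def is_arg_min_linorder m_def by blast
  have opt_iff: "F \<in> opt_curvatures Q2 B \<longleftrightarrow> Qstar Q2 (F - F0 Q2 B) = m" if "F \<in> sym_matrices" "det F = 0" for F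
  proof
    assume "F \<in> opt_curvatures Q2 B"
    then have "Qstar Q2 (F - F0 Q2 B) \<le> m"
      using Fm unfolding opt_curvatures_def is_arg_min_linorder m_def by blast
    then show "Qstar Q2 (F - F0 Q2 B) = m" using m_le[OF that] by linarith
  next
    assume "Qstar Q2 (F - F0 Q2 B) = m"
    then show "F \<in> opt_curvatures Q2 B"
      unfolding opt_curvatures_def is_arg_min_linorder using that m_le by simp
  qed
  \<comment> \<open>The pointwise excess over m. It is nonnegative where the determinant vanishes,
    and the functional is half its integral plus a constant.\<close>
  define S where "S w x = Qstar Q2 (- weak_hessian \<omega> w x - F0 Q2 B) - m" for w x
  define K where "K = (LINT x|lebesgue_on \<omega>. m + kappa)"
  have Si: "integrable (lebesgue_on \<omega>) (S w)" if "w \<in> W22sh \<omega>" for w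
    unfolding S_def using Qstar_hessian_integrable[OF \<omega>(1,3), of w] that
    by (simp add: W22sh_def)
  have det0: "AE x in lebesgue_on \<omega>. det (- weak_hessian \<omega> w x) = 0" if "w \<in> W22sh \<omega>" for w
    using that unfolding W22sh_def det_uminus_2 by blast
  have Snn: "AE x in lebesgue_on \<omega>. 0 \<le> S w x" if "w \<in> W22sh \<omega>" for w
    using det0[OF that] by eventually_elim (simp add: S_def m_le uminus_weak_hessian_sym)
  have I: "I_lKi Q2 B \<omega> w = ereal (1/2 * ((LINT x|lebesgue_on \<omega>. S w x) + K))" if "w \<in> W22sh \<omega>" for w
  proof -
    have "Qbar Q2 B (- weak_hessian \<omega> w x) = S w x + (m + kappa)" for x
      using Qbar_eq_Qstar[OF uminus_weak_hessian_sym] by (simp add: S_def)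
    then have "(LINT x|lebesgue_on \<omega>. Qbar Q2 B (- weak_hessian \<omega> w x)) = (LINT x|lebesgue_on \<omega>. S w x + (m + kappa))"
      by simp
    also have "\<dots> = (LINT x|lebesgue_on \<omega>. S w x) + K"
      unfolding K_def by (rule Bochner_Integration.integral_add[OF Si[OF that] fm.integrable_const])
    finally show ?thesis using that by (simp add: I_lKi_def)
  qed
  have zero_iff: "(LINT x|lebesgue_on \<omega>. S w x) = 0 \<longleftrightarrow> (AE x in lebesgue_on \<omega>. - weak_hessian \<omega> w x \<in> opt_curvatures Q2 B)"
    if "w \<in> W22sh \<omega>" for w
  proof -
    have "(LINT x|lebesgue_on \<omega>. S w x) = 0 \<longleftrightarrow> (AE x in lebesgue_on \<omega>. S w x = 0)"
      by (rule integral_nonneg_eq_0_iff_AE[OF Si[OF that] Snn[OF that]])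
    also have "\<dots> \<longleftrightarrow> (AE x in lebesgue_on \<omega>. - weak_hessian \<omega> w x \<in> opt_curvatures Q2 B)"
    proof
      assume "AE x in lebesgue_on \<omega>. S w x = 0"
      with det0[OF that] show "AE x in lebesgue_on \<omega>. - weak_hessian \<omega> w x \<in> opt_curvatures Q2 B"
        by eventually_elim (simp add: opt_iff[OF uminus_weak_hessian_sym] S_def)
    next
      assume "AE x in lebesgue_on \<omega>. - weak_hessian \<omega> w x \<in> opt_curvatures Q2 B"
      with det0[OF that] show "AE x in lebesgue_on \<omega>. S w x = 0"
        by eventually_elim (simp add: opt_iff[OF uminus_weak_hessian_sym] S_def)
    qed
    finally show ?thesis .
  qed
  have nonneg: "(LINT x|lebesgue_on \<omega>. S w x) \<ge> 0" if "w \<in> W22sh \<omega>" for w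
    by (rule integral_nonneg_AE[OF Snn[OF that]])
  show ?thesis
  proof
    assume min: "is_arg_min (I_lKi Q2 B \<omega>) (\<lambda>_. True) v"
    \<comment> \<open>This competitor has excess 0; its finite value also forces any minimiser into
      \<open>W22sh\<close>.\<close>
    define v0 where "v0 x = - (1/2 * (x \<bullet> (Fm *v x))) + ((0::real^2) \<bullet> x + 0)" for x
    have "AE x in lebesgue_on \<omega>. v0 x = - (1/2 * (x \<bullet> (Fm *v x))) + ((0::real^2) \<bullet> x + 0)"
      by (simp add: v0_def)
    note v0 = quadratic_imp_minimal_curvature[OF \<omega>(1,3) Fm this]
    have le: "I_lKi Q2 B \<omega> v \<le> I_lKi Q2 B \<omega> v0"
      using min unfolding is_arg_min_linorder by blast
    have S0: "(LINT x|lebesgue_on \<omega>. S v0 x) = 0" using zero_iff[OF v0(1)] v0(2) by blast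
    have vW: "v \<in> W22sh \<omega>"
    proof (rule ccontr)
      assume "v \<notin> W22sh \<omega>"
      then have "I_lKi Q2 B \<omega> v = \<infinity>" by (simp add: I_lKi_def)
      then show False using le unfolding I[OF v0(1)] by simp
    qed
    have "(LINT x|lebesgue_on \<omega>. S v x) \<le> 0"
      using le unfolding I[OF vW] I[OF v0(1)] S0 by simp
    then have "(LINT x|lebesgue_on \<omega>. S v x) = 0" using nonneg[OF vW] by linarith
    then have "AE x in lebesgue_on \<omega>. - weak_hessian \<omega> v x \<in> opt_curvatures Q2 B"
      using zero_iff[OF vW] by blast
    moreover have "v \<in> W22 \<omega>" using vW unfolding W22sh_def by blast
    ultimately show "\<exists>F\<in>opt_curvatures Q2 B. \<exists>a b. AE x in lebesgue_on \<omega>. v x = - (1/2 * (x \<bullet> (F *v x))) + (a \<bullet> x + b)"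
      by (intro minimal_curvature_imp_quadratic[OF \<omega>(1,2,4)])
  next
    assume "\<exists>F\<in>opt_curvatures Q2 B. \<exists>a b. AE x in lebesgue_on \<omega>. v x = - (1/2 * (x \<bullet> (F *v x))) + (a \<bullet> x + b)"
    then obtain F a b where F: "F \<in> opt_curvatures Q2 B"
      "AE x in lebesgue_on \<omega>. v x = - (1/2 * (x \<bullet> (F *v x))) + (a \<bullet> x + b)"
      by (elim bexE exE)
    note v = quadratic_imp_minimal_curvature[OF \<omega>(1,3) F]
    have Sv: "(LINT x|lebesgue_on \<omega>. S v x) = 0" using zero_iff[OF v(1)] v(2) by blast
    have "I_lKi Q2 B \<omega> v \<le> I_lKi Q2 B \<omega> w" for w
    proof (cases "w \<in> W22sh \<omega>")
      case True
      then show ?thesis unfolding I[OF v(1)] I[OF True] Sv using nonneg[OF True] by simp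
    qed (simp add: I_lKi_def)
    then show "is_arg_min (I_lKi Q2 B \<omega>) (\<lambda>_. True) v"
      unfolding is_arg_min_linorder by simp
  qed
qed

end

text \<open>The functional evaluates \<open>Qbar\<close> at minus the Hessian, so an optimal F is
  minus the Hessian of the minimiser, whence the sign of the quadratic term. Equality almost
  everywhere is the equality of Sobolev functions.\<close>

theorem theorem2:
  fixes \<omega> :: "(real^2) set"
    and Q2 :: "real \<Rightarrow> real^2^2 \<Rightarrow> real"
    and B :: "real \<Rightarrow> real^2^2"
    and c C :: real
    and v :: "real^2 \<Rightarrow> real"
  assumes "bounded_lipschitz_domain \<omega>"
    and "c > 0" and "C > 0"
    and "admissible_form c C Q2"
    and "Linf_sym B"
  shows "is_arg_min (I_lKi Q2 B \<omega>) (\<lambda>_. True) v \<longleftrightarrow>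
    (\<exists>F\<in>opt_curvatures Q2 B. \<exists>(a :: real^2) (b :: real).
       AE x in lebesgue_on \<omega>. v x = - (1/2 * (x \<bullet> (F *v x))) + (a \<bullet> x + b))"
proof -
  interpret plate_data Q2 B c C
    using assms(2,4,5) by unfold_locales
  show ?thesis
    using assms(1) unfolding bounded_lipschitz_domain_def
    by (intro minimisers_characterisation) blast+
qed

end
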